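(* Let $k\in\mathbb{Z}$, $c>1$, and $p,q,r\ge0$ with $p+q+r=1$, and assume $p>0$, $r>0$ and $p\ne r$. (i) Let $k=0$. If $(r/p)\wedge(p/r)\le q$, then $\rho^{(0)\,\mathrm{sym}},\mu^{(0)\,\mathrm{sym}}\in ID$. Conversely, if $(r/p)\wedge(p/r)>q$, then $\rho^{(0)\,\mathrm{sym}},\mu^{(0)\,\mathrm{sym}}\in ID^0$. (ii) Let $k>0$. Then $\rho^{(k)\,\mathrm{sym}}\in ID$ if and only if $c^k=2$ and $(r/p)^2\wedge(p/r)^2\le q$. (iii) Let $k>0$. Then $\mu^{(k)\,\mathrm{sym}}\in ID$ if and only if one of the following holds: (a) $(r/p)\wedge(p/r)\le q$; (b) $c^l=2$ for some $l\in\{1,2,\ldots,k\}$ and $(r/p)^2\wedge(p/r)^2\le q$. (iv) Let $k<0$. Then $\rho^{(k)\,\mathrm{sym}}\in ID$ if and only if $2c^{|k|}\in\mathbb{N}$ and $q^l\ge(l/2)[(r/p)^2\wedge(p/r)^2]$ for $l=2c^{|k|}$. (v) Let $k<0$. If $2c^j\notin\mathbb{N}$ for all integers $j$ satisfying $j\ge|k|$, then $\mu^{(k)\,\mathrm{sym}}\in ID^0$. (vi) Let $k<0$. Suppose that $c^j\in\mathbb{N}$ for some $j\in\mathbb{N}$. Let $l$ be the smallest of such $j$ and let $\alpha=c^l$, $\beta=\lceil|k|/l\rceil$. Then $\mu^{(k)\,\mathrm{sym}}\in ID$ if and only if $q>0$ and $h_{\alpha,\beta}(q^{\alpha^\beta})\ge(r/p)\wedge(p/r)$.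 (vii) Let $k<0$. Suppose that $2c^j\in\mathbb{N}_{\mathrm{odd}}$ for some $j\in\mathbb{N}$ with $j\ge|k|$. Then $j$ is unique. Let $\alpha=c^j$ and suppose that $2\alpha\ge5$. Then $\mu^{(k)\,\mathrm{sym}}\in ID$ if and only if $q^{2\alpha}+((r/p)\wedge(p/r))^{2\alpha}\ge\alpha((r/p)\wedge(p/r))^2$.
   Context: $\mathbb{N}=\{1,2,\ldots\}$, $\mathbb{N}_{\mathrm{odd}}$ is the set of odd positive integers, $a\wedge b=\min(a,b)$, $\lceil x\rceil$ is the smallest integer $\ge x$. For $k\in\mathbb{Z}$ let $\{(N_t^{(k)},L_t^{(k)}),t\ge0\}$ be the bivariate compound Poisson process (pure jump, no drift) with $E[e^{i(z_1N_t^{(k)}+z_2L_t^{(k)})}]=\exp[t\int_{\mathbb{R}^2}(e^{i(z_1x_1+z_2x_2)}-1)\nu^{(k)}(dx)]$, where $\nu^{(k)}$ is concentrated on the points $(1,0)$, $(0,1)$, $(1,c^{-k})$ with masses $u,v,w\ge0$ respectively, and $p=u/(u+v+w)$, $q=v/(u+v+w)$, $r=w/(u+v+w)$. Let $T$ be the first jump time of $\{N_t^{(k)}\}$. Define $\rho^{(k)}$ as the distribution of $L_T^{(k)}$, and $\mu^{(k)}$ as the distribution of $\int_0^{\infty-}c^{-N^{(k)}_{s-}}\,dL_s^{(k)}$ (the almost sure limit of $\int_0^t$ as $t\to\infty$, which exists). These depend on $u,v,w$ only through $p,q,r$. The symmetrization $\sigma^{\mathrm{sym}}$ of a distribution $\sigma$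 is the distribution with characteristic function $|\widehat\sigma(z)|^2$; $\rho^{(k)\,\mathrm{sym}},\mu^{(k)\,\mathrm{sym}}$ are the symmetrizations of $\rho^{(k)},\mu^{(k)}$. The functions $h_{\alpha,\gamma}$. For integers $\alpha\ge2$ and $\gamma\ge1$ let $F_\alpha(x)=\sum_{n=0}^\infty\alpha^{-n}x^{2\alpha^n}$ for $0\le x\le1$ (continuous, strictly increasing, $F_\alpha(0)=0$); for $0<x\le1$ let $h_{\alpha,\gamma}(x)\in(0,x)$ be the unique number with $\alpha^{-\gamma}F_\alpha(x)=F_\alpha(h_{\alpha,\gamma}(x))$. A distribution $\sigma$ on $\mathbb{R}$ is quasi-infinitely divisible if its characteristic function is $\widehat\sigma(z)=\exp[i\gamma z-az^2+\int_{\mathbb{R}}(e^{izx}-1-izx1_{[-1,1]}(x))\,\nu_\sigma(dx)]$, where $\gamma,a\in\mathbb{R}$ and $\nu_\sigma$ is a signed measure (a difference $\nu_\sigma^+-\nu_\sigma^-$ of mutually singular measures, possibly both of infinite mass near $0$) with total variation measure $|\nu_\sigma|$ satisfying $\nu_\sigma(\{0\})=0$ and $\int(x^2\wedge1)\,|\nu_\sigma|(dx)<\infty$. $ID$ is the class of infinitely divisible distributions on $\mathbb{R}$; $ID^0$ is the class of quasi-infinitely divisible distributions that are not infinitely divisible. *)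

theory Defs
  imports "HOL-Probability.Probability"
begin

subsection \<open>Infinite and quasi-infinite divisibility\<close>

primrec convolution_power :: "nat \<Rightarrow> real measure \<Rightarrow> real measure" where
  "convolution_power 0 \<sigma> = return borel 0"
| "convolution_power (Suc n) \<sigma> = convolution \<sigma> (convolution_power n \<sigma>)"

definition ID :: "real measure set" where
  "ID = {\<sigma>. real_distribution \<sigma> \<and>
     (\<forall>n\<ge>1. \<exists>\<tau>. real_distribution \<tau> \<and> \<sigma> = convolution_power n \<tau>)}"

definition mutually_singular :: "'a measure \<Rightarrow> 'a measure \<Rightarrow> bool" where
  "mutually_singular \<mu> \<nu> \<longleftrightarrow> sets \<mu> = sets \<nu> \<and>
     (\<exists>A\<in>sets \<mu>. emeasure \<mu> A = 0 \<and> emeasure \<nu> (space \<nu> - A) = 0)"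

text \<open>The signed measure of the Levy-Khintchine representation may have infinite positive and
  infinite negative part, so it is given by the pair \<open>(\<nu>p, \<nu>m)\<close> of its Jordan components; its total
  variation is \<open>\<nu>p + \<nu>m\<close>.\<close>

definition quasi_infinitely_divisible :: "real measure \<Rightarrow> bool" where
  "quasi_infinitely_divisible \<sigma> \<longleftrightarrow> real_distribution \<sigma> \<and>
     (\<exists>(\<gamma>::real) (a::real) (\<nu>p::real measure) (\<nu>m::real measure).
        sets \<nu>p = sets borel \<and> sets \<nu>m = sets borel \<and> mutually_singular \<nu>p \<nu>m \<and>
        emeasure \<nu>p {0} = 0 \<and> emeasure \<nu>m {0} = 0 \<and>
        (\<integral>\<^sup>+x. ennreal (min (x^2) 1) \<partial>\<nu>p) < \<infinity> \<and>
        (\<integral>\<^sup>+x. ennreal (min (x^2) 1) \<partial>\<nu>m) < \<infinity> \<and>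
        (\<forall>z. char \<sigma> z =
           exp (\<i> * complex_of_real (\<gamma> * z) - complex_of_real (a * z^2)
             + ((CLINT x|\<nu>p. iexp (z * x) - 1 - \<i> * complex_of_real (z * x * indicator {-1..1} x))
              - (CLINT x|\<nu>m. iexp (z * x) - 1 - \<i> * complex_of_real (z * x * indicator {-1..1} x))))))"

definition ID0 :: "real measure set" where
  "ID0 = {\<sigma>. quasi_infinitely_divisible \<sigma> \<and> \<sigma> \<notin> ID}"

definition symmetrization :: "real measure \<Rightarrow> real measure" where
  "symmetrization \<sigma> =
     (THE \<tau>. real_distribution \<tau> \<and> (\<forall>z. char \<tau> z = complex_of_real ((cmod (char \<sigma> z))^2)))"


subsection \<open>Compound Poisson processes\<close>

definition cadlag :: "(real \<Rightarrow> 'b::topological_space) \<Rightarrow> bool" where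
  "cadlag f \<longleftrightarrow> (\<forall>t\<ge>0. (f \<longlongrightarrow> f t) (at_right t)) \<and> (\<forall>t>0. \<exists>l. (f \<longlongrightarrow> l) (at_left t))"

text \<open>Processes are indexed by all reals, but only times \<open>t \<ge> 0\<close> matter.\<close>

definition levy_process :: "'a measure \<Rightarrow> (real \<Rightarrow> 'a \<Rightarrow> 'b::euclidean_space) \<Rightarrow> bool" where
  "levy_process M Z \<longleftrightarrow> prob_space M \<and>
     (\<forall>t\<ge>0. Z t \<in> borel_measurable M) \<and>
     (AE \<omega> in M. Z 0 \<omega> = 0) \<and>
     (\<forall>(n::nat) (ts::nat \<Rightarrow> real). 0 \<le> ts 0 \<and> (\<forall>i<n. ts i < ts (Suc i)) \<longrightarrow>
        prob_space.indep_vars M (\<lambda>_. borel) (\<lambda>i \<omega>. Z (ts (Suc i)) \<omega> - Z (ts i) \<omega>) {..<n}) \<and>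
     (\<forall>s\<ge>0. \<forall>t\<ge>0. distr M borel (\<lambda>\<omega>. Z (s + t) \<omega> - Z s \<omega>) = distr M borel (Z t)) \<and>
     (AE \<omega> in M. cadlag (\<lambda>t. Z t \<omega>))"

definition compound_poisson_process ::
  "'a measure \<Rightarrow> (real \<Rightarrow> 'a \<Rightarrow> 'b::euclidean_space) \<Rightarrow> 'b measure \<Rightarrow> bool" where
  "compound_poisson_process M Z \<nu> \<longleftrightarrow> levy_process M Z \<and>
     finite_measure \<nu> \<and> sets \<nu> = sets borel \<and> emeasure \<nu> {0} = 0 \<and>
     (\<forall>t\<ge>0. \<forall>z. (CLINT \<omega>|M. iexp (z \<bullet> Z t \<omega>)) =
        exp (complex_of_real t * (CLINT x|\<nu>. iexp (z \<bullet> x) - 1)))"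

definition levy_measure :: "real \<Rightarrow> int \<Rightarrow> real \<Rightarrow> real \<Rightarrow> real \<Rightarrow> (real \<times> real) measure" where
  "levy_measure c k u v w =
     distr (point_measure {(1, 0), (0, 1), (1, c powi (-k))}
              (\<lambda>x. ennreal (if x = (1, 0) then u else if x = (0, 1) then v else w)))
           borel (\<lambda>x. x)"

lemma emeasure_levy_measure:
  assumes "c > 0" "A \<in> sets borel"
  shows "emeasure (levy_measure c k u v w) A =
    ennreal u * indicator A (1, 0) + ennreal v * indicator A (0, 1)
      + ennreal w * indicator A (1, c powi (-k))"
proof -
  define S :: "(real \<times> real) set" where "S = {(1, 0), (0, 1), (1, c powi (-k))}"
  define f where "f = (\<lambda>x::real \<times> real. ennreal (if x = (1, 0) then u else if x = (0, 1) then v else w))"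
  define d where "d = c powi (-k)"
  have d: "d \<noteq> 0" using assms(1) by (simp add: d_def)
  have S: "finite S" by (simp add: S_def)
  have "emeasure (levy_measure c k u v w) A = emeasure (point_measure S f) (A \<inter> S)"
    unfolding levy_measure_def S_def[symmetric] f_def[symmetric] using assms(2)
    by (subst emeasure_distr) (simp_all add: space_point_measure S)
  also have "\<dots> = (\<Sum>x\<in>A \<inter> S. f x)"
    using S by (intro emeasure_point_measure_finite) simp_all
  also have "\<dots> = (\<Sum>x\<in>S. f x * indicator A x)"
    using S by (intro sum.mono_neutral_cong_left) (auto simp: indicator_def split: if_splits)
  also have "\<dots> = ennreal u * indicator A (1, 0) + ennreal v * indicator A (0, 1)
      + ennreal w * indicator A (1, c powi (-k))"
    unfolding S_def f_def d_def[symmetric] using d d[symmetric]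
    by (simp only: sum.insert sum.empty finite.intros insert_iff empty_iff prod.inject zero_neq_one
          one_neq_zero simp_thms if_True if_False add.assoc add_0_right)
  finally show ?thesis .
qed

definition left_limit :: "(real \<Rightarrow> real) \<Rightarrow> real \<Rightarrow> real" where
  "left_limit f t = Lim (at_left t) f"

definition first_jump_time :: "(real \<Rightarrow> real) \<Rightarrow> real" where
  "first_jump_time f = Inf {t. 0 < t \<and> f t \<noteq> left_limit f t}"

text \<open>The random variables below are determined, and measurable, only up to a null set on which the
  paths are arbitrary; hence their laws are taken with respect to the completion of \<open>M\<close>.\<close>

definition rho :: "'a measure \<Rightarrow> (real \<Rightarrow> 'a \<Rightarrow> real) \<Rightarrow> (real \<Rightarrow> 'a \<Rightarrow> real) \<Rightarrow> real measure" where
  "rho M N L = distr (completion M) borel (\<lambda>\<omega>. L (first_jump_time (\<lambda>t. N t \<omega>)) \<omega>)"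

text \<open>Pathwise Lebesgue-Stieltjes integral over \<open>(0, t]\<close>; almost all paths of \<open>L\<close> are
  right-continuous and nondecreasing on \<open>[0, \<infinity>)\<close>, and \<open>max 0 s\<close> extends them to the real line.\<close>

definition exp_integral ::
  "real \<Rightarrow> (real \<Rightarrow> 'a \<Rightarrow> real) \<Rightarrow> (real \<Rightarrow> 'a \<Rightarrow> real) \<Rightarrow> real \<Rightarrow> 'a \<Rightarrow> real" where
  "exp_integral c N L t \<omega> =
     (LINT s:{0<..t}|interval_measure (\<lambda>s. L (max 0 s) \<omega>). c powr (- left_limit (\<lambda>s. N s \<omega>) s))"

definition mu :: "real \<Rightarrow> 'a measure \<Rightarrow> (real \<Rightarrow> 'a \<Rightarrow> real) \<Rightarrow> (real \<Rightarrow> 'a \<Rightarrow> real) \<Rightarrow> real measure" where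
  "mu c M N L = distr (completion M) borel (\<lambda>\<omega>. Lim at_top (\<lambda>t. exp_integral c N L t \<omega>))"


subsection \<open>The functions \<open>h\<close>\<close>

definition F_fun :: "nat \<Rightarrow> real \<Rightarrow> real" where
  "F_fun \<alpha> x = (\<Sum>n. (1 / real \<alpha>) ^ n * x ^ (2 * \<alpha> ^ n))"

definition h_fun :: "nat \<Rightarrow> nat \<Rightarrow> real \<Rightarrow> real" where
  "h_fun \<alpha> \<gamma> x = (THE y. 0 < y \<and> y < x \<and> (1 / real \<alpha>) ^ \<gamma> * F_fun \<alpha> x = F_fun \<alpha> y)"

end

theory Submission
  imports Defs "HOL-Computational_Algebra.Primes"
begin

text \<open>Splitting at the first jump of \<open>N\<close> gives the characteristic function
  \<open>\<kappa>/\<theta>\<close> of \<open>\<rho>\<close>, with \<open>\<theta>(z) = 1 - q e^{iz}\<close> and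
  \<open>\<kappa>(z) = p + r e^{iz/c^k}\<close> up to a common factor, and that of \<open>\<mu>\<close> is
  the product of \<open>\<kappa>/\<theta>\<close> over the points \<open>z/c^n\<close>. The logarithm of its squared
  modulus expands into a cosine series: with \<open>a = min(r/p, p/r) < 1\<close>, the
  symmetrization of \<open>\<rho>\<close> has the signed Levy measure with masses \<open>q^m/m\<close> at
  \<open>\<plusminus>m\<close> and \<open>-(-a)^m/m\<close> at \<open>\<plusminus>m/c^k\<close>, and that of \<open>\<mu>\<close> the sum
  of the images of this measure under the scalings by \<open>c^{-n}\<close>. A symmetric law with such an exponent
  is infinitely divisible iff no mass is negative, so everything reduces to the arithmetic of the
  coincidences between the points \<open>m\<close> and \<open>j/c^{k+n}\<close>.\<close>

section \<open>Laws with a symmetric purely atomic Levy measure\<close>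

text \<open>The process is given only by its finite-dimensional laws and the cadlag property, so its
  jumps are never enumerated. The value at the first jump and the integral are approximated on grids
  of mesh 1/(n+1), where stationarity and independence of increments give exact products, and the
  mesh then goes to 0. For the integral the transform is guessed first: the infinite product solves
  the stationarity equation of the pair (integral, N), which makes a grid quantity an approximate
  martingale.

  One analytic device recurs. A standard normal \<xi> satisfies E iexp(\<xi> s x) = exp(-(s x)^2/2),
  so averaging a Fourier identity over \<xi> turns it into an integral against a Gaussian kernel. As
  s goes to infinity the kernel isolates a single atom (of the Levy measure, or of N t); as s goes
  to 0 it controls the mass far out (tightness, finiteness of the integral). In particular the sign
  of each Levy mass is read off the convolution roots themselves.\<close>

lemma integral_iexp_std_normal:
  "(CLINT \<xi>|std_normal_distribution. iexp (t * \<xi>)) = complex_of_real (exp (- (t^2) / 2))"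
  using fun_cong[OF char_std_normal_distribution, of t] by (simp add: char_def)

text \<open>The complex weight \<open>f\<close> lets the same exchange serve for a density, for a
  second exponential factor and for the constant 1.\<close>

lemma integral_std_normal_swap:
  fixes f :: "'a \<Rightarrow> complex"
  assumes "sigma_finite_measure M" "X \<in> borel_measurable M" "integrable M f"
  shows "(CLINT \<xi>|std_normal_distribution. (CLINT \<omega>|M. f \<omega> * iexp (\<xi> * X \<omega>)))
    = (CLINT \<omega>|M. f \<omega> * complex_of_real (exp (- ((X \<omega>)^2) / 2)))"
proof -
  interpret M: sigma_finite_measure M by fact
  interpret G: real_distribution std_normal_distribution by (rule real_dist_normal_dist)
  interpret P: pair_sigma_finite M std_normal_distribution ..
  note [measurable] = assms(2) borel_measurable_integrable[OF assms(3)]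
  have int: "integrable (M \<Otimes>\<^sub>M std_normal_distribution) (case_prod (\<lambda>\<omega> \<xi>. f \<omega> * iexp (\<xi> * X \<omega>)))"
  proof (rule P.Fubini_integrable)
    show "integrable M (\<lambda>x. LINT y|std_normal_distribution.
            norm (case (x, y) of (\<omega>, \<xi>) \<Rightarrow> f \<omega> * iexp (\<xi> * X \<omega>)))"
      using assms(3) by (simp add: norm_mult G.prob_space del: G.space_eq_univ)
    show "AE x in M. integrable std_normal_distribution
            (\<lambda>y. case (x, y) of (\<omega>, \<xi>) \<Rightarrow> f \<omega> * iexp (\<xi> * X \<omega>))"
      by (intro AE_I2) (auto intro!: integrable_mult_right G.integrable_iexp)
  qed simp
  show ?thesis
    unfolding P.Fubini_integral[OF int]
    using integral_iexp_std_normal[of "X _"] by (simp add: mult.commute)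
qed

lemma measure_std_normal_UNIV [simp]: "measure std_normal_distribution UNIV = 1"
proof -
  interpret G: real_distribution std_normal_distribution by (rule real_dist_normal_dist)
  show ?thesis using G.prob_space by simp
qed

lemma integral_std_normal_square: "(LINT x|std_normal_distribution. x^2) = 1"
  using std_normal_distribution_even_moments[of 1] by simp

section \<open>Convolution, symmetrization and Poisson laws\<close>

lemma real_distribution_convolution:
  assumes "real_distribution \<sigma>" "real_distribution \<tau>"
  shows "real_distribution (convolution \<sigma> \<tau>)"
    and "char (convolution \<sigma> \<tau>) z = char \<sigma> z * char \<tau> z"
proof -
  interpret s: real_distribution \<sigma> by fact
  interpret t: real_distribution \<tau> by fact
  interpret P: pair_prob_space \<sigma> \<tau> ..
  have m[measurable]: "(\<lambda>(x, y). x + y) \<in> borel_measurable (\<sigma> \<Otimes>\<^sub>M \<tau>)" by simp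
  show "real_distribution (convolution \<sigma> \<tau>)"
    unfolding convolution_def by (rule P.real_distribution_distr[OF m])
  have "char (convolution \<sigma> \<tau>) z = (CLINT x|\<sigma> \<Otimes>\<^sub>M \<tau>. (case x of (x, y) \<Rightarrow> iexp (z * x) * iexp (z * y)))"
    unfolding convolution_def char_def
    by (subst integral_distr) (auto intro!: Bochner_Integration.integral_cong simp: ring_distribs exp_add)
  also have "\<dots> = (CLINT x|\<sigma>. CLINT y|\<tau>. iexp (z * x) * iexp (z * y))"
    by (subst P.integral_fst'[symmetric])
       (auto intro!: P.integrable_const_bound[where B=1] simp: norm_mult case_prod_beta)
  also have "\<dots> = char \<sigma> z * char \<tau> z" by (simp add: char_def)
  finally show "char (convolution \<sigma> \<tau>) z = char \<sigma> z * char \<tau> z" .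
qed

lemma real_distribution_return: "real_distribution (return borel (x::real))"
  by (auto simp: real_distribution_def real_distribution_axioms_def intro: prob_space_return)

lemma char_return: "char (return borel x) z = iexp (z * x)"
  unfolding char_def by (subst integral_return) auto

lemma real_distribution_convolution_power:
  assumes "real_distribution \<sigma>"
  shows "real_distribution (convolution_power n \<sigma>)"
    and "char (convolution_power n \<sigma>) z = char \<sigma> z ^ n"
proof -
  have "real_distribution (convolution_power n \<sigma>) \<and> char (convolution_power n \<sigma>) z = char \<sigma> z ^ n"
    by (induction n) (auto simp: real_distribution_return char_return real_distribution_convolution assms)
  then show "real_distribution (convolution_power n \<sigma>)"
    "char (convolution_power n \<sigma>) z = char \<sigma> z ^ n" by auto
qed

text \<open>The law of the difference of two independent copies is a witness, and Levy's uniqueness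
  theorem makes it the only one, so the description by \<open>THE\<close> denotes it.\<close>

lemma symmetrization:
  assumes "real_distribution \<sigma>"
  shows "real_distribution (symmetrization \<sigma>)"
    and "char (symmetrization \<sigma>) z = complex_of_real ((cmod (char \<sigma> z))^2)"
proof -
  interpret s: real_distribution \<sigma> by fact
  define \<sigma>' where "\<sigma>' = distr \<sigma> borel uminus"
  have s': "real_distribution \<sigma>'" unfolding \<sigma>'_def by (rule s.real_distribution_distr) simp
  have c': "char \<sigma>' z = cnj (char \<sigma> z)" for z
    unfolding \<sigma>'_def char_def
    by (subst integral_distr) (auto simp: exp_cnj simp flip: Bochner_Integration.integral_cnj)
  have ex: "real_distribution (convolution \<sigma> \<sigma>') \<and>
      (\<forall>z. char (convolution \<sigma> \<sigma>') z = complex_of_real ((cmod (char \<sigma> z))^2))"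
    using real_distribution_convolution[OF assms s'] by (simp add: c' flip: complex_norm_square)
  then have "\<exists>!\<tau>. real_distribution \<tau> \<and> (\<forall>z. char \<tau> z = complex_of_real ((cmod (char \<sigma> z))^2))"
    by (rule ex1I) (use ex in \<open>auto intro!: Levy_uniqueness\<close>)
  from theI'[OF this, folded symmetrization_def]
  show "real_distribution (symmetrization \<sigma>)"
    "char (symmetrization \<sigma>) z = complex_of_real ((cmod (char \<sigma> z))^2)" by auto
qed

text \<open>The support is exported together with the characteristic function: it is how facts about
  the values of N and L (integral, nonnegative) are recovered from transforms.\<close>

lemma poisson_lattice_distribution:
  fixes x l :: real
  assumes "l \<ge> 0"
  obtains \<tau> where "real_distribution \<tau>" "\<And>z. char \<tau> z = exp (l * (iexp (z * x) - 1))"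
    "AE y in \<tau>. \<exists>n::nat. y = real n * x"
proof (cases "l = 0")
  case True
  have "AE y in return borel (0::real). \<exists>n::nat. y = real n * x"
    by (subst AE_return) (auto intro!: exI[of _ 0] measurable_If pred_intros_countable)
  with True show ?thesis
    by (intro that[of "return borel 0"]) (auto simp: char_return real_distribution_return)
next
  case False
  with assms have l0: "l > 0" by simp
  let ?p = "measure_pmf (poisson_pmf l)"
  define \<tau> where "\<tau> = distr ?p borel (\<lambda>n. real n * x)"
  have 1: "real_distribution \<tau>" unfolding \<tau>_def by (rule prob_space.real_distribution_distr[OF measure_pmf.prob_space_axioms]) simp
  have 2: "char \<tau> z = exp (l * (iexp (z * x) - 1))" for z
  proof -
    let ?e = "complex_of_real l * iexp (z * x)"
    let ?f = "\<lambda>n. complex_of_real (pmf (poisson_pmf l) n) * iexp (z * (real n * x))"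
    have "integrable ?p (\<lambda>n. iexp (z * (real n * x)))"
      by (rule measure_pmf.integrable_const_bound[where B=1]) auto
    then have "integrable (count_space UNIV) ?f"
      unfolding measure_pmf_eq_density by (subst (asm) integrable_density) (auto simp: scaleR_conv_of_real)
    then have "?f sums integral\<^sup>L (count_space UNIV) ?f"
      by (rule sums_integral_count_space_nat)
    also have "integral\<^sup>L (count_space UNIV) ?f = char \<tau> z"
      unfolding \<tau>_def char_def measure_pmf_eq_density
      by (subst integral_distr) (auto simp: integral_density scaleR_conv_of_real)
    finally have a: "?f sums char \<tau> z" .
    have "(\<lambda>n. exp (- complex_of_real l) * (?e ^ n /\<^sub>R fact n)) sums (exp (- complex_of_real l) * exp ?e)"
      by (intro sums_mult exp_converges)
    also have "(\<lambda>n. exp (- complex_of_real l) * (?e ^ n /\<^sub>R fact n)) = ?f"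
      using l0 by (intro ext)
        (simp add: power_mult_distrib scaleR_conv_of_real field_simps flip: exp_of_nat_mult exp_of_real)
    finally have "?f sums (exp (- complex_of_real l) * exp ?e)" .
    with a have "char \<tau> z = exp (- complex_of_real l) * exp ?e" by (rule sums_unique2)
    then show ?thesis by (simp add: algebra_simps flip: exp_add)
  qed
  have 3: "AE y in \<tau>. \<exists>n::nat. y = real n * x"
    unfolding \<tau>_def by (subst AE_distr_iff) auto
  show ?thesis by (rule that[OF 1 2 3])
qed

lemma cos_ge_one_minus_square: "1 - cos t \<le> t^2 / 2" for t :: real
proof -
  have "1 - cos t = 2 * (sin (t / 2))^2"
    using cos_double_sin[of "t / 2"] by simp
  also have "(sin (t / 2))^2 \<le> (t / 2)^2"
    using abs_sin_x_le_abs_x[of "t / 2"] by (rule abs_le_square_iff[THEN iffD1])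
  finally show ?thesis by (simp add: power_divide)
qed

text \<open>A single finite set \<open>F\<close> serves every \<open>k\<close> dominated by a
  multiple of \<open>g\<close>, and the error scales with that multiple. Below, \<open>k\<close>
  depends on the argument z of an exponent while \<open>F\<close> must not, because the truncated
  sum is averaged over z or used as the exponent of an approximating law. \<open>S\<close> puts a
  chosen atom into \<open>F\<close>.\<close>

lemma infsum_uniform_finite_approx:
  fixes g :: "'a \<Rightarrow> real"
  assumes g: "g summable_on A" and g0: "\<And>x. x \<in> A \<Longrightarrow> 0 \<le> g x"
    and S: "finite S" "S \<subseteq> A" and e: "e > 0"
  obtains F where "finite F" "S \<subseteq> F" "F \<subseteq> A"
    "\<And>k C. (\<And>x. x \<in> A \<Longrightarrow> \<bar>k x\<bar> \<le> C * g x) \<Longrightarrow> 0 \<le> C \<Longrightarrow> \<bar>infsum k A - sum k F\<bar> \<le> C * e"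
proof -
  have "(sum g \<longlongrightarrow> infsum g A) (finite_subsets_at_top A)"
    using infsum_tendsto[OF g] .
  from tendstoD[OF this e] obtain X where X: "finite X" "X \<subseteq> A"
    "\<And>Y. finite Y \<Longrightarrow> X \<subseteq> Y \<Longrightarrow> Y \<subseteq> A \<Longrightarrow> dist (sum g Y) (infsum g A) < e"
    unfolding eventually_finite_subsets_at_top by metis
  define F where "F = X \<union> S"
  have F: "finite F" "S \<subseteq> F" "F \<subseteq> A" using X S by (auto simp: F_def)
  have d: "infsum f (A - F) = infsum f A - sum f F" if "f summable_on A" for f :: "'a \<Rightarrow> real"
    using infsum_Diff[OF that _ F(3)] F(1) by simp
  have g': "g summable_on (A - F)"
    using g by (rule summable_on_subset_banach) auto
  have te: "infsum g (A - F) \<le> e"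
    using X(3)[of F] F d[OF g] by (auto simp: F_def dist_real_def)
  show ?thesis
  proof (rule that[OF F])
    fix k :: "'a \<Rightarrow> real" and C :: real assume k: "\<And>x. x \<in> A \<Longrightarrow> \<bar>k x\<bar> \<le> C * g x" and C: "0 \<le> C"
    have kg: "(\<lambda>x. norm (k x)) summable_on A"
      using k by (intro Infinite_Sum.abs_summable_on_comparison_test'[where g="\<lambda>x. C * g x"] summable_on_cmult_right g) auto
    then have kA: "k summable_on A" by (rule abs_summable_summable)
    have "\<bar>infsum k A - sum k F\<bar> = norm (infsum k (A - F))" by (simp add: d[OF kA])
    also have "\<dots> \<le> infsum (\<lambda>x. norm (k x)) (A - F)"
      by (rule norm_infsum_bound) (rule summable_on_subset_banach[OF kg], auto)
    also have "\<dots> \<le> infsum (\<lambda>x. C * g x) (A - F)"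
      using k by (intro infsum_mono summable_on_cmult_right g' summable_on_subset_banach[OF kg]) auto
    also have "\<dots> = C * infsum g (A - F)" by (rule infsum_cmult_right) (use g' in auto)
    also have "\<dots> \<le> C * e" using C te by (rule mult_left_mono[rotated])
    finally show "\<bar>infsum k A - sum k F\<bar> \<le> C * e" .
  qed
qed

text \<open>The logarithm of the characteristic function of the symmetric purely atomic (signed) Levy
  measure with mass \<open>w x\<close> at each of \<open>x\<close> and \<open>-x\<close>.\<close>

definition cos_exponent :: "(real \<Rightarrow> real) \<Rightarrow> real \<Rightarrow> real" where
  "cos_exponent w z = (\<Sum>\<^sub>\<infinity>x\<in>{0<..}. 2 * w x * (cos (x * z) - 1))"

lemma cos_term_bound: "\<bar>2 * w x * (cos (x * z) - 1)\<bar> \<le> z^2 * (\<bar>w x\<bar> * x^2)" for w :: "real \<Rightarrow> real"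
proof -
  have "\<bar>2 * w x * (cos (x * z) - 1)\<bar> = 2 * \<bar>w x\<bar> * (1 - cos (x * z))"
    by (simp add: abs_mult)
  also have "\<dots> \<le> 2 * \<bar>w x\<bar> * ((x * z)^2 / 2)"
    by (intro mult_left_mono cos_ge_one_minus_square) auto
  finally show ?thesis by (simp add: power_mult_distrib mult_ac)
qed

lemma cos_exponent_even: "cos_exponent w (- z) = cos_exponent w z"
  by (simp add: cos_exponent_def)

context
  fixes w :: "real \<Rightarrow> real"
  assumes w: "(\<lambda>x. \<bar>w x\<bar> * x^2) summable_on {0<..}"
begin

lemma cos_terms_summable: "(\<lambda>x. 2 * w x * (cos (x * z) - 1)) summable_on {0<..}"
proof (rule abs_summable_summable, rule Infinite_Sum.abs_summable_on_comparison_test')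
  show "(\<lambda>x. z^2 * (\<bar>w x\<bar> * x^2)) summable_on {0<..}"
    by (intro summable_on_cmult_right w)
qed (use cos_term_bound in auto)

text \<open>The factor \<open>1 - cos (x * h)\<close> is O(x^2), so the second difference is the
  cosine transform of a finite signed measure although \<open>w\<close> itself may have infinite
  mass near 0. This makes single atoms accessible to Fourier inversion.\<close>

lemma cos_exponent_second_difference:
  "cos_exponent w z - (cos_exponent w (z + h) + cos_exponent w (z - h)) / 2
    = (\<Sum>\<^sub>\<infinity>x\<in>{0<..}. 2 * w x * (1 - cos (x * h)) * cos (x * z))"
proof -
  let ?t = "\<lambda>z x. 2 * w x * (cos (x * z) - 1)"
  have "((\<lambda>x. ?t z x + (?t (z + h) x + ?t (z - h) x) * (- (1/2))) has_sum
      (cos_exponent w z + (cos_exponent w (z + h) + cos_exponent w (z - h)) * (- (1/2)))) {0<..}"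
    unfolding cos_exponent_def
    by (intro has_sum_add has_sum_cmult_left has_sum_infsum cos_terms_summable)
  also have "(\<lambda>x. ?t z x + (?t (z + h) x + ?t (z - h) x) * (- (1/2)))
      = (\<lambda>x. 2 * w x * (1 - cos (x * h)) * cos (x * z))"
    by (auto simp: fun_eq_iff cos_add cos_diff algebra_simps)
  finally show ?thesis by (simp add: infsumI)
qed

end

section \<open>Necessity: an infinitely divisible law has no negative mass\<close>

lemma char_root_of_exp:
  assumes "real_distribution \<sigma>" "real_distribution \<tau>" "n \<ge> 1"
    and \<sigma>: "\<And>z. char \<sigma> z = complex_of_real (exp (\<psi> z))"
    and \<tau>: "\<And>z. char \<tau> z ^ n = char \<sigma> z"
  shows "char \<tau> z = complex_of_real (exp (\<psi> z / real n))"
proof -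
  interpret s: real_distribution \<sigma> by fact
  interpret t: real_distribution \<tau> by fact
  have \<psi>: "\<psi> z = ln (Re (char \<sigma> z))" for z by (simp add: \<sigma>)
  have cs: "continuous_on UNIV (char \<sigma>)" "continuous_on UNIV (char \<tau>)"
    by (auto intro!: continuous_at_imp_continuous_on s.isCont_char t.isCont_char)
  have c\<psi>: "continuous_on UNIV \<psi>"
    unfolding \<psi>[abs_def] by (intro continuous_intros cs) (auto simp: \<sigma>)
  \<comment> \<open>The ratio of \<open>char \<tau>\<close> to the positive real root is continuous
    with values among the finitely many n-th roots of unity, hence constant; at 0 it is 1.\<close>
  define f where "f z = char \<tau> z * complex_of_real (exp (- (\<psi> z / real n)))" for z
  have "f z ^ n = complex_of_real (exp (\<psi> z) * exp (- (\<psi> z / real n)) ^ n)" for z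
    by (simp add: f_def power_mult_distrib \<tau> \<sigma>)
  moreover have "exp (- (\<psi> z / real n)) ^ n = exp (- \<psi> z)" for z
    using \<open>n \<ge> 1\<close> by (simp flip: exp_of_nat_mult)
  ultimately have "f z ^ n = 1" for z by (simp flip: exp_add)
  then have "f ` UNIV \<subseteq> {z. z ^ n = 1}" by auto
  moreover have "finite {z::complex. z ^ n = 1}" using finite_roots_unity[OF \<open>n \<ge> 1\<close>] .
  ultimately have "finite (f ` UNIV)" by (rule finite_subset)
  moreover have "continuous_on UNIV f"
    unfolding f_def by (intro continuous_intros cs c\<psi>) (use \<open>n \<ge> 1\<close> in auto)
  ultimately have "f constant_on UNIV" by (intro continuous_finite_range_constant connected_UNIV)
  then have "f z = f 0" by (auto simp: constant_on_def)
  also have "f 0 = 1"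
  proof -
    have "\<psi> 0 = 0" using s.char_zero by (simp add: \<psi>)
    then show ?thesis by (simp add: f_def t.char_zero)
  qed
  finally show ?thesis by (simp add: f_def exp_minus field_simps)
qed

lemma tendsto_mult_exp_minus_one: "(\<lambda>n. real n * (exp (x / real n) - 1)) \<longlonglongrightarrow> x"
proof -
  have "((\<lambda>y. exp (x * y)) has_real_derivative x) (at 0)"
    by (auto intro!: derivative_eq_intros)
  then have "((\<lambda>h. (exp (x * h) - 1) / h) \<longlongrightarrow> x) (at 0)"
    by (simp add: DERIV_def)
  from this[unfolded tendsto_at_iff_sequentially, rule_format, of "\<lambda>n. 1 / real (Suc n)"]
  have "(\<lambda>n. (exp (x * (1 / real (Suc n))) - 1) / (1 / real (Suc n))) \<longlonglongrightarrow> x"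
    using LIMSEQ_inverse_real_of_nat by (simp add: o_def inverse_eq_divide)
  then have "(\<lambda>n. real (Suc n) * (exp (x / real (Suc n)) - 1)) \<longlonglongrightarrow> x"
    by (simp add: mult.commute)
  then show ?thesis by (rule LIMSEQ_imp_Suc)
qed

lemma infinitely_divisible_root:
  assumes "\<sigma> \<in> ID" "n \<ge> 1" "\<And>z. char \<sigma> z = complex_of_real (exp (\<psi> z))"
  obtains \<tau> where "real_distribution \<tau>" "\<And>z. char \<tau> z = complex_of_real (exp (\<psi> z / real n))"
proof -
  from assms obtain \<tau> where \<tau>: "real_distribution \<sigma>" "real_distribution \<tau>" "\<sigma> = convolution_power n \<tau>"
    by (auto simp: ID_def)
  show ?thesis
    using real_distribution_convolution_power(2)[OF \<tau>(2), of n]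
    by (intro that[OF \<tau>(2)] char_root_of_exp[OF \<tau>(1,2) assms(2,3)]) (simp add: \<tau>(3))
qed

text \<open>With \<open>\<tau>\<close> the \<open>n\<close>-th convolution root of \<open>\<sigma>\<close>, the second difference in \<open>z\<close> of \<open>n\<close> times the
  characteristic function of \<open>\<tau>\<close> is the Fourier transform of the positive measure
  \<open>n (1 - cos (h y)) \<tau>(dy)\<close>, which converges as \<open>n\<close> grows; integrating it against
  \<open>iexp (- \<xi> s x0)\<close> for a standard normal \<open>\<xi>\<close> keeps the positivity.\<close>

lemma infinitely_divisible_second_difference_nonneg:
  assumes ID: "\<sigma> \<in> ID" and \<sigma>: "\<And>z. char \<sigma> z = complex_of_real (exp (\<psi> z))"
    and even: "\<And>z. \<psi> (- z) = \<psi> z"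
  defines "\<Phi> \<equiv> \<lambda>h z. \<psi> z - (\<psi> (z + h) + \<psi> (z - h)) / 2"
  shows "\<Phi> h \<in> borel_measurable borel" "\<bar>\<Phi> h z\<bar> \<le> - \<psi> h"
    "0 \<le> Re (CLINT \<xi>|std_normal_distribution. complex_of_real (\<Phi> h (s * \<xi>)) * iexp (- (\<xi> * (s * x0))))"
proof -
  interpret s: real_distribution \<sigma> using ID by (simp add: ID_def)
  interpret G: real_distribution std_normal_distribution by (rule real_dist_normal_dist)
  have \<psi>_eq: "\<psi> = (\<lambda>z. ln (Re (char \<sigma> z)))" by (simp add: \<sigma>)
  have [measurable]: "\<psi> \<in> borel_measurable borel" unfolding \<psi>_eq by measurable
  show meas[measurable]: "\<Phi> h \<in> borel_measurable borel" unfolding \<Phi>_def by measurable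
  have "\<psi> 0 = 0" using s.char_zero by (simp add: \<psi>_eq)
  define C where "C n z = real n * (exp (\<psi> z / real n) - (exp (\<psi> (z + h) / real n) + exp (\<psi> (z - h) / real n)) / 2)" for n z
  have C_lim: "(\<lambda>n. C n z) \<longlonglongrightarrow> \<Phi> h z" for z
  proof -
    let ?e = "\<lambda>y n. real n * (exp (y / real n) - 1)"
    have "(\<lambda>n. ?e (\<psi> z) n - (?e (\<psi> (z + h)) n + ?e (\<psi> (z - h)) n) / 2) \<longlonglongrightarrow> \<Phi> h z"
      unfolding \<Phi>_def by (intro tendsto_intros tendsto_mult_exp_minus_one) auto
    also have "(\<lambda>n. ?e (\<psi> z) n - (?e (\<psi> (z + h)) n + ?e (\<psi> (z - h)) n) / 2) = (\<lambda>n. C n z)"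
      by (auto simp: C_def fun_eq_iff algebra_simps add_divide_distrib diff_divide_distrib)
    finally show ?thesis .
  qed
  have [measurable]: "C n \<in> borel_measurable borel" for n unfolding C_def by measurable
  have key: "\<bar>C n z\<bar> \<le> - \<psi> h \<and>
      0 \<le> Re (CLINT \<xi>|std_normal_distribution. complex_of_real (C n (s * \<xi>)) * iexp (- (\<xi> * (s * x0))))"
    if n: "n \<ge> 1" for n z
  proof -
    from infinitely_divisible_root[OF ID n \<sigma>] obtain \<tau> where
      \<tau>: "real_distribution \<tau>" "\<And>z. char \<tau> z = complex_of_real (exp (\<psi> z / real n))" by metis
    interpret t: real_distribution \<tau> by fact
    define f where "f y = real n * (1 - cos (h * y))" for y
    have f0: "f y \<ge> 0" for y by (simp add: f_def)
    have [measurable]: "f \<in> borel_measurable borel" unfolding f_def by measurable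
    have intf: "integrable \<tau> f"
      unfolding f_def by (rule t.integrable_const_bound[where B="real n * 2"])
        (auto simp: abs_mult intro!: AE_I2 mult_left_mono order_trans[OF abs_triangle_ineq4])
    have Cf: "complex_of_real (C n z) = (CLINT y|\<tau>. complex_of_real (f y) * iexp (z * y))" for z
    proof -
      have i: "integrable \<tau> (\<lambda>y. iexp (z * y))" for z by (rule t.integrable_iexp) auto
      have "complex_of_real (C n z) = of_nat n * (char \<tau> z - (char \<tau> (z + h) + char \<tau> (z - h)) / 2)"
        by (simp add: C_def \<tau>(2))
      also have "\<dots> = (CLINT y|\<tau>. of_nat n * (iexp (z * y) - (iexp ((z + h) * y) + iexp ((z - h) * y)) / 2))"
        unfolding char_def using i[of z] i[of "z + h"] i[of "z - h"] by simp
      also have "\<dots> = (CLINT y|\<tau>. complex_of_real (f y) * iexp (z * y))"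
      proof (intro Bochner_Integration.integral_cong refl)
        fix y :: real
        have c: "complex_of_real (cos (h * y)) = (iexp (h * y) + iexp (- (h * y))) / 2"
          by (simp add: cos_exp_eq flip: cos_of_real)
        have e1: "iexp ((z + h) * y) = iexp (z * y) * iexp (h * y)"
          by (simp add: ring_distribs exp_add)
        have e2: "iexp ((z - h) * y) = iexp (z * y) * iexp (- (h * y))"
          by (simp add: ring_distribs left_diff_distrib flip: exp_add)
        have "iexp (z * y) * complex_of_real (cos (h * y)) = (iexp ((z + h) * y) + iexp ((z - h) * y)) / 2"
          by (simp only: c e1 e2) (simp only: ring_distribs times_divide_eq_right)
        then show "of_nat n * (iexp (z * y) - (iexp ((z + h) * y) + iexp ((z - h) * y)) / 2)
            = complex_of_real (f y) * iexp (z * y)"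
          by (simp only: f_def of_real_mult of_real_diff of_real_1 of_real_of_nat_eq) (simp add: algebra_simps)
      qed
      finally show ?thesis .
    qed
    \<comment> \<open>The transform of a positive measure is largest at 0. There evenness and
      \<open>\<psi> 0 = 0\<close> give n (1 - exp (\<psi> h / n)) \<le> -\<psi> h, which is free of
      n and z and serves as the dominating constant.\<close>
    have "\<bar>C n z\<bar> = cmod (CLINT y|\<tau>. complex_of_real (f y) * iexp (z * y))"
      by (simp only: Cf[symmetric] norm_of_real)
    also have "\<dots> \<le> (LINT y|\<tau>. norm (complex_of_real (f y) * iexp (z * y)))"
      by (rule integral_norm_bound)
    also have "\<dots> = (LINT y|\<tau>. f y)" by (simp add: norm_mult f0)
    also have "\<dots> = C n 0"
    proof -
      have "complex_of_real (LINT y|\<tau>. f y) = complex_of_real (C n 0)"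
        unfolding Cf by (simp add: integral_complex_of_real)
      then show ?thesis by (simp only: of_real_eq_iff)
    qed
    also have "\<dots> = real n * (1 - exp (\<psi> h / real n))" by (simp add: C_def \<open>\<psi> 0 = 0\<close> even)
    also have "\<dots> \<le> real n * - (\<psi> h / real n)"
      using exp_ge_add_one_self[of "\<psi> h / real n"] by - (rule mult_left_mono, linarith, simp)
    finally have 1: "\<bar>C n z\<bar> \<le> - \<psi> h" using n by simp
    have "(CLINT \<xi>|std_normal_distribution. complex_of_real (C n (s * \<xi>)) * iexp (- (\<xi> * (s * x0))))
        = (CLINT \<xi>|std_normal_distribution. (CLINT y|\<tau>. complex_of_real (f y) * iexp (\<xi> * (s * (y - x0)))))"
    proof (intro Bochner_Integration.integral_cong refl)
      fix \<xi>
      have "complex_of_real (C n (s * \<xi>)) * iexp (- (\<xi> * (s * x0)))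
         = (CLINT y|\<tau>. complex_of_real (f y) * iexp (s * \<xi> * y) * iexp (- (\<xi> * (s * x0))))"
        unfolding Cf by (simp only: integral_mult_left_zero)
      also have "\<dots> = (CLINT y|\<tau>. complex_of_real (f y) * iexp (\<xi> * (s * (y - x0))))"
        by (intro Bochner_Integration.integral_cong refl)
           (simp add: mult.assoc right_diff_distrib mult_ac flip: exp_add)
      finally show "complex_of_real (C n (s * \<xi>)) * iexp (- (\<xi> * (s * x0)))
         = (CLINT y|\<tau>. complex_of_real (f y) * iexp (\<xi> * (s * (y - x0))))" .
    qed
    also have "\<dots> = (CLINT y|\<tau>. complex_of_real (f y) * complex_of_real (exp (- ((s * (y - x0))^2) / 2)))"
      by (rule integral_std_normal_swap) (use intf t.sigma_finite_measure_axioms in auto)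
    also have "\<dots> = complex_of_real (LINT y|\<tau>. f y * exp (- ((s * (y - x0))^2) / 2))"
      by (simp flip: of_real_mult)
    finally have 2: "0 \<le> Re (CLINT \<xi>|std_normal_distribution. complex_of_real (C n (s * \<xi>)) * iexp (- (\<xi> * (s * x0))))"
      by (simp add: f0 integral_nonneg_AE)
    from 1 2 show ?thesis by simp
  qed
  show "\<bar>\<Phi> h z\<bar> \<le> - \<psi> h"
    by (rule LIMSEQ_le_const2[OF tendsto_rabs[OF C_lim]]) (use key in blast)
  have "(\<lambda>n. CLINT \<xi>|std_normal_distribution. complex_of_real (C n (s * \<xi>)) * iexp (- (\<xi> * (s * x0))))
     \<longlonglongrightarrow> (CLINT \<xi>|std_normal_distribution. complex_of_real (\<Phi> h (s * \<xi>)) * iexp (- (\<xi> * (s * x0))))"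
  proof -
    have "(\<lambda>n. CLINT \<xi>|std_normal_distribution. complex_of_real (C (Suc n) (s * \<xi>)) * iexp (- (\<xi> * (s * x0))))
     \<longlonglongrightarrow> (CLINT \<xi>|std_normal_distribution. complex_of_real (\<Phi> h (s * \<xi>)) * iexp (- (\<xi> * (s * x0))))"
    proof (rule integral_dominated_convergence[where w="\<lambda>_. - \<psi> h"])
      show "AE x in std_normal_distribution. (\<lambda>i. complex_of_real (C (Suc i) (s * x)) * iexp (- (x * (s * x0))))
         \<longlonglongrightarrow> complex_of_real (\<Phi> h (s * x)) * iexp (- (x * (s * x0)))"
        by (intro AE_I2 tendsto_intros LIMSEQ_Suc C_lim)
      show "AE x in std_normal_distribution. norm (complex_of_real (C (Suc i) (s * x)) * iexp (- (x * (s * x0)))) \<le> - \<psi> h" for i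
        using key[of "Suc i"] by (intro AE_I2) (auto simp: norm_mult)
    qed (auto intro!: measurable_compose[OF _ meas])
    then show ?thesis by (rule LIMSEQ_imp_Suc)
  qed
  from tendsto_Re[OF this] show "0 \<le> Re (CLINT \<xi>|std_normal_distribution. complex_of_real (\<Phi> h (s * \<xi>)) * iexp (- (\<xi> * (s * x0))))"
    by (rule LIMSEQ_le_const) (use key in blast)
qed

text \<open>Averaging the second difference against \<open>iexp (- (\<xi> * (s * x0)))\<close>
  weights each atom x by Gaussian kernels centred at x0 and -x0. As s grows only x = x0 keeps its
  weight, while the average stays nonnegative. The sum is truncated first so that the limit concerns
  finitely many atoms.\<close>

lemma infinitely_divisible_imp_nonneg:
  assumes ID: "\<sigma> \<in> ID" and w: "(\<lambda>x. \<bar>w x\<bar> * x^2) summable_on {0<..}"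
    and \<sigma>: "\<And>z. char \<sigma> z = complex_of_real (exp (cos_exponent w z))"
    and x0: "x0 > 0"
  shows "w x0 \<ge> 0"
proof -
  interpret G: real_distribution std_normal_distribution by (rule real_dist_normal_dist)
  \<comment> \<open>With this h the factor \<open>1 - cos (x0 * h)\<close> equals 2 at the atom
    under test; a zero of that factor would hide the atom.\<close>
  define h where "h = pi / x0"
  define \<Phi> where "\<Phi> z = cos_exponent w z - (cos_exponent w (z + h) + cos_exponent w (z - h)) / 2" for z
  note sd = infinitely_divisible_second_difference_nonneg[OF ID \<sigma> cos_exponent_even, where h=h]
  have [measurable]: "\<Phi> \<in> borel_measurable borel" and \<Phi>_le: "\<bar>\<Phi> z\<bar> \<le> - cos_exponent w h"
    and \<Phi>_nonneg: "0 \<le> Re (CLINT \<xi>|std_normal_distribution. complex_of_real (\<Phi> (s * \<xi>)) * iexp (- (\<xi> * (s * x0))))" for z s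
    using sd unfolding \<Phi>_def by blast+
  let ?k = "\<lambda>x z. 2 * w x * (1 - cos (x * h)) * cos (x * z)"
  have \<Phi>: "\<Phi> z = infsum (\<lambda>x. ?k x z) {0<..}" for z
    unfolding \<Phi>_def by (rule cos_exponent_second_difference[OF w])
  have kb: "\<bar>?k x z\<bar> \<le> h^2 * (\<bar>w x\<bar> * x^2)" for x z
  proof -
    have "\<bar>?k x z\<bar> = \<bar>2 * w x * (cos (x * h) - 1)\<bar> * \<bar>cos (x * z)\<bar>"
      by (simp add: abs_mult abs_minus_commute)
    also have "\<dots> \<le> \<bar>2 * w x * (cos (x * h) - 1)\<bar> * 1"
      by (intro mult_left_mono) auto
    also have "\<dots> \<le> h^2 * (\<bar>w x\<bar> * x^2)" using cos_term_bound[of w x h] by simp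
    finally show ?thesis .
  qed
  let ?E = "\<lambda>s x. exp (- ((s * (x - x0))^2) / 2) + exp (- ((s * (x + x0))^2) / 2)"
  have ineq: "0 \<le> 2 * w x0 + h^2 * e" if e: "e > 0" for e
  proof -
    from infsum_uniform_finite_approx[OF w, of "{x0}" e] x0 e obtain F where
      F: "finite F" "x0 \<in> F" "F \<subseteq> {0<..}"
      "\<And>k C. (\<And>x. x \<in> {0<..} \<Longrightarrow> \<bar>k x\<bar> \<le> C * (\<bar>w x\<bar> * x^2)) \<Longrightarrow> 0 \<le> C \<Longrightarrow> \<bar>infsum k {0<..} - sum k F\<bar> \<le> C * e"
      by (auto simp: zero_le_mult_iff)
    have approx: "\<bar>\<Phi> z - (\<Sum>x\<in>F. ?k x z)\<bar> \<le> h^2 * e" for z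
      unfolding \<Phi> using kb by (intro F(4)) auto
    have s_ineq: "0 \<le> (\<Sum>x\<in>F. w x * (1 - cos (x * h)) * ?E s x) + h^2 * e" for s
    proof -
      let ?m = "\<lambda>\<xi>. iexp (- (\<xi> * (s * x0)))"
      have i1: "integrable std_normal_distribution (\<lambda>\<xi>. complex_of_real (\<Phi> (s * \<xi>)) * ?m \<xi>)"
        using \<Phi>_le by (intro G.integrable_const_bound[where B="- cos_exponent w h"]) (auto simp: norm_mult)
      have i2: "integrable std_normal_distribution (\<lambda>\<xi>. complex_of_real (?k x (s * \<xi>)) * ?m \<xi>)" for x
      proof (rule G.integrable_const_bound[where B="h^2 * (\<bar>w x\<bar> * x^2)"])
        show "AE \<xi> in std_normal_distribution. norm (complex_of_real (?k x (s * \<xi>)) * ?m \<xi>) \<le> h^2 * (\<bar>w x\<bar> * x^2)"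
          by (intro AE_I2) (simp only: norm_mult[of _ "iexp _"] norm_exp_i_times norm_of_real mult_1_right kb)
      qed simp
      have ie: "integrable std_normal_distribution (\<lambda>\<xi>. iexp (t * \<xi>))" for t
        by (rule G.integrable_iexp) auto
      have k_int: "(CLINT \<xi>|std_normal_distribution. complex_of_real (?k x (s * \<xi>)) * ?m \<xi>)
          = complex_of_real (w x * (1 - cos (x * h)) * ?E s x)" for x
      proof -
        have "complex_of_real (?k x (s * \<xi>)) * ?m \<xi>
            = complex_of_real (w x * (1 - cos (x * h))) *
              (iexp ((s * (x - x0)) * \<xi>) + iexp (- (s * (x + x0)) * \<xi>))" for \<xi>
        proof -
          have c: "complex_of_real (cos (x * (s * \<xi>))) = (iexp (x * (s * \<xi>)) + iexp (- (x * (s * \<xi>)))) / 2"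
            by (simp add: cos_exp_eq flip: cos_of_real)
          have e1: "iexp ((s * (x - x0)) * \<xi>) = iexp (x * (s * \<xi>)) * ?m \<xi>"
            by (simp add: ring_distribs right_diff_distrib left_diff_distrib mult_ac flip: exp_add)
          have e2: "iexp (- (s * (x + x0)) * \<xi>) = iexp (- (x * (s * \<xi>))) * ?m \<xi>"
            unfolding exp_add[symmetric] by (rule arg_cong[of _ _ exp]) (simp add: algebra_simps)
          show ?thesis unfolding e1 e2 of_real_mult[of _ "cos (x * (s * \<xi>))"] c
            by (simp add: ring_distribs)
        qed
        then have "(CLINT \<xi>|std_normal_distribution. complex_of_real (?k x (s * \<xi>)) * ?m \<xi>)
          = complex_of_real (w x * (1 - cos (x * h))) *
             ((CLINT \<xi>|std_normal_distribution. iexp ((s * (x - x0)) * \<xi>)) +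
              (CLINT \<xi>|std_normal_distribution. iexp (- (s * (x + x0)) * \<xi>)))"
          by (simp only: integral_mult_right_zero Bochner_Integration.integral_add[OF ie ie])
        then show ?thesis
          unfolding integral_iexp_std_normal by simp
      qed
      let ?I = "CLINT \<xi>|std_normal_distribution. complex_of_real (\<Phi> (s * \<xi>)) * ?m \<xi>"
      let ?S = "CLINT \<xi>|std_normal_distribution. (\<Sum>x\<in>F. complex_of_real (?k x (s * \<xi>)) * ?m \<xi>)"
      have S: "?S = complex_of_real (\<Sum>x\<in>F. w x * (1 - cos (x * h)) * ?E s x)"
        by (subst Bochner_Integration.integral_sum[OF i2]) (simp only: k_int of_real_sum)
      have iS: "integrable std_normal_distribution (\<lambda>\<xi>. \<Sum>x\<in>F. complex_of_real (?k x (s * \<xi>)) * ?m \<xi>)"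
        by (rule Bochner_Integration.integrable_sum[OF i2])
      have "cmod (?I - ?S) = cmod (CLINT \<xi>|std_normal_distribution.
          complex_of_real (\<Phi> (s * \<xi>)) * ?m \<xi> - (\<Sum>x\<in>F. complex_of_real (?k x (s * \<xi>)) * ?m \<xi>))"
        by (simp only: Bochner_Integration.integral_diff[OF i1 iS])
      also have "\<dots> \<le> (LINT \<xi>|std_normal_distribution. cmod (
          complex_of_real (\<Phi> (s * \<xi>)) * ?m \<xi> - (\<Sum>x\<in>F. complex_of_real (?k x (s * \<xi>)) * ?m \<xi>)))"
        by (rule integral_norm_bound)
      also have "\<dots> \<le> (LINT \<xi>|std_normal_distribution. h^2 * e)"
      proof (rule integral_mono)
        show "integrable std_normal_distribution (\<lambda>\<xi>. cmod (
          complex_of_real (\<Phi> (s * \<xi>)) * ?m \<xi> - (\<Sum>x\<in>F. complex_of_real (?k x (s * \<xi>)) * ?m \<xi>)))"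
          by (intro integrable_norm Bochner_Integration.integrable_diff i1 Bochner_Integration.integrable_sum i2)
        fix \<xi>
        have "complex_of_real (\<Phi> (s * \<xi>)) * ?m \<xi> - (\<Sum>x\<in>F. complex_of_real (?k x (s * \<xi>)) * ?m \<xi>)
          = complex_of_real (\<Phi> (s * \<xi>) - (\<Sum>x\<in>F. ?k x (s * \<xi>))) * ?m \<xi>"
          by (simp only: sum_distrib_right[symmetric] left_diff_distrib[symmetric] of_real_sum[symmetric] of_real_diff[symmetric])
        then show "cmod (complex_of_real (\<Phi> (s * \<xi>)) * ?m \<xi> - (\<Sum>x\<in>F. complex_of_real (?k x (s * \<xi>)) * ?m \<xi>)) \<le> h^2 * e"
          using approx[of "s * \<xi>"] by (simp only: norm_mult norm_exp_i_times norm_of_real mult_1_right)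
      qed simp
      also have "\<dots> = h^2 * e" by simp
      finally have "cmod (?I - ?S) \<le> h^2 * e" .
      moreover have "Re ?I \<le> Re ?S + cmod (?I - ?S)"
        using complex_Re_le_cmod[of "?I - ?S"] by simp
      ultimately have "0 \<le> Re ?S + h^2 * e" using \<Phi>_nonneg[of s] by linarith
      then show ?thesis by (simp only: S Re_complex_of_real)
    qed
    have lim: "(\<lambda>n. (\<Sum>x\<in>F. w x * (1 - cos (x * h)) * ?E (real n) x) + h^2 * e) \<longlonglongrightarrow>
        (\<Sum>x\<in>F. w x * (1 - cos (x * h)) * ((if x = x0 then 1 else 0) + 0)) + h^2 * e"
    proof (intro tendsto_intros)
      have g: "(\<lambda>n. exp (- ((real n * b)^2) / 2)) \<longlonglongrightarrow> 0" if "b \<noteq> 0" for b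
      proof -
        have "filterlim (\<lambda>n. (b^2 / 2) * (real n * real n)) at_top sequentially"
          using that by (intro filterlim_tendsto_pos_mult_at_top[OF tendsto_const]
            filterlim_at_top_mult_at_top filterlim_real_sequentially) auto
        then have "filterlim (\<lambda>n. - ((b^2 / 2) * (real n * real n))) at_bot sequentially"
          by (simp add: filterlim_uminus_at_bot)
        from filterlim_compose[OF exp_at_bot this] show ?thesis
          by (simp add: power_mult_distrib power2_eq_square mult_ac)
      qed
      show "(\<lambda>n. exp (- ((real n * (x - x0))^2) / 2)) \<longlonglongrightarrow> (if x = x0 then 1 else 0)" for x
        using g[of "x - x0"] by auto
      show "(\<lambda>n. exp (- ((real n * (x + x0))^2) / 2)) \<longlonglongrightarrow> 0" if "x \<in> F" for x
        using g[of "x + x0"] F(3) that x0 by (auto simp: subset_eq)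
    qed
    have "0 \<le> (\<Sum>x\<in>F. w x * (1 - cos (x * h)) * ((if x = x0 then 1 else 0) + 0)) + h^2 * e"
      using s_ineq by (intro LIMSEQ_le_const[OF lim]) auto
    also have "(\<Sum>x\<in>F. w x * (1 - cos (x * h)) * ((if x = x0 then 1 else 0) + 0)) = w x0 * (1 - cos (x0 * h))"
    proof -
      have "(\<Sum>x\<in>F. w x * (1 - cos (x * h)) * ((if x = x0 then 1 else 0) + 0))
          = (\<Sum>x\<in>F. if x = x0 then w x0 * (1 - cos (x0 * h)) else 0)"
        by (intro sum.cong) auto
      then show ?thesis using F(1,2) by simp
    qed
    also have "cos (x0 * h) = -1" using x0 by (simp add: h_def)
    finally show ?thesis by simp
  qed
  show ?thesis
  proof (rule ccontr)
    assume "\<not> w x0 \<ge> 0"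
    moreover have "h^2 > 0" using x0 by (simp add: h_def)
    \<comment> \<open>This \<open>e\<close> turns the right-hand side of \<open>ineq\<close> into
      \<open>w x0\<close>, which is negative.\<close>
    ultimately show False using ineq[of "- w x0 / h^2"] by (simp add: field_simps zero_less_divide_iff)
  qed
qed

section \<open>Sufficiency: laws with prescribed nonnegative masses\<close>

lemma exists_distribution_char_limit:
  fixes C :: real
  assumes \<mu>: "\<And>n. real_distribution (\<mu> n)"
    and lim: "\<And>z. (\<lambda>n. char (\<mu> n) z) \<longlonglongrightarrow> g z"
    and le: "\<And>n z. 1 - Re (char (\<mu> n) z) \<le> C * z^2"
  shows "\<exists>\<tau>. real_distribution \<tau> \<and> (\<forall>z. char \<tau> z = g z)"
proof -
  interpret G: real_distribution std_normal_distribution by (rule real_dist_normal_dist)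
  \<comment> \<open>The least value of 1 - exp (-y^2 / 2) on |y| \<ge> 1. Averaging 1 - Re char over
    a centred normal argument of standard deviation 1/R therefore bounds K times the mass outside
    (-R, R), and the hypothesis \<open>le\<close> bounds that average by C / R^2: a common quadratic
    bound at 0 yields tightness.\<close>
  define K where "K = 1 - exp (- (1 / 2) :: real)"
  have K: "K > 0" by (simp add: K_def)
  have tail: "measure (\<mu> n) {x. R \<le> \<bar>x\<bar>} \<le> C / (K * R^2)" if R: "R > 0" for n R
  proof -
    interpret m: real_distribution "\<mu> n" by (rule \<mu>)
    define s where "s = 1 / R"
    have i: "integrable (\<mu> n) (\<lambda>x. exp (- ((s * x)^2) / 2))"
      by (rule m.integrable_const_bound[where B=1]) auto
    have "(CLINT \<xi>|std_normal_distribution. char (\<mu> n) (s * \<xi>))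
        = (CLINT \<xi>|std_normal_distribution. CLINT x|\<mu> n. 1 * iexp (\<xi> * (s * x)))"
      unfolding char_def by (simp add: mult_ac)
    also have "\<dots> = (CLINT x|\<mu> n. 1 * complex_of_real (exp (- ((s * x)^2) / 2)))"
      by (rule integral_std_normal_swap) (auto intro: m.sigma_finite_measure_axioms)
    also have "\<dots> = complex_of_real (LINT x|\<mu> n. exp (- ((s * x)^2) / 2))" by simp
    finally have eq: "(LINT \<xi>|std_normal_distribution. Re (char (\<mu> n) (s * \<xi>))) = (LINT x|\<mu> n. exp (- ((s * x)^2) / 2))"
      by (subst integral_Re)
        (auto intro!: G.integrable_const_bound[where B=1] measurable_compose[OF _ m.char_measurable] m.cmod_char_le_1)
    have iR: "integrable std_normal_distribution (\<lambda>\<xi>. Re (char (\<mu> n) (s * \<xi>)))"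
      by (intro integrable_Re G.integrable_const_bound[where B=1])
         (auto intro!: measurable_compose[OF _ m.char_measurable] m.cmod_char_le_1)
    have "K * measure (\<mu> n) {x. R \<le> \<bar>x\<bar>} = (LINT x|\<mu> n. K * indicator {x. R \<le> \<bar>x\<bar>} x)"
      by simp
    also have "\<dots> \<le> (LINT x|\<mu> n. 1 - exp (- ((s * x)^2) / 2))"
    proof (rule integral_mono)
      fix x
      show "K * indicator {x. R \<le> \<bar>x\<bar>} x \<le> 1 - exp (- ((s * x)^2) / 2)"
      proof (cases "R \<le> \<bar>x\<bar>")
        case True
        then have "1 \<le> \<bar>s * x\<bar>" using R by (simp add: s_def abs_mult)
        then have "1 \<le> (s * x)^2" using abs_le_square_iff[of 1 "s * x"] by simp
        then show ?thesis using True by (simp add: K_def)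
      qed simp
    qed (use i m.emeasure_finite in \<open>auto simp: less_top[symmetric]\<close>)
    also have "\<dots> = (LINT \<xi>|std_normal_distribution. 1 - Re (char (\<mu> n) (s * \<xi>)))"
      using i iR by (simp add: eq m.prob_space del: m.space_eq_univ)
    also have "\<dots> \<le> (LINT \<xi>|std_normal_distribution. C * s^2 * \<xi>^2)"
      using iR le[of n "s * _"]
      by (intro integral_mono Bochner_Integration.integrable_diff integrable_mult_right integrable_std_normal_distribution_moment)
         (auto simp: power_mult_distrib mult_ac)
    also have "\<dots> = C / R^2" by (simp add: integral_std_normal_square s_def power_divide)
    finally show ?thesis using K R by (simp add: field_simps)
  qed
  have "tight \<mu>"
    unfolding tight_def
  proof (intro conjI allI impI \<mu>)
    fix \<epsilon> :: real assume \<epsilon>: "\<epsilon> > 0"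
    \<comment> \<open>With this radius the tail bound becomes \<epsilon> C / (|C| + 1), which is
      strictly below \<epsilon> for C of either sign.\<close>
    define R where "R = sqrt ((\<bar>C\<bar> + 1) / (K * \<epsilon>))"
    have R: "R > 0" "R^2 = (\<bar>C\<bar> + 1) / (K * \<epsilon>)" using K \<epsilon> by (auto simp: R_def)
    have "1 - \<epsilon> < measure (\<mu> n) {-R<..R}" for n
    proof -
      interpret m: real_distribution "\<mu> n" by (rule \<mu>)
      have "C / (K * R^2) < \<epsilon>" using K \<epsilon> R by (simp add: field_simps)
      then have "measure (\<mu> n) {x. R \<le> \<bar>x\<bar>} < \<epsilon>" using tail[OF R(1), of n] by simp
      then have "1 - \<epsilon> < 1 - measure (\<mu> n) {x. R \<le> \<bar>x\<bar>}" by simp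
      also have "\<dots> = measure (\<mu> n) (space (\<mu> n) - {x. R \<le> \<bar>x\<bar>})"
        by (rule m.prob_compl[symmetric]) simp
      also have "\<dots> \<le> measure (\<mu> n) {-R<..R}"
        by (rule m.finite_measure_mono) auto
      finally show ?thesis .
    qed
    then show "\<exists>a b. a < b \<and> (\<forall>n. 1 - \<epsilon> < measure (\<mu> n) {a<..b})"
      using R(1) by (intro exI[of _ "-R"] exI[of _ R]) auto
  qed
  from tight_imp_convergent_subsubsequence[OF this strict_mono_id] obtain r \<tau> where
    r: "strict_mono (r :: nat \<Rightarrow> nat)" and \<tau>: "real_distribution \<tau>" and wc: "weak_conv_m (\<mu> \<circ> r) \<tau>"
    by (auto simp: o_def id_def)
  have "char \<tau> z = g z" for z
  proof (rule LIMSEQ_unique)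
    show "(\<lambda>n. char ((\<mu> \<circ> r) n) z) \<longlonglongrightarrow> char \<tau> z"
      by (rule levy_continuity1[OF _ \<tau> wc]) (simp add: \<mu>)
    show "(\<lambda>n. char ((\<mu> \<circ> r) n) z) \<longlonglongrightarrow> g z"
      using LIMSEQ_subseq_LIMSEQ[OF lim r] by (simp add: o_def)
  qed
  then show ?thesis using \<tau> by auto
qed

text \<open>Finitely many atoms give convolutions of scaled Poisson laws, and the exponents of
  growing finite sets converge. Since 1 - exp S \<le> -S, the total of
  \<open>\<bar>w x\<bar> * x^2\<close> is a common constant for the quadratic bound that tightness
  asks for.\<close>

lemma exists_distribution_cos_exponent:
  assumes w: "(\<lambda>x. \<bar>w x\<bar> * x^2) summable_on {0<..}" and w0: "\<And>x. x > 0 \<Longrightarrow> 0 \<le> w x"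
  shows "\<exists>\<tau>. real_distribution \<tau> \<and> (\<forall>z. char \<tau> z = complex_of_real (exp (cos_exponent w z)))"
proof -
  have fin: "\<exists>\<tau>. real_distribution \<tau> \<and> (\<forall>z. char \<tau> z = complex_of_real (exp (\<Sum>x\<in>F. 2 * w x * (cos (x * z) - 1))))"
    if "finite F" "F \<subseteq> {0<..}" for F
    using that
  proof (induction F)
    case empty
    show ?case by (rule exI[of _ "return borel 0"]) (simp add: real_distribution_return char_return)
  next
    case (insert x F)
    then obtain \<tau> where \<tau>: "real_distribution \<tau>"
      "\<And>z. char \<tau> z = complex_of_real (exp (\<Sum>x\<in>F. 2 * w x * (cos (x * z) - 1)))" by auto
    have "w x \<ge> 0" using insert w0 by auto
    obtain \<tau>1 where \<tau>1: "real_distribution \<tau>1" "\<And>z. char \<tau>1 z = exp (w x * (iexp (z * x) - 1))"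
      using poisson_lattice_distribution[OF \<open>w x \<ge> 0\<close>] by metis
    obtain \<tau>2 where \<tau>2: "real_distribution \<tau>2" "\<And>z. char \<tau>2 z = exp (w x * (iexp (z * - x) - 1))"
      using poisson_lattice_distribution[OF \<open>w x \<ge> 0\<close>] by metis
    have "char \<tau>1 z * char \<tau>2 z = complex_of_real (exp (2 * w x * (cos (x * z) - 1)))" for z
    proof -
      have "complex_of_real (cos (x * z)) = (iexp (z * x) + iexp (z * - x)) / 2"
        by (simp add: cos_exp_eq mult_ac flip: cos_of_real)
      then have "complex_of_real (w x) * (iexp (z * x) - 1) + complex_of_real (w x) * (iexp (z * - x) - 1)
        = complex_of_real (2 * w x * (cos (x * z) - 1))"
        by (simp only: of_real_mult of_real_diff of_real_1) (simp add: algebra_simps)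
      then show ?thesis unfolding \<tau>1 \<tau>2 exp_add[symmetric] by (simp only: exp_of_real)
    qed
    moreover note real_distribution_convolution[OF \<tau>1(1) \<tau>2(1)]
    ultimately have "real_distribution (convolution (convolution \<tau>1 \<tau>2) \<tau>)" "\<And>z. char (convolution (convolution \<tau>1 \<tau>2) \<tau>) z =
        complex_of_real (exp (\<Sum>x\<in>insert x F. 2 * w x * (cos (x * z) - 1)))"
      using real_distribution_convolution[OF _ \<tau>(1)] insert.hyps by (simp_all add: exp_add \<tau>(2))
    then show ?case by blast
  qed
  have "\<exists>F. finite F \<and> F \<subseteq> {0<..} \<and>
      (\<forall>z. \<bar>cos_exponent w z - (\<Sum>x\<in>F. 2 * w x * (cos (x * z) - 1))\<bar> \<le> z^2 * inverse (real (Suc n)))" for n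
  proof -
    obtain F where F: "finite F" "F \<subseteq> {0<..}"
      "\<And>k C. (\<And>x. x \<in> {0<..} \<Longrightarrow> \<bar>k x\<bar> \<le> C * (\<bar>w x\<bar> * x^2)) \<Longrightarrow> 0 \<le> C \<Longrightarrow> \<bar>infsum k {0<..} - sum k F\<bar> \<le> C * inverse (real (Suc n))"
      using infsum_uniform_finite_approx[OF w, of "{}" "inverse (real (Suc n))"] by auto
    show ?thesis
      by (intro exI[of _ F] conjI F(1,2) allI) (unfold cos_exponent_def, rule F(3), rule cos_term_bound, simp)
  qed
  then obtain F where F: "\<And>n. finite (F n)" "\<And>n. F n \<subseteq> {0<..}"
      "\<And>n z. \<bar>cos_exponent w z - (\<Sum>x\<in>F n. 2 * w x * (cos (x * z) - 1))\<bar> \<le> z^2 * inverse (real (Suc n))"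
    by metis
  from fin[OF F(1,2)] obtain \<mu> where \<mu>: "\<And>n. real_distribution (\<mu> n)"
    "\<And>n z. char (\<mu> n) z = complex_of_real (exp (\<Sum>x\<in>F n. 2 * w x * (cos (x * z) - 1)))"
    by metis
  show ?thesis
  proof (rule exists_distribution_char_limit[OF \<mu>(1)])
    fix z
    have "(\<lambda>n. (\<Sum>x\<in>F n. 2 * w x * (cos (x * z) - 1)) - cos_exponent w z) \<longlonglongrightarrow> 0"
    proof (rule Lim_null_comparison)
      show "\<forall>\<^sub>F n in sequentially. norm ((\<Sum>x\<in>F n. 2 * w x * (cos (x * z) - 1)) - cos_exponent w z) \<le> z^2 * inverse (real (Suc n))"
        using F(3)[of z] by (simp add: abs_minus_commute)
      show "(\<lambda>n. z^2 * inverse (real (Suc n))) \<longlonglongrightarrow> 0"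
        using tendsto_mult_right_zero[OF LIMSEQ_inverse_real_of_nat] by blast
    qed
    then have "(\<lambda>n. \<Sum>x\<in>F n. 2 * w x * (cos (x * z) - 1)) \<longlonglongrightarrow> cos_exponent w z"
      by (simp add: LIM_zero_iff)
    then show "(\<lambda>n. char (\<mu> n) z) \<longlonglongrightarrow> complex_of_real (exp (cos_exponent w z))"
      unfolding \<mu>(2) by (intro tendsto_intros)
  next
    fix n z
    let ?S = "\<Sum>x\<in>F n. 2 * w x * (cos (x * z) - 1)"
    have "1 - Re (char (\<mu> n) z) = 1 - exp ?S" by (simp add: \<mu>(2))
    also have "\<dots> \<le> - ?S" using exp_ge_add_one_self[of ?S] by linarith
    also have "\<dots> = (\<Sum>x\<in>F n. - (2 * w x * (cos (x * z) - 1)))" by (simp only: sum_negf)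
    also have "\<dots> \<le> (\<Sum>x\<in>F n. z^2 * (\<bar>w x\<bar> * x^2))"
      using cos_term_bound[of w _ z] by (intro sum_mono) (meson abs_ge_minus_self order_trans)
    also have "\<dots> = (\<Sum>x\<in>F n. \<bar>w x\<bar> * x^2) * z^2" by (simp add: sum_distrib_left sum_distrib_right mult_ac)
    also have "\<dots> \<le> infsum (\<lambda>x. \<bar>w x\<bar> * x^2) {0<..} * z^2"
      using F(1,2) w by (intro mult_right_mono finite_sum_le_infsum) auto
    finally show "1 - Re (char (\<mu> n) z) \<le> infsum (\<lambda>x. \<bar>w x\<bar> * x^2) {0<..} * z^2" .
  qed
qed

text \<open>Dividing all masses by n again gives admissible masses, and their law is the n-th
  convolution root.\<close>

lemma nonneg_imp_infinitely_divisible: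
  assumes rd: "real_distribution \<sigma>" and w: "(\<lambda>x. \<bar>w x\<bar> * x^2) summable_on {0<..}"
    and \<sigma>: "\<And>z. char \<sigma> z = complex_of_real (exp (cos_exponent w z))"
    and w0: "\<And>x. x > 0 \<Longrightarrow> 0 \<le> w x"
  shows "\<sigma> \<in> ID"
  unfolding ID_def
proof (intro CollectI conjI rd allI impI)
  fix n :: nat assume n: "n \<ge> 1"
  have "(\<lambda>x. inverse (real n) * (\<bar>w x\<bar> * x^2)) summable_on {0<..}" by (intro summable_on_cmult_right w)
  then have "(\<lambda>x. \<bar>inverse (real n) * w x\<bar> * x^2) summable_on {0<..}"
    by (simp add: abs_mult mult_ac)
  from exists_distribution_cos_exponent[OF this] w0 obtain \<tau> where
    \<tau>: "real_distribution \<tau>" "\<And>z. char \<tau> z = complex_of_real (exp (cos_exponent (\<lambda>x. inverse (real n) * w x) z))"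
    by auto
  have "cos_exponent (\<lambda>x. inverse (real n) * w x) z = inverse (real n) * cos_exponent w z" for z
  proof -
    have "cos_exponent (\<lambda>x. inverse (real n) * w x) z
      = (\<Sum>\<^sub>\<infinity>x\<in>{0<..}. inverse (real n) * (2 * w x * (cos (x * z) - 1)))"
      unfolding cos_exponent_def by (simp add: mult_ac)
    also have "\<dots> = inverse (real n) * cos_exponent w z"
      unfolding cos_exponent_def by (rule infsum_cmult_right) (intro cos_terms_summable w)
    finally show ?thesis .
  qed
  then have "char (convolution_power n \<tau>) = char \<sigma>"
    using n by (auto simp: fun_eq_iff real_distribution_convolution_power[OF \<tau>(1)] \<tau>(2) \<sigma> simp flip: of_real_power exp_of_nat_mult)
  then have "\<sigma> = convolution_power n \<tau>"
    by (intro Levy_uniqueness rd real_distribution_convolution_power \<tau>(1)) simp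
  then show "\<exists>\<tau>. real_distribution \<tau> \<and> \<sigma> = convolution_power n \<tau>" using \<tau>(1) by auto
qed

section \<open>Quasi-infinite divisibility\<close>

lemma has_sum_reflect:
  fixes f :: "real \<Rightarrow> 'b :: {topological_comm_monoid_add, t2_space}"
  shows "(f has_sum s) {..<0} \<longleftrightarrow> ((\<lambda>x. f (- x)) has_sum s) {0<..}"
  by (rule has_sum_reindex_bij_witness[of _ uminus uminus]) auto

text \<open>The compensating term is odd in \<open>x\<close>, so it cancels between \<open>x\<close> and \<open>-x\<close>.\<close>

lemma quasi_infinitely_divisible_cos_exponent:
  assumes rd: "real_distribution \<sigma>" and w: "(\<lambda>x. \<bar>w x\<bar> * x^2) summable_on {0<..}"
    and \<sigma>: "\<And>z. char \<sigma> z = complex_of_real (exp (cos_exponent w z))"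
  shows "quasi_infinitely_divisible \<sigma>"
proof -
  define W where "W x = (if x = 0 then 0 else w \<bar>x\<bar>)" for x :: real
  have W_sum: "(\<lambda>x. \<bar>W x\<bar> * x^2) summable_on UNIV"
  proof -
    have "((\<lambda>x. \<bar>W x\<bar> * x^2) summable_on {0<..})"
      using w by (rule summable_on_cong[THEN iffD1, rotated]) (auto simp: W_def)
    moreover from this have "((\<lambda>x. \<bar>W x\<bar> * x^2) summable_on {..<0})"
      unfolding summable_on_def has_sum_reflect by (simp add: W_def cong: if_cong)
    ultimately have "(\<lambda>x. \<bar>W x\<bar> * x^2) summable_on ({0<..} \<union> {..<0})"
      by (intro summable_on_Un_disjoint) auto
    then show ?thesis
      by (rule summable_on_cong_neutral[THEN iffD1, rotated -1]) (auto simp: W_def)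
  qed
  \<comment> \<open>A density with respect to counting measure lives on all subsets; its image under
    the identity restricts it to the Borel sets.\<close>
  define n :: "(real \<Rightarrow> real) \<Rightarrow> real measure"
    where "n V = distr (density (count_space UNIV) (\<lambda>x. ennreal (V x))) borel (\<lambda>x. x)" for V
  have sets_n: "sets (n V) = sets borel" for V by (simp add: n_def)
  have emeasure_n: "emeasure (n V) A = (\<integral>\<^sup>+x. ennreal (V x) * indicator A x \<partial>count_space UNIV)"
    if "A \<in> sets borel" for V A
    using that unfolding n_def by (simp add: emeasure_distr emeasure_density)
  have nn_n: "(\<integral>\<^sup>+x. f x \<partial>n V) = (\<integral>\<^sup>+x. ennreal (V x) * f x \<partial>count_space UNIV)"
    if "f \<in> borel_measurable borel" for V f
    using that unfolding n_def by (simp add: nn_integral_distr nn_integral_density)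
  have integral_n: "(CLINT x|n V. f x) = (CLINT x|count_space UNIV. complex_of_real (V x) * f x)"
    if "f \<in> borel_measurable borel" "\<And>x. V x \<ge> 0" for V f
    using that unfolding n_def
    by (simp add: integral_distr integral_density scaleR_conv_of_real)
  let ?p = "\<lambda>x. max 0 (W x)" and ?m = "\<lambda>x. max 0 (- W x)"
  have W_bound: "integrable (count_space UNIV) (\<lambda>x. \<bar>W x\<bar> * x^2)"
  proof -
    have "Infinite_Sum.abs_summable_on (\<lambda>x. \<bar>W x\<bar> * x^2) UNIV" using W_sum by simp
    then show ?thesis unfolding abs_summable_equivalent abs_summable_on_def .
  qed
  have fin: "(\<integral>\<^sup>+x. ennreal (min (x^2) 1) \<partial>n V) < \<infinity>" if V: "\<And>x. 0 \<le> V x" "\<And>x. V x \<le> \<bar>W x\<bar>" for V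
  proof -
    have "(\<integral>\<^sup>+x. ennreal (min (x^2) 1) \<partial>n V) = (\<integral>\<^sup>+x. ennreal (V x) * ennreal (min (x^2) 1) \<partial>count_space UNIV)"
      by (rule nn_n) simp
    also have "\<dots> \<le> (\<integral>\<^sup>+x. ennreal (\<bar>W x\<bar> * x^2) \<partial>count_space UNIV)"
      using V by (intro nn_integral_mono) (auto simp: ennreal_mult[symmetric] intro!: ennreal_leI mult_mono)
    also have "\<dots> = ennreal (LINT x|count_space UNIV. \<bar>W x\<bar> * x^2)"
      by (rule nn_integral_eq_integral[OF W_bound]) auto
    also have "\<dots> < \<infinity>" by simp
    finally show ?thesis .
  qed
  \<comment> \<open>The weight \<open>w\<close> is an arbitrary function; its negative set is Borel
    because summability leaves only countably many points with nonzero weight.\<close>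
  have countable: "countable {x. W x < 0}"
  proof -
    have "countable {x\<in>UNIV. \<bar>W x\<bar> * x^2 \<noteq> 0}" using W_sum by (rule summable_countable_real)
    then show ?thesis by (rule countable_subset[rotated]) (auto simp: W_def split: if_splits)
  qed
  have sing: "mutually_singular (n ?p) (n ?m)"
    unfolding mutually_singular_def
  proof (intro conjI bexI[of _ "{x. W x < 0}"])
    have A: "{x. W x < 0} \<in> sets borel"
      by (rule sets.countable[OF _ countable]) simp
    show "{x. W x < 0} \<in> sets (n ?p)" using A by (simp add: sets_n)
    show "emeasure (n ?p) {x. W x < 0} = 0"
      unfolding emeasure_n[OF A] by (subst nn_integral_0_iff_AE) (auto simp: indicator_def ennreal_neg)
    have "space (n ?m) - {x. W x < 0} \<in> sets borel" using A by (simp add: n_def)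
    from emeasure_n[OF this] show "emeasure (n ?m) (space (n ?m) - {x. W x < 0}) = 0"
      by (simp only:) (subst nn_integral_0_iff_AE, auto simp: indicator_def n_def ennreal_neg)
  qed (simp add: sets_n)
  have zero: "emeasure (n V) {0} = 0" if "V 0 = 0" for V
    unfolding emeasure_n[OF borel_singleton[OF sets.empty_sets]]
    using that by (subst nn_integral_0_iff_AE) (auto simp: indicator_def AE_count_space)
  have "char \<sigma> z = exp ((CLINT x|n ?p. iexp (z * x) - 1 - \<i> * complex_of_real (z * x * indicator {-1..1} x))
        - (CLINT x|n ?m. iexp (z * x) - 1 - \<i> * complex_of_real (z * x * indicator {-1..1} x)))" for z
  proof -
    let ?g = "\<lambda>x. iexp (z * x) - 1 - \<i> * complex_of_real (z * x * indicator {-1..1} x)"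
    have g_meas: "?g \<in> borel_measurable borel" by measurable
    \<comment> \<open>\<open>z^2\<close> dominates the second-order Taylor remainder on |x| \<le> 1,
      and 2 bounds the difference of two unimodular numbers outside.\<close>
    define C where "C = z^2 + 2"
    have g_bound: "cmod (?g x) \<le> C * x^2" for x
    proof (cases "\<bar>x\<bar> \<le> 1")
      case True
      then have "cmod (?g x) \<le> (z * x)^2 / 2"
        using iexp_approx1[of "z * x" 1] by (simp add: indicator_def abs_le_iff diff_diff_eq numeral_2_eq_2)
      also have "\<dots> \<le> z^2 * x^2" by (simp add: power_mult_distrib)
      also have "\<dots> \<le> C * x^2" by (intro mult_right_mono) (auto simp: C_def)
      finally show ?thesis .
    next
      case False
      then have "cmod (?g x) = cmod (iexp (z * x) - 1)" by (auto simp: indicator_def)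
      also have "\<dots> \<le> cmod (iexp (z * x)) + cmod 1" by (rule norm_triangle_ineq4)
      also have "\<dots> = 2 * 1^2" by (simp only: norm_exp_i_times norm_one) simp
      also have "\<dots> \<le> 2 * \<bar>x\<bar>^2" using False by (intro mult_left_mono power_mono) auto
      also have "\<dots> \<le> C * x^2" unfolding power2_abs by (intro mult_right_mono) (auto simp: C_def)
      finally show ?thesis .
    qed
    have int: "integrable (count_space UNIV) (\<lambda>x. complex_of_real (V x) * ?g x)" if V: "\<And>x. \<bar>V x\<bar> \<le> \<bar>W x\<bar>" for V
    proof (rule Bochner_Integration.integrable_bound)
      show "integrable (count_space UNIV) (\<lambda>x. C * (\<bar>W x\<bar> * x^2))"
        by (intro integrable_mult_right W_bound)
      show "AE x in count_space UNIV. norm (complex_of_real (V x) * ?g x) \<le> norm (C * (\<bar>W x\<bar> * x^2))"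
      proof (intro AE_I2)
        fix x
        have "norm (complex_of_real (V x) * ?g x) = \<bar>V x\<bar> * cmod (?g x)" by (simp only: norm_mult norm_of_real)
        also have "\<dots> \<le> \<bar>W x\<bar> * (C * x^2)" by (intro mult_mono V g_bound) auto
        also have "\<dots> \<le> norm (C * (\<bar>W x\<bar> * x^2))" by (simp add: mult_ac)
        finally show "norm (complex_of_real (V x) * ?g x) \<le> norm (C * (\<bar>W x\<bar> * x^2))" .
      qed
    qed simp
    have "(CLINT x|n ?p. ?g x) - (CLINT x|n ?m. ?g x)
        = (CLINT x|count_space UNIV. complex_of_real (?p x) * ?g x) - (CLINT x|count_space UNIV. complex_of_real (?m x) * ?g x)"
      by (subst (1 2) integral_n[OF g_meas]) auto
    also have "\<dots> = (CLINT x|count_space UNIV. complex_of_real (?p x) * ?g x - complex_of_real (?m x) * ?g x)"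
      by (rule Bochner_Integration.integral_diff[symmetric]; rule int) auto
    also have "\<dots> = (CLINT x|count_space UNIV. complex_of_real (W x) * ?g x)"
      by (intro Bochner_Integration.integral_cong refl)
         (simp only: left_diff_distrib[symmetric] of_real_diff[symmetric], auto simp: max_def)
    also have "\<dots> = infsum (\<lambda>x. complex_of_real (W x) * ?g x) UNIV"
      using int[of W] unfolding infsetsum_def[symmetric] by (intro infsetsum_infsum) (simp add: abs_summable_on_def)
    also have "\<dots> = complex_of_real (cos_exponent w z)"
    proof -
      let ?f = "\<lambda>x. complex_of_real (W x) * ?g x"
      have "Infinite_Sum.abs_summable_on ?f UNIV"
        using int[of W] unfolding abs_summable_equivalent abs_summable_on_def by simp
      then have s: "?f summable_on UNIV" by (rule abs_summable_summable)
      have hs: "(?f has_sum infsum ?f A) A" for A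
        by (intro has_sum_infsum summable_on_subset_banach[OF s]) simp
      have "(?f has_sum (infsum ?f {0<..} + infsum ?f {..<0})) ({0<..} \<union> {..<0})"
        by (intro has_sum_Un_disjoint hs) auto
      then have "(?f has_sum (infsum ?f {0<..} + infsum ?f {..<0})) UNIV"
        by (rule has_sum_cong_neutral[THEN iffD1, rotated -1]) (auto simp: W_def)
      then have e1: "infsum ?f UNIV = infsum ?f {0<..} + infsum ?f {..<0}" by (rule infsumI)
      have "((\<lambda>x. ?f x + ?f (- x)) has_sum (infsum ?f {0<..} + infsum ?f {..<0})) {0<..}"
        using hs[of "{..<0}"] unfolding has_sum_reflect by (intro has_sum_add hs) simp
      also have "?this \<longleftrightarrow> ((\<lambda>x. complex_of_real (2 * w x * (cos (x * z) - 1))) has_sum (infsum ?f {0<..} + infsum ?f {..<0})) {0<..}"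
      proof (rule has_sum_cong)
        fix x :: real assume x: "x \<in> {0<..}"
        have c: "complex_of_real (cos (x * z)) = (iexp (z * x) + iexp (z * - x)) / 2"
          by (simp add: cos_exp_eq mult_ac flip: cos_of_real)
        have i: "indicator {-1..1} (- x) = (indicator {-1..1} x :: real)" by (auto simp: indicator_def)
        have W': "W x = w x" "W (- x) = w x" using x by (auto simp: W_def)
        show "?f x + ?f (- x) = complex_of_real (2 * w x * (cos (x * z) - 1))"
          unfolding W' i of_real_mult of_real_diff c of_real_minus by (simp add: algebra_simps)
      qed
      finally have "((\<lambda>x. complex_of_real (2 * w x * (cos (x * z) - 1))) has_sum (infsum ?f {0<..} + infsum ?f {..<0})) {0<..}" .
      moreover have "((\<lambda>x. complex_of_real (2 * w x * (cos (x * z) - 1))) has_sum complex_of_real (cos_exponent w z)) {0<..}"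
        unfolding cos_exponent_def by (intro has_sum_of_real has_sum_infsum cos_terms_summable w)
      ultimately show ?thesis unfolding e1 by (rule has_sum_unique)
    qed
    finally show ?thesis by (simp only: \<sigma> exp_of_real)
  qed
  moreover have "?p 0 = 0" "?m 0 = 0" by (auto simp: W_def)
  ultimately show ?thesis
    unfolding quasi_infinitely_divisible_def
    by (intro conjI rd exI[of _ 0] exI[of _ "n ?p"] exI[of _ "n ?m"] sets_n sing zero fin allI) auto
qed

section \<open>Paths\<close>

lemma rational_sequence_at_right:
  assumes "e > 0"
  shows "\<exists>r :: nat \<Rightarrow> real. (\<forall>n. r n \<in> \<rat> \<and> t < r n \<and> r n < t + e) \<and> filterlim r (at_right t) sequentially"
proof -
  have "\<exists>x\<in>\<rat>. t < x \<and> x < t + min e (inverse (real (Suc n)))" for n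
    using assms by (intro Rats_dense_in_real) simp
  then obtain r where r: "\<And>n. r n \<in> \<rat>" "\<And>n. t < r n" "\<And>n. r n < t + min e (inverse (real (Suc n)))"
    by metis
  have "r \<longlonglongrightarrow> t"
  proof (rule tendsto_sandwich[of "\<lambda>_. t" r _ "\<lambda>n. t + inverse (real (Suc n))"])
    show "(\<lambda>n. t + inverse (real (Suc n))) \<longlonglongrightarrow> t"
      using tendsto_add[OF tendsto_const LIMSEQ_inverse_real_of_nat, of t] by simp
    show "\<forall>\<^sub>F n in sequentially. r n \<le> t + inverse (real (Suc n))"
      using r(3) by (intro always_eventually allI less_imp_le) (meson add_left_mono less_le_trans min.cobounded2)
    show "\<forall>\<^sub>F n in sequentially. t \<le> r n"
      using r(2) by (intro always_eventually allI less_imp_le)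
  qed simp
  moreover have "r n \<noteq> t" for n using r(2)[of n] by simp
  ultimately have "filterlim r (at_right t) sequentially"
    using r(2) by (auto simp: filterlim_at)
  moreover have "r n < t + e" for n using r(3)[of n] by linarith
  ultimately show ?thesis using r(1,2) by (intro exI[of _ r]) simp
qed

text \<open>Almost sure statements about increments hold simultaneously only for countably many
  pairs of times; right-continuity and closedness of \<open>C\<close> extend them from the rational
  pairs. The case s = t is the reason for \<open>0 \<in> C\<close>.\<close>

lemma increments_closed_from_rationals:
  fixes f :: "real \<Rightarrow> real"
  assumes rc: "\<And>t. t \<ge> 0 \<Longrightarrow> (f \<longlongrightarrow> f t) (at_right t)" and C: "closed C" "0 \<in> C"
    and rat: "\<And>s t. s \<in> \<rat> \<Longrightarrow> t \<in> \<rat> \<Longrightarrow> 0 \<le> s \<Longrightarrow> s \<le> t \<Longrightarrow> f t - f s \<in> C"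
    and st: "0 \<le> s" "s \<le> t"
  shows "f t - f s \<in> C"
proof (cases "s = t")
  case False
  with st have "t - s > 0" by simp
  from rational_sequence_at_right[OF this, of s] obtain a where
    a: "(\<forall>n. a n \<in> \<rat> \<and> s < a n \<and> a n < s + (t - s)) \<and> filterlim a (at_right s) sequentially" ..
  from rational_sequence_at_right[OF zero_less_one, of t] obtain b where
    b: "(\<forall>n. b n \<in> \<rat> \<and> t < b n \<and> b n < t + 1) \<and> filterlim b (at_right t) sequentially" ..
  have "(\<lambda>n. f (b n) - f (a n)) \<longlonglongrightarrow> f t - f s"
    using st by (intro tendsto_diff filterlim_compose[OF rc conjunct2[OF a]] filterlim_compose[OF rc conjunct2[OF b]]) auto
  moreover have "f (b n) - f (a n) \<in> C" for n
    using spec[OF conjunct1[OF a], of n] spec[OF conjunct1[OF b], of n] st by (intro rat) auto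
  ultimately show ?thesis using closed_sequentially[OF C(1), of "\<lambda>n. f (b n) - f (a n)"] by blast
qed (use C in auto)

lemma grid_cell:
  fixes n :: nat and s :: real
  assumes "n > 0" "s > 0"
  obtains i where "real i / real n < s" "s \<le> real (Suc i) / real n"
    "\<And>j. real j / real n < s \<and> s \<le> real (Suc j) / real n \<longleftrightarrow> j = i"
proof -
  define i where "i = nat (\<lceil>s * real n\<rceil> - 1)"
  have "s * real n > 0" using assms by simp
  then have "real i < s * real n" "s * real n \<le> real (Suc i)" by (auto simp: i_def) linarith+
  then have i: "real i / real n < s" "s \<le> real (Suc i) / real n" using assms by (auto simp: field_simps)
  show ?thesis
  proof (rule that[OF i])
    fix j show "real j / real n < s \<and> s \<le> real (Suc j) / real n \<longleftrightarrow> j = i"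
    proof
      assume j: "real j / real n < s \<and> s \<le> real (Suc j) / real n"
      then have "real j < real (Suc i)" "real i < real (Suc j)"
        using i assms by (auto simp: field_simps)
      then show "j = i" by simp
    qed (use i in auto)
  qed
qed

lemma tendsto_of_inverse_real_bound:
  fixes f :: "nat \<Rightarrow> real"
  assumes "\<And>n. \<bar>f n - l\<bar> \<le> 1 / real (Suc n)"
  shows "f \<longlonglongrightarrow> l"
proof (rule LIM_zero_cancel, rule Lim_null_comparison)
  show "\<forall>\<^sub>F n in sequentially. norm (f n - l) \<le> inverse (real (Suc n))"
    using assms by (simp add: inverse_eq_divide)
qed (rule LIMSEQ_inverse_real_of_nat)

text \<open>On a counting path exactly one cell contains the first jump T, and the sum picks
  \<open>G\<close> of L at the right end of that cell if T \<le> t. It is a finite expression in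
  grid values, hence measurable. The value type is general because \<open>G\<close> is the identity
  for a measurable version of L at T and a complex exponential for its law.\<close>

definition first_jump_sum :: "(real \<Rightarrow> real) \<Rightarrow> (real \<Rightarrow> real) \<Rightarrow> (real \<Rightarrow> 'b::{real_normed_algebra_1}) \<Rightarrow> nat \<Rightarrow> nat \<Rightarrow> 'b" where
  "first_jump_sum N L G t n = (\<Sum>j<t * Suc n. of_bool (N (real j / real (Suc n)) = 0 \<and> N (real (Suc j) / real (Suc n)) \<noteq> 0)
      * G (L (real (Suc j) / real (Suc n))))"

text \<open>N is taken at the left end of the cell, so that refinement produces the left limit in
  the integrand.\<close>

definition riemann_sum :: "(real \<Rightarrow> real) \<Rightarrow> (real \<Rightarrow> real) \<Rightarrow> real \<Rightarrow> nat \<Rightarrow> nat \<Rightarrow> real" where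
  "riemann_sum N L c t n = (\<Sum>i<t * Suc n. c powr (- N (real i / real (Suc n))) *
      (L (real (Suc i) / real (Suc n)) - L (real i / real (Suc n))))"

definition path_integral :: "(real \<Rightarrow> real) \<Rightarrow> (real \<Rightarrow> real) \<Rightarrow> real \<Rightarrow> real \<Rightarrow> real" where
  "path_integral N L c t = (LINT s:{0<..t}|interval_measure (\<lambda>s. L (max 0 s)). c powr (- left_limit N s))"

text \<open>Properties of a single path that hold almost surely, so that the pathwise analysis is
  free of probability. Unboundedness of N makes the first jump time finite and later sends c^(-N) to
  0.\<close>

locale counting_path =
  fixes N L :: "real \<Rightarrow> real"
  assumes N_right: "t \<ge> 0 \<Longrightarrow> (N \<longlongrightarrow> N t) (at_right t)"
    and L_right: "t \<ge> 0 \<Longrightarrow> (L \<longlongrightarrow> L t) (at_right t)"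
    and N_left: "t > 0 \<Longrightarrow> \<exists>l. (N \<longlongrightarrow> l) (at_left t)"
    and N_zero: "N 0 = 0"
    and N_increment: "0 \<le> s \<Longrightarrow> s \<le> t \<Longrightarrow> N t - N s \<in> \<nat>"
    and L_increment: "0 \<le> s \<Longrightarrow> s \<le> t \<Longrightarrow> L s \<le> L t"
    and N_unbounded: "\<exists>n::nat. B \<le> N (real n)"
begin

lemma N_mono: "0 \<le> s \<Longrightarrow> s \<le> t \<Longrightarrow> N s \<le> N t"
  using N_increment[of s t] by (auto elim!: Nats_cases)

lemma N_nat: "0 \<le> t \<Longrightarrow> N t \<in> \<nat>"
  using N_increment[of 0 t] by (simp add: N_zero)

lemma N_nonneg: "0 \<le> t \<Longrightarrow> 0 \<le> N t"
  using N_mono[of 0 t] by (simp add: N_zero)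

lemma N_pos_ge_one: "0 \<le> t \<Longrightarrow> N t \<noteq> 0 \<Longrightarrow> 1 \<le> N t"
  using N_nat[of t] by (auto elim!: Nats_cases)

lemma filterlim_N: "filterlim (\<lambda>n. N (real n)) at_top sequentially"
  unfolding filterlim_at_top
proof
  fix B
  obtain n where "B \<le> N (real n)" using N_unbounded by blast
  then show "\<forall>\<^sub>F m in sequentially. B \<le> N (real m)"
    using N_mono[of "real n"] by (intro eventually_sequentiallyI[of n]) (meson of_nat_0_le_iff of_nat_mono order_trans)
qed

text \<open>The definition looks for the first t at which N differs from its left limit. This agrees
  with the infimum T of the times with N nonzero: N vanishes before T, and since nonzero values are
  at least 1, right-continuity forces N to be nonzero at T. So T is itself a jump and the infimum is
  attained.\<close>

lemma first_jump_time:
  shows "0 < first_jump_time N" "N (first_jump_time N) \<noteq> 0"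
    "0 \<le> t \<Longrightarrow> t < first_jump_time N \<Longrightarrow> N t = 0"
proof -
  define U where "U = {t. 0 \<le> t \<and> N t \<noteq> 0}"
  define T where "T = Inf U"
  have "U \<noteq> {}"
  proof -
    obtain n :: nat where "1 \<le> N (real n)" using N_unbounded by blast
    then have "real n \<in> U" by (auto simp: U_def)
    then show ?thesis by blast
  qed
  have bdd: "bdd_below U" by (auto simp: U_def intro!: bdd_belowI[of _ 0])
  have T0: "0 \<le> T" unfolding T_def using \<open>U \<noteq> {}\<close> by (intro cInf_greatest) (auto simp: U_def)
  have below: "N t = 0" if "0 \<le> t" "t < T" for t
    using cInf_lower[OF _ bdd, of t] that by (force simp: U_def T_def)
  have NT: "N T \<noteq> 0"
  proof
    assume "N T = 0"
    then have "\<forall>\<^sub>F t in at_right T. N t < 1"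
      using order_tendstoD(2)[OF N_right[OF T0], of 1] by simp
    then obtain b where b: "b > T" "\<And>t. T < t \<Longrightarrow> t < b \<Longrightarrow> N t < 1"
      unfolding eventually_at_right_field by auto
    have "b \<le> T" unfolding T_def
    proof (rule cInf_greatest[OF \<open>U \<noteq> {}\<close>])
      fix x assume x: "x \<in> U"
      then have "T \<le> x" unfolding T_def by (rule cInf_lower[OF _ bdd])
      then show "b \<le> x" using x b(2)[of x] \<open>N T = 0\<close> N_pos_ge_one[of x] by (force simp: U_def)
    qed
    then show False using b by simp
  qed
  then have Tpos: "0 < T" using T0 N_zero by (cases "T = 0") auto
  have left: "left_limit N s = 0" if s: "0 < s" "s \<le> T" for s
  proof -
    have "\<forall>\<^sub>F t in at_left s. N t = 0"
      unfolding eventually_at_left_field using s by (intro exI[of _ 0]) (auto intro!: below)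
    then have "(N \<longlongrightarrow> 0) (at_left s)" by (rule tendsto_eventually)
    then show ?thesis unfolding left_limit_def by (intro tendsto_Lim) auto
  qed
  have "first_jump_time N = T"
    unfolding first_jump_time_def
  proof (rule cInf_eq_minimum)
    show "T \<in> {t. 0 < t \<and> N t \<noteq> left_limit N t}" using Tpos NT left[of T] by auto
    show "T \<le> t" if "t \<in> {t. 0 < t \<and> N t \<noteq> left_limit N t}" for t
      using that left[of t] below[of t] by (cases "t < T") auto
  qed
  then show "0 < first_jump_time N" "N (first_jump_time N) \<noteq> 0"
    "0 \<le> t \<Longrightarrow> t < first_jump_time N \<Longrightarrow> N t = 0"
    using Tpos NT below by auto
qed

lemma N_eq_0_iff: "0 \<le> t \<Longrightarrow> N t = 0 \<longleftrightarrow> t < first_jump_time N"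
  using first_jump_time N_mono[of "first_jump_time N" t] N_nonneg[of "first_jump_time N"]
  by (metis less_eq_real_def linorder_not_less order_antisym)

text \<open>The witness is the right end of the cell containing the jump; it is never before the
  jump, so right-continuity of L will suffice for the limit.\<close>

lemma first_jump_sum_cases:
  obtains \<tau> where "first_jump_sum N L G t n = (if first_jump_time N \<le> real t then G (L \<tau>) else 0)"
    "first_jump_time N \<le> \<tau>" "\<tau> < first_jump_time N + 1 / real (Suc n)"
proof -
  let ?T = "first_jump_time N"
  obtain i where i: "real i / real (Suc n) < ?T" "?T \<le> real (Suc i) / real (Suc n)"
    "\<And>j. real j / real (Suc n) < ?T \<and> ?T \<le> real (Suc j) / real (Suc n) \<longleftrightarrow> j = i"
    using grid_cell[of "Suc n" ?T] first_jump_time(1) by auto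
  have iff: "N (real j / real (Suc n)) = 0 \<and> N (real (Suc j) / real (Suc n)) \<noteq> 0 \<longleftrightarrow> j = i" for j
    using i(3)[of j] by (simp add: N_eq_0_iff not_less del: of_nat_Suc)
  have mem: "i < t * Suc n \<longleftrightarrow> ?T \<le> real t"
  proof
    assume "i < t * Suc n"
    then have "real (Suc i) \<le> real (t * Suc n)" by (intro of_nat_mono) simp
    then have "real (Suc i) / real (Suc n) \<le> real t" by (simp add: field_simps)
    then show "?T \<le> real t" using i by simp
  next
    assume "?T \<le> real t"
    then have "real i / real (Suc n) < real t" using i by simp
    then have "real i < real (t * Suc n)" by (simp add: field_simps)
    then show "i < t * Suc n" by (simp only: of_nat_less_iff)
  qed
  have "first_jump_sum N L G t n = (\<Sum>j<t * Suc n. if j = i then G (L (real (Suc i) / real (Suc n))) else 0)"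
    unfolding first_jump_sum_def iff by (intro sum.cong) auto
  also have "\<dots> = (if ?T \<le> real t then G (L (real (Suc i) / real (Suc n))) else 0)"
    using mem by (simp only: sum.delta finite_lessThan lessThan_iff)
  finally show ?thesis
  proof (rule that)
    have "real (Suc i) / real (Suc n) = real i / real (Suc n) + 1 / real (Suc n)"
      by (simp add: add_divide_distrib)
    then show "real (Suc i) / real (Suc n) < ?T + 1 / real (Suc n)" using i(1) by linarith
  qed (rule i(2))
qed

lemma first_jump_sum_tendsto:
  assumes G: "\<And>x. isCont G x"
  shows "(\<lambda>n. first_jump_sum N L G t n) \<longlonglongrightarrow> (if first_jump_time N \<le> real t then G (L (first_jump_time N)) else 0)"
proof -
  let ?T = "first_jump_time N"
  have "\<exists>\<tau>. first_jump_sum N L G t n = (if ?T \<le> real t then G (L \<tau>) else 0) \<and> ?T \<le> \<tau> \<and> \<tau> < ?T + 1 / real (Suc n)" for n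
    using first_jump_sum_cases[of G t n] by metis
  then obtain \<tau> where \<tau>: "\<And>n. first_jump_sum N L G t n = (if ?T \<le> real t then G (L (\<tau> n)) else 0)"
    "\<And>n. ?T \<le> \<tau> n" "\<And>n. \<tau> n < ?T + 1 / real (Suc n)" by metis
  have "\<tau> \<longlonglongrightarrow> ?T"
  proof (rule tendsto_of_inverse_real_bound)
    fix n show "\<bar>\<tau> n - ?T\<bar> \<le> 1 / real (Suc n)" using \<tau>(2,3)[of n] by linarith
  qed
  have Lc: "((\<lambda>x. L x) \<longlongrightarrow> L ?T) (at ?T within {?T..})"
  proof -
    have "{?T..} - {?T} = {?T<..} - {?T}" by auto
    then have "at ?T within {?T..} = at_right ?T" unfolding at_within_def by simp
    then show ?thesis using L_right[of ?T] first_jump_time(1) by simp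
  qed
  have "continuous (at ?T within {?T..}) L" using Lc by (simp add: continuous_within)
  then have "(\<lambda>n. L (\<tau> n)) \<longlonglongrightarrow> L ?T"
    using \<open>\<tau> \<longlonglongrightarrow> ?T\<close> \<tau>(2) by (auto simp: continuous_within_sequentially o_def)
  then have "(\<lambda>n. G (L (\<tau> n))) \<longlonglongrightarrow> G (L ?T)"
    by (rule isCont_tendsto_compose[OF G])
  then show ?thesis by (simp add: \<tau>(1))
qed

lemma left_limit_N:
  assumes s: "0 < s"
  shows "(N \<longlongrightarrow> left_limit N s) (at_left s)"
proof -
  obtain l where "(N \<longlongrightarrow> l) (at_left s)" using N_left[OF s] by blast
  then show ?thesis unfolding left_limit_def by (metis tendsto_Lim trivial_limit_at_left_real)
qed

abbreviation "L_measure \<equiv> interval_measure (\<lambda>s. L (max 0 s))"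

lemma emeasure_L_measure: "a \<le> b \<Longrightarrow> emeasure L_measure {a<..b} = ennreal (L (max 0 b) - L (max 0 a))"
proof (rule emeasure_interval_measure_Ioc)
  show "L (max 0 x) \<le> L (max 0 y)" if "x \<le> y" for x y using that by (intro L_increment) auto
  show "continuous (at_right a) (\<lambda>s. L (max 0 s))" for a :: real
  proof (cases "a < 0")
    case True
    then have "\<forall>\<^sub>F s in at_right a. L (max 0 s) = L 0"
      unfolding eventually_at_right_field by (intro exI[of _ 0]) (auto simp: max_def)
    then have "((\<lambda>s. L (max 0 s)) \<longlongrightarrow> L 0) (at_right a)" by (rule tendsto_eventually)
    then show ?thesis using True by (simp add: continuous_within max_def)
  next
    case False
    then have "\<forall>\<^sub>F s in at_right a. L s = L (max 0 s)"
      unfolding eventually_at_right_field by (intro exI[of _ "a + 1"]) (auto simp: max_def)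
    from Lim_transform_eventually[OF L_right this] show ?thesis
      using False by (simp add: continuous_within max_def)
  qed
qed

lemma measure_L_measure:
  assumes "0 \<le> a" "a \<le> b" shows "measure L_measure {a<..b} = L b - L a"
proof -
  have "0 \<le> L b - L a" using L_increment[of a b] assms by simp
  then show ?thesis unfolding measure_def using assms by (simp add: emeasure_L_measure)
qed

text \<open>The step functions \<open>f n\<close> take N at a grid point strictly before s, so they
  converge pointwise to the left-limit integrand, which inherits their measurability; and they are
  bounded by the indicator of (0, t]. The Riemann sums are their integrals, and dominated
  convergence does the rest.\<close>

lemma path_integral_approx:
  assumes c: "c > 1"
  shows "set_integrable L_measure {0<..real t} (\<lambda>s. c powr (- left_limit N s))"
    "(\<lambda>n. riemann_sum N L c t n) \<longlonglongrightarrow> path_integral N L c (real t)"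
proof -
  define f where "f n s = (\<Sum>i<t * Suc n. c powr (- N (real i / real (Suc n))) *
      indicator {real i / real (Suc n)<..real (Suc i) / real (Suc n)} s)" for n s
  let ?g = "\<lambda>s. indicator {0<..real t} s *\<^sub>R c powr (- left_limit N s)"
  have f_outside: "f n s = 0" if "\<not> (0 < s \<and> s \<le> real t)" for n s
    unfolding f_def
  proof (intro sum.neutral ballI)
    fix i assume "i \<in> {..<t * Suc n}"
    then have "real (Suc i) \<le> real (t * Suc n)" by (intro of_nat_mono) auto
    then have "real (Suc i) / real (Suc n) \<le> real t" by (simp add: field_simps)
    moreover have "0 \<le> real i / real (Suc n)" by simp
    ultimately have "s \<notin> {real i / real (Suc n)<..real (Suc i) / real (Suc n)}"
      unfolding greaterThanAtMost_iff using that by linarith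
    then have "indicator {real i / real (Suc n)<..real (Suc i) / real (Suc n)} s = (0 :: real)"
      by (rule indicator_simps(2))
    then show "c powr - N (real i / real (Suc n)) * indicator {real i / real (Suc n)<..real (Suc i) / real (Suc n)} s = 0"
      by (rule ssubst) (rule mult_zero_right)
  qed
  have f_inside: "\<exists>i. f n s = c powr (- N (real i / real (Suc n))) \<and> real i / real (Suc n) < s
      \<and> s \<le> real i / real (Suc n) + 1 / real (Suc n)" if s: "0 < s" "s \<le> real t" for n s
  proof -
    obtain i where i: "real i / real (Suc n) < s" "s \<le> real (Suc i) / real (Suc n)"
      "\<And>j. real j / real (Suc n) < s \<and> s \<le> real (Suc j) / real (Suc n) \<longleftrightarrow> j = i"
      using grid_cell[of "Suc n" s] s(1) by auto
    have "real i / real (Suc n) < real t" using i s by simp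
    then have "real i < real (t * Suc n)" by (simp add: field_simps)
    then have mem: "i < t * Suc n" by (simp only: of_nat_less_iff)
    have ind: "indicator {real j / real (Suc n)<..real (Suc j) / real (Suc n)} s = (if j = i then 1 else 0 :: real)" for j
      using i(3)[of j] by (simp only: indicator_def greaterThanAtMost_iff of_bool_def)
    have "f n s = (\<Sum>j<t * Suc n. if j = i then c powr (- N (real i / real (Suc n))) else 0)"
      unfolding f_def ind by (intro sum.cong) auto
    also have "\<dots> = c powr (- N (real i / real (Suc n)))"
      using mem by (simp only: sum.delta finite_lessThan lessThan_iff if_True)
    finally have "f n s = c powr (- N (real i / real (Suc n)))" .
    moreover have "real (Suc i) / real (Suc n) = real i / real (Suc n) + 1 / real (Suc n)"
      by (simp add: add_divide_distrib)
    ultimately show ?thesis using i(1,2) by (intro exI[of _ i]) simp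
  qed
  have powr_le: "c powr (- x) \<le> 1" if "0 \<le> x" for x
    using that c powr_mono[of "-x" 0 c] by simp
  have f_bound: "norm (f n s) \<le> indicator {0<..real t} s" for n s
  proof (cases "0 < s \<and> s \<le> real t")
    case True
    then obtain i where "f n s = c powr (- N (real i / real (Suc n)))" using f_inside by blast
    then show ?thesis using True powr_le N_nonneg by simp
  qed (auto simp: f_outside)
  have f_lim: "(\<lambda>n. f n s) \<longlonglongrightarrow> ?g s" for s
  proof (cases "0 < s \<and> s \<le> real t")
    case True
    then obtain i where i: "\<And>n. f n s = c powr (- N (real (i n) / real (Suc n)))" "\<And>n. real (i n) / real (Suc n) < s"
      "\<And>n. s \<le> real (i n) / real (Suc n) + 1 / real (Suc n)" using f_inside by metis
    have "(\<lambda>n. real (i n) / real (Suc n)) \<longlonglongrightarrow> s"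
    proof (rule tendsto_of_inverse_real_bound)
      fix n show "\<bar>real (i n) / real (Suc n) - s\<bar> \<le> 1 / real (Suc n)" using i(2,3)[of n] by linarith
    qed
    moreover have "real (i n) / real (Suc n) \<noteq> s" for n using i(2)[of n] by simp
    ultimately have "filterlim (\<lambda>n. real (i n) / real (Suc n)) (at_left s) sequentially"
      using i(2) by (auto simp: filterlim_at simp del: of_nat_Suc)
    from filterlim_compose[OF left_limit_N this] True
    have "(\<lambda>n. N (real (i n) / real (Suc n))) \<longlonglongrightarrow> left_limit N s" by simp
    then have "(\<lambda>n. f n s) \<longlonglongrightarrow> c powr (- left_limit N s)"
      unfolding i(1) using c by (intro tendsto_intros) auto
    then show ?thesis using True by simp
  qed (auto simp: f_outside)
  have fin: "emeasure L_measure {0<..real t} < \<infinity>" by (simp add: emeasure_L_measure)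
  have f_meas: "f n \<in> borel_measurable L_measure" for n unfolding f_def by measurable
  have g_meas: "?g \<in> borel_measurable L_measure"
    by (rule borel_measurable_LIMSEQ_metric[OF f_meas f_lim])
  have dom: "integrable L_measure (indicator {0<..real t} :: real \<Rightarrow> real)"
    using fin by (intro integrable_real_indicator) auto
  note dc = integrable_dominated_convergence[OF g_meas f_meas dom AE_I2[OF f_lim] AE_I2[OF f_bound]]
    integral_dominated_convergence[OF g_meas f_meas dom AE_I2[OF f_lim] AE_I2[OF f_bound]]
  show "set_integrable L_measure {0<..real t} (\<lambda>s. c powr (- left_limit N s))"
    unfolding set_integrable_def by (rule dc(1))
  have "integral\<^sup>L L_measure (f n) = riemann_sum N L c t n" for n
  proof -
    have le: "real i / real (Suc n) \<le> real (Suc i) / real (Suc n)" for i by (simp add: divide_right_mono)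
    have int: "integrable L_measure (\<lambda>s. indicator {real i / real (Suc n)<..real (Suc i) / real (Suc n)} s :: real)" for i
      by (intro integrable_real_indicator) (simp_all add: emeasure_L_measure[OF le] del: of_nat_Suc)
    show ?thesis
      unfolding f_def riemann_sum_def
      by (subst Bochner_Integration.integral_sum)
        (auto intro!: integrable_mult_right int sum.cong simp: measure_L_measure[OF _ le] simp del: of_nat_Suc)
  qed
  with dc(2) show "(\<lambda>n. riemann_sum N L c t n) \<longlonglongrightarrow> path_integral N L c (real t)"
    unfolding path_integral_def set_lebesgue_integral_def by simp
qed

lemma path_integral_mono:
  assumes c: "c > 1" and st: "s \<le> t"
  shows "path_integral N L c s \<le> path_integral N L c t"
proof -
  let ?h = "\<lambda>s. c powr (- left_limit N s)"
  have int: "set_integrable L_measure {0<..x} ?h" for x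
  proof -
    have "set_integrable L_measure {0<..real (nat \<lceil>x\<rceil>)} ?h" by (rule path_integral_approx(1)[OF c])
    then show ?thesis by (rule set_integrable_subset) (auto, linarith)
  qed
  have "(LINT x:{0<..s}|L_measure. ?h x) \<le> (LINT x:{0<..t}|L_measure. ?h x)"
    unfolding set_lebesgue_integral_def
    using int[of s] int[of t] st unfolding set_integrable_def
    by (intro integral_mono) (auto simp: indicator_def)
  then show ?thesis by (simp add: path_integral_def)
qed

text \<open>The integral is nondecreasing in its upper limit, so convergence along the integers
  gives the limit over the reals that the definition of \<open>mu\<close> takes.\<close>

lemma path_integral_tendsto:
  assumes c: "c > 1" and lim: "(\<lambda>n. path_integral N L c (real n)) \<longlonglongrightarrow> l"
  shows "Lim at_top (path_integral N L c) = l"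
proof (rule tendsto_Lim)
  have inc: "incseq (\<lambda>n. path_integral N L c (real n))"
    by (intro incseq_SucI path_integral_mono[OF c]) simp
  show "(path_integral N L c \<longlongrightarrow> l) at_top"
  proof (rule order_tendstoI)
    fix a assume "a < l"
    then obtain n where "a < path_integral N L c (real n)"
      using order_tendstoD(1)[OF lim, of a] by (auto simp: eventually_sequentially)
    then show "\<forall>\<^sub>F t in at_top. a < path_integral N L c t"
      using path_integral_mono[OF c] by (intro eventually_at_top_linorderI[of "real n"]) (meson less_le_trans)
  next
    fix a assume "l < a"
    have "path_integral N L c t < a" for t
    proof -
      have "path_integral N L c t \<le> path_integral N L c (real (nat \<lceil>t\<rceil>))"
        by (rule path_integral_mono[OF c]) linarith
      also have "\<dots> \<le> l" by (rule incseq_le[OF inc lim])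
      finally show ?thesis using \<open>l < a\<close> by simp
    qed
    then show "\<forall>\<^sub>F t in at_top. path_integral N L c t < a" by simp
  qed
qed simp

end

section \<open>The law of the process at the first jump\<close>

lemma integral_levy_measure:
  fixes f :: "real \<times> real \<Rightarrow> complex"
  assumes "c > 0" "u \<ge> 0" "v \<ge> 0" "w \<ge> 0" and f: "f \<in> borel_measurable borel"
  shows "(CLINT x|levy_measure c k u v w. f x)
    = complex_of_real u * f (1, 0) + complex_of_real v * f (0, 1) + complex_of_real w * f (1, c powi (- k))"
proof -
  define d where "d = c powi (- k)"
  have d: "d \<noteq> 0" using assms(1) by (simp add: d_def)
  define S :: "(real \<times> real) set" where "S = {(1, 0), (0, 1), (1, d)}"
  define g :: "real \<times> real \<Rightarrow> real" where "g = (\<lambda>x. if x = (1, 0) then u else if x = (0, 1) then v else w)"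
  have "(CLINT x|levy_measure c k u v w. f x) = (CLINT x|point_measure S (\<lambda>x. ennreal (g x)). f x)"
    unfolding levy_measure_def d_def[symmetric] S_def[symmetric] g_def[symmetric]
    by (subst integral_distr) (use f in \<open>auto simp: g_def S_def\<close>)
  also have "\<dots> = (\<Sum>x\<in>S. g x *\<^sub>R f x)"
    using assms by (intro lebesgue_integral_point_measure_finite) (auto simp: S_def g_def)
  also have "\<dots> = complex_of_real u * f (1, 0) + complex_of_real v * f (0, 1) + complex_of_real w * f (1, d)"
    using d by (simp add: S_def g_def scaleR_conv_of_real)
  finally show ?thesis by (simp add: d_def)
qed

locale compound_poisson_pair =
  fixes M :: "'a measure" and N L :: "real \<Rightarrow> 'a \<Rightarrow> real" and c u v w :: real and k :: int
  assumes c: "c > 1" and u: "u \<ge> 0" and v: "v \<ge> 0" and w: "w \<ge> 0" and uw: "u + w > 0"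
    and cpp: "compound_poisson_process M (\<lambda>t \<omega>. (N t \<omega>, L t \<omega>)) (levy_measure c k u v w)"
begin

definition d :: real where "d = c powi (- k)"

lemma d_pos: "d > 0" using c by (simp add: d_def)

text \<open>The exponent of (N, L) at (z1, z2) is
  \<open>\<kappa> z2 * iexp z1 - \<theta> z2\<close>: \<kappa> gathers the jumps that move N, and
  \<theta> is the total rate less the jumps of L alone. The rates are left unnormalized.\<close>

definition \<theta> :: "real \<Rightarrow> complex" where "\<theta> z = complex_of_real (u + v + w) - complex_of_real v * iexp z"

definition \<kappa> :: "real \<Rightarrow> complex" where "\<kappa> z = complex_of_real u + complex_of_real w * iexp (z * d)"

lemma levy: "levy_process M (\<lambda>t \<omega>. (N t \<omega>, L t \<omega>))"
  using cpp by (simp add: compound_poisson_process_def)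

sublocale prob_space M using levy by (simp add: levy_process_def)

lemma measurable_NL: "0 \<le> t \<Longrightarrow> (\<lambda>\<omega>. (N t \<omega>, L t \<omega>)) \<in> borel_measurable M"
  using levy by (simp add: levy_process_def)

lemma measurable_N: "0 \<le> t \<Longrightarrow> N t \<in> borel_measurable M"
  and measurable_L: "0 \<le> t \<Longrightarrow> L t \<in> borel_measurable M"
proof -
  assume t: "0 \<le> t"
  have "fst \<in> borel_measurable (borel :: (real \<times> real) measure)" "snd \<in> borel_measurable (borel :: (real \<times> real) measure)"
    by (intro borel_measurable_continuous_onI continuous_intros)+
  from this[THEN measurable_compose[OF measurable_NL[OF t]]]
  show "N t \<in> borel_measurable M" "L t \<in> borel_measurable M" by simp_all
qed

lemma cf_NL:
  assumes "0 \<le> t"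
  shows "(CLINT \<omega>|M. iexp (z1 * N t \<omega> + z2 * L t \<omega>)) = exp (complex_of_real t * (\<kappa> z2 * iexp z1 - \<theta> z2))"
proof -
  have m: "(\<lambda>x::real \<times> real. iexp ((z1, z2) \<bullet> x) - 1) \<in> borel_measurable borel"
    by (intro borel_measurable_continuous_onI continuous_intros)
  have "(CLINT x|levy_measure c k u v w. iexp ((z1, z2) \<bullet> x) - 1) = \<kappa> z2 * iexp z1 - \<theta> z2"
    using c u v w by (subst integral_levy_measure[OF _ _ _ _ m])
      (auto simp: \<kappa>_def \<theta>_def d_def algebra_simps exp_add)
  then show ?thesis
    using cpp assms by (auto simp: compound_poisson_process_def dest!: spec[of _ t] spec[of _ "(z1, z2)"])
qed

section \<open>Laws and supports of increments\<close>

lemma increment_distr: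
  assumes "0 \<le> s" "0 \<le> t"
  shows "distr M borel (\<lambda>\<omega>. (N (s + t) \<omega> - N s \<omega>, L (s + t) \<omega> - L s \<omega>)) = distr M borel (\<lambda>\<omega>. (N t \<omega>, L t \<omega>))"
  using levy assms by (simp add: levy_process_def)

lemma integral_increment:
  fixes f :: "real \<times> real \<Rightarrow> complex"
  assumes "0 \<le> s" "0 \<le> t" and f: "f \<in> borel_measurable borel"
  shows "(CLINT \<omega>|M. f (N (s + t) \<omega> - N s \<omega>, L (s + t) \<omega> - L s \<omega>)) = (CLINT \<omega>|M. f (N t \<omega>, L t \<omega>))"
proof -
  have "(\<lambda>\<omega>. (N (s + t) \<omega>, L (s + t) \<omega>) - (N s \<omega>, L s \<omega>)) \<in> borel_measurable M"
    using assms by (intro borel_measurable_diff measurable_NL) auto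
  then have "(CLINT \<omega>|M. f (N (s + t) \<omega> - N s \<omega>, L (s + t) \<omega> - L s \<omega>))
     = (CLINT x|distr M borel (\<lambda>\<omega>. (N (s + t) \<omega> - N s \<omega>, L (s + t) \<omega> - L s \<omega>)). f x)"
    by (subst integral_distr) (use f in auto)
  also have "\<dots> = (CLINT \<omega>|M. f (N t \<omega>, L t \<omega>))"
    unfolding increment_distr[OF assms(1,2)] using measurable_NL[OF assms(2)]
    by (subst integral_distr) (use f in auto)
  finally show ?thesis .
qed

lemma AE_increment:
  assumes "0 \<le> s" "s \<le> t" and P: "Measurable.pred borel P" and AE: "AE \<omega> in M. P (N (t - s) \<omega>, L (t - s) \<omega>)"
  shows "AE \<omega> in M. P (N t \<omega> - N s \<omega>, L t \<omega> - L s \<omega>)"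
proof -
  have m: "(\<lambda>\<omega>. (N t \<omega>, L t \<omega>) - (N s \<omega>, L s \<omega>)) \<in> borel_measurable M"
    using assms by (intro borel_measurable_diff measurable_NL) auto
  have "AE x in distr M borel (\<lambda>\<omega>. (N (t - s) \<omega>, L (t - s) \<omega>)). P x"
    using assms P measurable_NL[of "t - s"] by (subst AE_distr_iff) (auto simp: pred_def)
  also have "distr M borel (\<lambda>\<omega>. (N (t - s) \<omega>, L (t - s) \<omega>)) = distr M borel (\<lambda>\<omega>. (N t \<omega> - N s \<omega>, L t \<omega> - L s \<omega>))"
    using increment_distr[of s "t - s"] assms by simp
  finally show ?thesis using m P by (subst (asm) AE_distr_iff) (auto simp: pred_def)
qed

lemma AE_N_nat: "0 \<le> t \<Longrightarrow> AE \<omega> in M. N t \<omega> \<in> \<nat>"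
proof -
  assume t: "0 \<le> t"
  have "t * (u + w) \<ge> 0" using t uw by simp
  obtain \<tau> where \<tau>: "real_distribution \<tau>" "\<And>z. char \<tau> z = exp (complex_of_real (t * (u + w)) * (iexp (z * 1) - 1))"
    "AE y in \<tau>. \<exists>n::nat. y = real n * 1"
    by (rule poisson_lattice_distribution[where x=1, OF \<open>t * (u + w) \<ge> 0\<close>], rule that)
  have "char (distr M borel (N t)) z = char \<tau> z" for z
    unfolding char_def[of "distr M borel (N t)"] \<tau>(2) using cf_NL[OF t, of z 0] measurable_N[OF t]
    by (subst integral_distr) (auto simp: \<kappa>_def \<theta>_def algebra_simps)
  then have eq: "distr M borel (N t) = \<tau>"
    using measurable_N[OF t] by (intro Levy_uniqueness \<tau>(1) real_distribution_distr) auto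
  have "AE y in \<tau>. y \<in> \<nat>" using \<tau>(3) by eventually_elim auto
  then have "AE y in distr M borel (N t). y \<in> \<nat>" unfolding eq .
  then show ?thesis using measurable_N[OF t] by (subst (asm) AE_distr_iff) auto
qed

text \<open>The characteristic function of L t is that of a sum of independent Poisson variables on
  the lattices with steps 1 and d, both supported on the nonnegative half-line.\<close>

lemma AE_L_nonneg: "0 \<le> t \<Longrightarrow> AE \<omega> in M. 0 \<le> L t \<omega>"
proof -
  assume t: "0 \<le> t"
  have "t * v \<ge> 0" "t * w \<ge> 0" using t v w by auto
  obtain \<tau> where \<tau>: "real_distribution \<tau>" "\<And>z. char \<tau> z = exp (complex_of_real (t * v) * (iexp (z * 1) - 1))"
    "AE y in \<tau>. \<exists>n::nat. y = real n * 1"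
    by (rule poisson_lattice_distribution[where x=1, OF \<open>t * v \<ge> 0\<close>], rule that)
  obtain \<tau>' where \<tau>': "real_distribution \<tau>'" "\<And>z. char \<tau>' z = exp (complex_of_real (t * w) * (iexp (z * d) - 1))"
    "AE y in \<tau>'. \<exists>n::nat. y = real n * d"
    by (rule poisson_lattice_distribution[where x=d, OF \<open>t * w \<ge> 0\<close>], rule that)
  interpret t: real_distribution \<tau> by fact
  interpret t': real_distribution \<tau>' by fact
  have "char (distr M borel (L t)) z = char (convolution \<tau> \<tau>') z" for z
  proof -
    have "char (distr M borel (L t)) z = exp (complex_of_real t * (\<kappa> z - \<theta> z))"
      unfolding char_def using cf_NL[OF t, of 0 z] measurable_L[OF t]
      by (subst integral_distr) auto
    also have "complex_of_real t * (\<kappa> z - \<theta> z) = complex_of_real (t * v) * (iexp (z * 1) - 1) + complex_of_real (t * w) * (iexp (z * d) - 1)"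
      by (simp add: \<kappa>_def \<theta>_def algebra_simps)
    finally show ?thesis
      by (simp only: real_distribution_convolution(2)[OF \<tau>(1) \<tau>'(1)] \<tau>(2) \<tau>'(2) exp_add)
  qed
  then have eq: "distr M borel (L t) = convolution \<tau> \<tau>'"
    using measurable_L[OF t]
    by (intro Levy_uniqueness real_distribution_convolution \<tau>(1) \<tau>'(1) real_distribution_distr) auto
  have "emeasure (convolution \<tau> \<tau>') {..<0} = (\<integral>\<^sup>+x. \<integral>\<^sup>+y. indicator {..<0} (x + y) \<partial>\<tau>' \<partial>\<tau>)"
    using t.finite_measure_axioms t'.finite_measure_axioms by (intro convolution_emeasure') auto
  also have "\<dots> = (\<integral>\<^sup>+x. 0 \<partial>\<tau>)"
  proof (rule nn_integral_cong_AE)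
    show "AE x in \<tau>. (\<integral>\<^sup>+y. indicator {..<0} (x + y) \<partial>\<tau>') = 0"
      using \<tau>(3)
    proof eventually_elim
      case (elim x)
      have "AE y in \<tau>'. indicator {..<0} (x + y) = (0 :: ennreal)"
        using \<tau>'(3) by eventually_elim (use elim d_pos in \<open>auto simp: indicator_def not_less\<close>)
      then have "(\<integral>\<^sup>+y. indicator {..<0} (x + y) \<partial>\<tau>') = (\<integral>\<^sup>+y. 0 \<partial>\<tau>')"
        by (rule nn_integral_cong_AE)
      then show ?case by simp
    qed
  qed
  finally have "{..<0} \<in> null_sets (distr M borel (L t))" unfolding eq by (simp add: null_sets_def)
  then have "AE y in distr M borel (L t). y \<notin> {..<0}" by (rule AE_not_in)
  then show ?thesis using measurable_L[OF t] by (subst (asm) AE_distr_iff) (auto simp: not_less)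
qed

text \<open>Averaging the joint characteristic function over a centred normal first argument of growing
  variance isolates the atom \<open>N t = m\<close>.\<close>

lemma cf_L_atom_N:
  assumes t: "0 \<le> t"
  shows "(CLINT \<omega>|M. iexp (z * L t \<omega>) * of_bool (N t \<omega> = real m))
    = exp (- (complex_of_real t * \<theta> z)) * ((complex_of_real t * \<kappa> z) ^ m /\<^sub>R fact m)"
proof -
  interpret G: real_distribution std_normal_distribution by (rule real_dist_normal_dist)
  note [measurable] = measurable_N[OF t] measurable_L[OF t]
  let ?y = "complex_of_real t * \<kappa> z" and ?A = "exp (- (complex_of_real t * \<theta> z))"
  let ?E = "\<lambda>s x. exp (- ((s * (x - real m))^2) / 2)"
  let ?lhs = "\<lambda>s. (CLINT \<omega>|M. iexp (z * L t \<omega>) * complex_of_real (?E s (N t \<omega>)))"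
  have E_lim: "(\<lambda>n. ?E (real n) x) \<longlonglongrightarrow> of_bool (x = real m)" for x
  proof (cases "x = real m")
    case False
    have "filterlim (\<lambda>n. ((x - real m)^2 / 2) * (real n * real n)) at_top sequentially"
      using False by (intro filterlim_tendsto_pos_mult_at_top[OF tendsto_const]
        filterlim_at_top_mult_at_top filterlim_real_sequentially) auto
    then have "filterlim (\<lambda>n. - (((x - real m)^2 / 2) * (real n * real n))) at_bot sequentially"
      by (simp add: filterlim_uminus_at_bot)
    from filterlim_compose[OF exp_at_bot this] show ?thesis
      using False by (simp add: power_mult_distrib power2_eq_square mult_ac)
  qed simp
  have lhs_lim: "(\<lambda>n. ?lhs (real n)) \<longlonglongrightarrow> (CLINT \<omega>|M. iexp (z * L t \<omega>) * of_bool (N t \<omega> = real m))"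
  proof (rule integral_dominated_convergence[where w="\<lambda>_. 1"])
    show "AE x in M. (\<lambda>n. iexp (z * L t x) * complex_of_real (?E (real n) (N t x)))
        \<longlonglongrightarrow> iexp (z * L t x) * of_bool (N t x = real m)"
    proof (intro AE_I2 tendsto_mult tendsto_const)
      fix x
      have "of_bool (N t x = real m) = complex_of_real (of_bool (N t x = real m))" by simp
      then show "(\<lambda>n. complex_of_real (?E (real n) (N t x))) \<longlonglongrightarrow> of_bool (N t x = real m)"
        by (rule ssubst) (rule tendsto_of_real[OF E_lim])
    qed
  qed (auto simp: norm_mult)
  \<comment> \<open>Expanding the exponential of t \<kappa> e^(i s \<xi>) in its power series before
    averaging over \<xi> turns the j-th term into a Gaussian weight at j - m, a smoothed indicator
    of j = m.\<close>
  have sums: "(\<lambda>j. ?A * ((?y ^ j /\<^sub>R fact j) * complex_of_real (?E s (real j)))) sums ?lhs s" for s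
  proof -
    let ?f = "\<lambda>j \<xi>. (?y ^ j /\<^sub>R fact j) * iexp ((s * (real j - real m)) * \<xi>)"
    have sm: "summable (\<lambda>j. norm (?y ^ j /\<^sub>R fact j))" by (rule summable_norm_exp)
    have nf: "norm (?f j \<xi>) = norm (?y ^ j /\<^sub>R fact j)" for j \<xi> by (simp only: norm_mult norm_exp_i_times mult_1_right)
    have "(\<lambda>j. CLINT \<xi>|std_normal_distribution. ?f j \<xi>) sums (CLINT \<xi>|std_normal_distribution. (\<Sum>j. ?f j \<xi>))"
    proof (rule sums_integral)
      show "integrable std_normal_distribution (?f j)" for j
        by (intro integrable_mult_right G.integrable_iexp) auto
      show "AE \<xi> in std_normal_distribution. summable (\<lambda>j. norm (?f j \<xi>))"
        unfolding nf using sm by simp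
      show "summable (\<lambda>j. LINT \<xi>|std_normal_distribution. norm (?f j \<xi>))"
        unfolding nf using sm by simp
    qed
    also have "(\<lambda>j. CLINT \<xi>|std_normal_distribution. ?f j \<xi>) = (\<lambda>j. (?y ^ j /\<^sub>R fact j) * complex_of_real (?E s (real j)))"
      by (simp only: integral_mult_right_zero integral_iexp_std_normal)
    finally have "(\<lambda>j. ?A * ((?y ^ j /\<^sub>R fact j) * complex_of_real (?E s (real j)))) sums
        (?A * (CLINT \<xi>|std_normal_distribution. (\<Sum>j. ?f j \<xi>)))"
      by (rule sums_mult)
    also have "?A * (CLINT \<xi>|std_normal_distribution. (\<Sum>j. ?f j \<xi>))
        = (CLINT \<xi>|std_normal_distribution. CLINT \<omega>|M. iexp (z * L t \<omega>) * iexp (\<xi> * (s * (N t \<omega> - real m))))"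
    proof -
      have "(CLINT \<omega>|M. iexp (z * L t \<omega>) * iexp (\<xi> * (s * (N t \<omega> - real m)))) = ?A * (\<Sum>j. ?f j \<xi>)" for \<xi>
      proof -
        have "(CLINT \<omega>|M. iexp (z * L t \<omega>) * iexp (\<xi> * (s * (N t \<omega> - real m))))
            = (CLINT \<omega>|M. iexp ((s * \<xi>) * N t \<omega> + z * L t \<omega>) * iexp (- (s * \<xi> * real m)))"
          by (intro Bochner_Integration.integral_cong refl) (simp add: algebra_simps flip: exp_add)
        also have "\<dots> = exp (complex_of_real t * (\<kappa> z * iexp (s * \<xi>) - \<theta> z)) * iexp (- (s * \<xi> * real m))"
          by (simp only: integral_mult_left_zero cf_NL[OF t])
        also have "\<dots> = ?A * (exp (?y * iexp (s * \<xi>)) * iexp (- (s * \<xi> * real m)))"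
          by (simp add: algebra_simps flip: exp_add)
        also have "exp (?y * iexp (s * \<xi>)) * iexp (- (s * \<xi> * real m)) = (\<Sum>j. ?f j \<xi>)"
        proof -
          have "(\<lambda>j. ((?y * iexp (s * \<xi>)) ^ j /\<^sub>R fact j) * iexp (- (s * \<xi> * real m))) sums
              (exp (?y * iexp (s * \<xi>)) * iexp (- (s * \<xi> * real m)))"
            by (intro sums_mult2 exp_converges)
          also have "(\<lambda>j. ((?y * iexp (s * \<xi>)) ^ j /\<^sub>R fact j) * iexp (- (s * \<xi> * real m))) = (\<lambda>j. ?f j \<xi>)"
          proof
            fix j
            have "iexp (s * \<xi>) ^ j * iexp (- (s * \<xi> * real m)) = iexp ((s * (real j - real m)) * \<xi>)"
              unfolding exp_of_nat_mult[symmetric] exp_add[symmetric]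
              by (rule arg_cong[of _ _ exp]) (simp add: algebra_simps)
            then show "((?y * iexp (s * \<xi>)) ^ j /\<^sub>R fact j) * iexp (- (s * \<xi> * real m)) = ?f j \<xi>"
              by (simp only: power_mult_distrib scaleR_conv_of_real mult.assoc)
          qed
          finally show ?thesis by (rule sums_unique)
        qed
        finally show ?thesis .
      qed
      then show ?thesis by (simp only: integral_mult_right_zero)
    qed
    also have "\<dots> = ?lhs s"
      by (rule integral_std_normal_swap) (auto intro: sigma_finite_measure_axioms integrable_iexp)
    finally show ?thesis .
  qed
  let ?a = "\<lambda>j n. ?A * ((?y ^ j /\<^sub>R fact j) * complex_of_real (?E (real n) (real j)))"
  let ?b = "\<lambda>j. ?A * ((?y ^ j /\<^sub>R fact j) * complex_of_real (of_bool (real j = real m)))"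
  \<comment> \<open>Tannery's theorem exchanges the limit with the series: the exponential series
    dominates, and only j = m survives.\<close>
  have "(\<lambda>n. suminf (\<lambda>j. ?a j n)) \<longlonglongrightarrow> suminf ?b"
  proof (rule tannerys_theorem[THEN conjunct2, THEN conjunct2])
    show "(\<lambda>n. ?a j n) \<longlonglongrightarrow> ?b j" for j by (intro tendsto_intros E_lim)
    show "summable (\<lambda>j. norm ?A * norm (?y ^ j /\<^sub>R fact j))" by (intro summable_mult summable_norm_exp)
    have "norm (?a j n) \<le> norm ?A * norm (?y ^ j /\<^sub>R fact j)" for j n
    proof -
      have "norm (?a j n) = norm ?A * (norm (?y ^ j /\<^sub>R fact j) * ?E (real n) (real j))"
        by (simp only: norm_mult norm_of_real abs_exp_cancel)
      also have "\<dots> \<le> norm ?A * (norm (?y ^ j /\<^sub>R fact j) * 1)"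
        by (intro mult_left_mono) auto
      finally show ?thesis by simp
    qed
    then show "\<forall>\<^sub>F (j, n) in sequentially \<times>\<^sub>F sequentially. norm (?a j n) \<le> norm ?A * norm (?y ^ j /\<^sub>R fact j)"
      by (intro always_eventually) auto
  qed simp
  moreover have "suminf (\<lambda>j. ?a j n) = ?lhs (real n)" for n
    using sums[of "real n"] by (rule sums_unique[symmetric])
  moreover have "suminf ?b = ?A * (?y ^ m /\<^sub>R fact m)"
  proof -
    have "suminf ?b = (\<Sum>j\<in>{m}. ?b j)" by (rule suminf_finite) auto
    then show ?thesis by simp
  qed
  ultimately have "(\<lambda>n. ?lhs (real n)) \<longlonglongrightarrow> ?A * (?y ^ m /\<^sub>R fact m)" by simp
  from LIMSEQ_unique[OF lhs_lim this] show ?thesis .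
qed

end

text \<open>The variables in the definitions of \<open>rho\<close> and \<open>mu\<close> are
  arbitrary on a null set. They are replaced by Borel versions \<open>X\<close>, namely limits of
  grid sums; almost sure equality already makes \<open>f\<close> measurable for the
  completion.\<close>

lemma distr_completion_AE:
  assumes X: "X \<in> measurable M K" and eq: "AE \<omega> in M. f \<omega> = X \<omega>" and f: "\<And>\<omega>. f \<omega> \<in> space K"
  shows "distr (completion M) K f = distr M K X"
proof -
  have X': "X \<in> measurable (completion M) K" using X by (rule measurable_completion)
  have eq': "AE \<omega> in completion M. f \<omega> = X \<omega>" using eq by (rule AE_completion)
  have "f \<in> measurable (completion M) K"
  proof (rule measurableI)
    fix A assume A: "A \<in> sets K"
    show "f -` A \<inter> space (completion M) \<in> sets (completion M)"
    proof (rule completion.in_sets_AE)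
      show "X -` A \<inter> space (completion M) \<in> sets (completion M)" using X' A by (rule measurable_sets)
      show "AE \<omega> in completion M. \<omega> \<in> X -` A \<inter> space (completion M) \<longleftrightarrow> \<omega> \<in> f -` A \<inter> space (completion M)"
        using eq' by eventually_elim auto
    qed auto
  qed (rule f)
  then have "distr (completion M) K f = distr (completion M) K X"
    using eq' X' by (intro distr_cong_AE) auto
  then show ?thesis using X by (simp add: distr_completion)
qed

lemma tendsto_mult_exp_minus_one_complex:
  "(\<lambda>n. of_nat (Suc n) * (exp (x / of_nat (Suc n)) - 1)) \<longlonglongrightarrow> (x :: complex)"
proof -
  have "((\<lambda>y. exp (x * y)) has_field_derivative x) (at 0)"
    by (auto intro!: derivative_eq_intros)
  then have "((\<lambda>h. (exp (x * h) - 1) / h) \<longlongrightarrow> x) (at 0)"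
    by (simp add: DERIV_def)
  moreover have "(\<lambda>n. inverse (of_nat (Suc n)) :: complex) \<longlonglongrightarrow> 0"
    using tendsto_of_real[OF LIMSEQ_inverse_real_of_nat, where 'a=complex] by simp
  ultimately have "(\<lambda>n. (exp (x * inverse (of_nat (Suc n))) - 1) / inverse (of_nat (Suc n))) \<longlonglongrightarrow> x"
    unfolding tendsto_at_iff_sequentially by (auto simp: o_def simp del: of_nat_Suc dest!: spec[of _ "\<lambda>n. inverse (of_nat (Suc n))"])
  then show ?thesis by (simp add: divide_inverse mult.commute del: of_nat_Suc)
qed

context compound_poisson_pair
begin

section \<open>Almost sure regularity of the paths\<close>

lemma prob_N_eq:
  assumes t: "0 \<le> t"
  shows "prob {\<omega> \<in> space M. N t \<omega> = real m} = exp (- (t * (u + w))) * ((t * (u + w)) ^ m / fact m)"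
proof -
  note [measurable] = measurable_N[OF t]
  have "complex_of_real (prob {\<omega> \<in> space M. N t \<omega> = real m}) = (CLINT \<omega>|M. complex_of_real (indicator {\<omega> \<in> space M. N t \<omega> = real m} \<omega>))"
    by simp
  also have "\<dots> = (CLINT \<omega>|M. iexp (0 * L t \<omega>) * of_bool (N t \<omega> = real m))"
    by (intro Bochner_Integration.integral_cong refl) (simp add: indicator_def)
  also have "\<dots> = complex_of_real (exp (- (t * (u + w))) * ((t * (u + w)) ^ m / fact m))"
    unfolding cf_L_atom_N[OF t]
    by (simp add: \<theta>_def \<kappa>_def scaleR_conv_of_real field_simps flip: exp_of_real)
  finally show ?thesis by (simp only: of_real_eq_iff)
qed

lemma AE_increments:
  "AE \<omega> in M. \<forall>s\<in>\<rat>. \<forall>t\<in>\<rat>. 0 \<le> s \<longrightarrow> s \<le> t \<longrightarrow> N t \<omega> - N s \<omega> \<in> \<nat> \<and> L t \<omega> - L s \<omega> \<in> {0..}"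
proof -
  have "AE \<omega> in M. 0 \<le> s \<longrightarrow> s \<le> t \<longrightarrow> N t \<omega> - N s \<omega> \<in> \<nat> \<and> L t \<omega> - L s \<omega> \<in> {0..}" for s t
  proof (cases "0 \<le> s \<and> s \<le> t")
    case True
    then have "AE \<omega> in M. N (t - s) \<omega> \<in> \<nat> \<and> L (t - s) \<omega> \<in> {0..}"
      using AE_N_nat[of "t - s"] AE_L_nonneg[of "t - s"] by auto
    then have "AE \<omega> in M. case (N (t - s) \<omega>, L (t - s) \<omega>) of (x, y) \<Rightarrow> x \<in> \<nat> \<and> y \<in> {0..}" by simp
    moreover have "Measurable.pred borel (\<lambda>(x, y). x \<in> (\<nat> :: real set) \<and> y \<in> {0 :: real..})"
    proof -
      have "closed {p. fst p \<in> (\<nat> :: real set) \<and> snd p \<in> {0 :: real..}}"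
      proof -
        have "{p. fst p \<in> (\<nat> :: real set) \<and> snd p \<in> {0 :: real..}} = \<nat> \<times> {0..}" by auto
        then show ?thesis by (simp add: closed_Times)
      qed
      then show ?thesis by (simp add: pred_def case_prod_beta borel_closed)
    qed
    ultimately show ?thesis
      using True AE_increment[of s t "\<lambda>(x, y). x \<in> \<nat> \<and> y \<in> {0..}"] by auto
  qed auto
  then show ?thesis by (simp add: AE_ball_countable countable_rat)
qed

text \<open>Staying below B at all integer times is at most as likely as N n < B for each single n,
  and that is a finite sum of Poisson probabilities tending to 0 because u + w > 0.\<close>

lemma AE_unbounded: "AE \<omega> in M. \<forall>B::nat. \<exists>n::nat. real B \<le> N (real n) \<omega>"
  unfolding AE_all_countable
proof
  fix B :: nat
  have [measurable]: "N (real n) \<in> borel_measurable M" for n by (rule measurable_N) simp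
  let ?A = "{\<omega> \<in> space M. \<forall>n::nat. N (real n) \<omega> < real B}"
  have le: "prob ?A \<le> (\<Sum>j<B. exp (- (real n * (u + w))) * ((real n * (u + w)) ^ j / fact j))" for n
  proof -
    have "prob ?A \<le> prob (\<Union>j<B. {\<omega> \<in> space M. N (real n) \<omega> = real j})"
    proof (rule finite_measure_mono_AE)
      show "AE \<omega> in M. \<omega> \<in> ?A \<longrightarrow> \<omega> \<in> (\<Union>j<B. {\<omega> \<in> space M. N (real n) \<omega> = real j})"
        using AE_N_nat[of "real n", OF of_nat_0_le_iff]
      proof eventually_elim
        case (elim \<omega>)
        then obtain j :: nat where "N (real n) \<omega> = real j" by (auto elim: Nats_cases)
        then show ?case by (auto dest: spec[of _ n])
      qed
    qed simp
    also have "\<dots> \<le> (\<Sum>j<B. prob {\<omega> \<in> space M. N (real n) \<omega> = real j})"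
      by (rule finite_measure_subadditive_finite) auto
    finally show ?thesis by (simp add: prob_N_eq)
  qed
  have "(\<lambda>n. \<Sum>j<B. exp (- (real n * (u + w))) * ((real n * (u + w)) ^ j / fact j)) \<longlonglongrightarrow> (\<Sum>j<B. 0)"
  proof (rule tendsto_sum)
    fix j
    have "filterlim (\<lambda>n. real n * (u + w)) at_top sequentially"
      using filterlim_tendsto_pos_mult_at_top[OF tendsto_const uw filterlim_real_sequentially] by (simp add: mult.commute)
    from tendsto_divide[OF filterlim_compose[OF tendsto_power_div_exp_0 this] tendsto_const[of "fact j"]]
    have "(\<lambda>n. (real n * (u + w)) ^ j / exp (real n * (u + w)) / fact j) \<longlonglongrightarrow> 0" by simp
    then show "(\<lambda>n. exp (- (real n * (u + w))) * ((real n * (u + w)) ^ j / fact j)) \<longlonglongrightarrow> 0"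
      by (simp add: exp_minus divide_inverse mult_ac)
  qed
  then have "prob ?A \<le> 0"
    using le by (intro LIMSEQ_le_const[where a="prob ?A"]) auto
  then have "prob ?A = 0" using measure_nonneg[of M ?A] by linarith
  then have "AE \<omega> in M. \<not> (\<forall>n::nat. N (real n) \<omega> < real B)"
    by (subst (asm) prob_eq_0) auto
  then show "AE \<omega> in M. \<exists>n::nat. real B \<le> N (real n) \<omega>"
    by (simp add: not_less)
qed

lemma AE_path: "AE \<omega> in M. counting_path (\<lambda>t. N t \<omega>) (\<lambda>t. L t \<omega>) \<and> L 0 \<omega> = 0"
proof -
  have "AE \<omega> in M. cadlag (\<lambda>t. (N t \<omega>, L t \<omega>))" "AE \<omega> in M. (N 0 \<omega>, L 0 \<omega>) = 0"
    using levy by (simp_all add: levy_process_def)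
  then show ?thesis using AE_increments AE_unbounded
  proof eventually_elim
    case (elim \<omega>)
    have N_right: "((\<lambda>t. N t \<omega>) \<longlongrightarrow> N t \<omega>) (at_right t)" if "t \<ge> 0" for t
      using tendsto_fst[of "\<lambda>t. (N t \<omega>, L t \<omega>)" "(N t \<omega>, L t \<omega>)"] that elim(1) by (simp add: cadlag_def)
    have L_right: "((\<lambda>t. L t \<omega>) \<longlongrightarrow> L t \<omega>) (at_right t)" if "t \<ge> 0" for t
      using tendsto_snd[of "\<lambda>t. (N t \<omega>, L t \<omega>)" "(N t \<omega>, L t \<omega>)"] that elim(1) by (simp add: cadlag_def)
    have "counting_path (\<lambda>t. N t \<omega>) (\<lambda>t. L t \<omega>)"
    proof
      show "\<exists>l. ((\<lambda>t. N t \<omega>) \<longlongrightarrow> l) (at_left t)" if "t > 0" for t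
      proof -
        obtain l where "((\<lambda>t. (N t \<omega>, L t \<omega>)) \<longlongrightarrow> l) (at_left t)"
          using elim(1) \<open>t > 0\<close> unfolding cadlag_def by blast
        from tendsto_fst[OF this] show ?thesis by auto
      qed
      show "N 0 \<omega> = 0" using elim(2) by (simp add: zero_prod_def)
      show "N t \<omega> - N s \<omega> \<in> \<nat>" if "0 \<le> s" "s \<le> t" for s t
        by (rule increments_closed_from_rationals[OF N_right]) (use elim(3) that in auto)
      show "L s \<omega> \<le> L t \<omega>" if "0 \<le> s" "s \<le> t" for s t
        using increments_closed_from_rationals[OF L_right, of "{0..}" s t] elim(3) that by auto
      show "\<exists>n::nat. B \<le> N (real n) \<omega>" for B
      proof -
        obtain n :: nat where "real (nat \<lceil>B\<rceil>) \<le> N (real n) \<omega>" using elim(4) by blast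
        then show ?thesis by (intro exI[of _ n]) linarith
      qed
    qed (use N_right L_right in auto)
    then show ?case using elim(2) by (simp add: zero_prod_def)
  qed
qed

section \<open>The law at the first jump, from independent grid increments\<close>

definition increment :: "nat \<Rightarrow> nat \<Rightarrow> 'a \<Rightarrow> real \<times> real" where
  "increment m i \<omega> = (N (real (Suc i) / real m) \<omega> - N (real i / real m) \<omega>,
      L (real (Suc i) / real m) \<omega> - L (real i / real m) \<omega>)"

lemma indep_increments:
  assumes m: "m > 0" shows "indep_vars (\<lambda>_. borel) (increment m) {..<n}"
proof -
  let ?t = "\<lambda>i. real i / real m"
  have t: "0 \<le> ?t 0 \<and> (\<forall>i<n. ?t i < ?t (Suc i))"
    using m by (auto intro!: divide_strict_right_mono)
  have "\<forall>(n::nat) (ts::nat \<Rightarrow> real). 0 \<le> ts 0 \<and> (\<forall>i<n. ts i < ts (Suc i)) \<longrightarrow>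
        indep_vars (\<lambda>_. borel) (\<lambda>i \<omega>. (N (ts (Suc i)) \<omega>, L (ts (Suc i)) \<omega>) - (N (ts i) \<omega>, L (ts i) \<omega>)) {..<n}"
    using levy unfolding levy_process_def by (elim conjE)
  from this[THEN spec, THEN spec, THEN mp, OF t] show ?thesis
    unfolding increment_def[abs_def] diff_Pair .
qed

lemma integral_increment_grid:
  fixes f :: "real \<times> real \<Rightarrow> complex"
  assumes f: "f \<in> borel_measurable borel"
  shows "(CLINT \<omega>|M. f (increment m i \<omega>)) = (CLINT \<omega>|M. f (N (1 / real m) \<omega>, L (1 / real m) \<omega>))"
  using integral_increment[of "real i / real m" "1 / real m" f] f
  by (simp add: increment_def add_divide_distrib add.commute)

lemma measurable_increment: "increment m i \<in> borel_measurable M"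
proof -
  have "(\<lambda>\<omega>. (N (real (Suc i) / real m) \<omega>, L (real (Suc i) / real m) \<omega>) -
      (N (real i / real m) \<omega>, L (real i / real m) \<omega>)) \<in> borel_measurable M"
    by (intro borel_measurable_diff measurable_NL) auto
  then show ?thesis by (simp add: increment_def[abs_def])
qed

lemma integral_prod_increments:
  fixes f :: "nat \<Rightarrow> real \<times> real \<Rightarrow> complex"
  assumes m: "m > 0" and f: "\<And>i. f i \<in> borel_measurable borel" and b: "\<And>i x. norm (f i x) \<le> 1"
  shows "(CLINT \<omega>|M. \<Prod>i<n. f i (increment m i \<omega>))
    = (\<Prod>i<n. CLINT \<omega>|M. f i (N (1 / real m) \<omega>, L (1 / real m) \<omega>))"
proof -
  have "(CLINT \<omega>|M. \<Prod>i<n. f i (increment m i \<omega>)) = (\<Prod>i<n. CLINT \<omega>|M. f i (increment m i \<omega>))"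
  proof (rule indep_vars_lebesgue_integral)
    show "indep_vars (\<lambda>_. borel) (\<lambda>i \<omega>. f i (increment m i \<omega>)) {..<n}"
      using indep_vars_compose2[OF indep_increments[OF m], of n f "\<lambda>_. borel"] f by simp
    show "integrable M (\<lambda>\<omega>. f i (increment m i \<omega>))" for i
      using b by (intro integrable_const_bound[where B=1] AE_I2 measurable_compose[OF measurable_increment f])
  qed simp
  then show ?thesis by (simp add: integral_increment_grid f)
qed

text \<open>The first jump of \<open>N\<close> falls into the \<open>j\<close>-th cell of the grid iff the first \<open>j\<close> increments
  of \<open>N\<close> vanish and the next one does not.\<close>

lemma integral_first_jump_term:
  fixes z :: real
  defines "A \<equiv> \<lambda>n. exp (- (complex_of_real (1 / real (Suc n)) * \<theta> z))"
    and "B \<equiv> \<lambda>n. exp (complex_of_real (1 / real (Suc n)) * (\<kappa> z - \<theta> z)) - exp (- (complex_of_real (1 / real (Suc n)) * \<theta> z))"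
  shows "(CLINT \<omega>|M. of_bool (N (real j / real (Suc n)) \<omega> = 0 \<and> N (real (Suc j) / real (Suc n)) \<omega> \<noteq> 0)
      * iexp (z * L (real (Suc j) / real (Suc n)) \<omega>)) = A n ^ j * B n"
proof -
  define m where "m = Suc n"
  have m: "m > 0" by (simp add: m_def)
  let ?h = "1 / real m"
  \<comment> \<open>One factor per increment: no jump of N before index j, a jump of N at j. Each
    factor carries the exponential of its own increment of L, and these multiply to the exponential
    of L at the right end of the cell.\<close>
  define f :: "nat \<Rightarrow> real \<times> real \<Rightarrow> complex"
    where "f i p = (if i < j then of_bool (fst p = 0) else of_bool (fst p \<noteq> 0)) * iexp (z * snd p)" for i p
  have fst_snd[measurable]: "fst \<in> borel_measurable (borel :: (real \<times> real) measure)"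
    "snd \<in> borel_measurable (borel :: (real \<times> real) measure)"
    by (intro borel_measurable_continuous_onI continuous_intros)+
  have f_meas: "f i \<in> borel_measurable borel" for i unfolding f_def by measurable
  have f_bound: "norm (f i x) \<le> 1" for i x by (simp add: f_def norm_mult)
  have "AE \<omega> in M. of_bool (N (real j / real m) \<omega> = 0 \<and> N (real (Suc j) / real m) \<omega> \<noteq> 0)
      * iexp (z * L (real (Suc j) / real m) \<omega>) = (\<Prod>i<Suc j. f i (increment m i \<omega>))"
    using AE_path
  proof eventually_elim
    case (elim \<omega>)
    interpret counting_path "\<lambda>t. N t \<omega>" "\<lambda>t. L t \<omega>" using elim by simp
    have tel: "(\<Sum>i<i'. fst (increment m i \<omega>)) = N (real i' / real m) \<omega>"
      "(\<Sum>i<i'. snd (increment m i \<omega>)) = L (real i' / real m) \<omega>" for i'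
      using sum_lessThan_telescope[of "\<lambda>i. N (real i / real m) \<omega>" i'] sum_lessThan_telescope[of "\<lambda>i. L (real i / real m) \<omega>" i'] N_zero elim
      by (simp_all add: increment_def)
    have pos: "0 \<le> fst (increment m i \<omega>)" for i
      using N_mono[of "real i / real m" "real (Suc i) / real m"] by (simp add: increment_def divide_right_mono)
    have zero: "N (real j / real m) \<omega> = 0 \<longleftrightarrow> (\<forall>i<j. fst (increment m i \<omega>) = 0)"
      unfolding tel(1)[of j, symmetric] using pos by (subst sum_nonneg_eq_0_iff) auto
    have "(\<Prod>i<j. f i (increment m i \<omega>)) = (\<Prod>i<j. of_bool (fst (increment m i \<omega>) = 0) * iexp (z * snd (increment m i \<omega>)))"
      by (intro prod.cong refl) (simp add: f_def)
    also have "\<dots> = of_bool (\<forall>i<j. fst (increment m i \<omega>) = 0) * (\<Prod>i<j. iexp (z * snd (increment m i \<omega>)))"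
      unfolding prod.distrib by (auto simp: of_bool_def)
    finally have p: "(\<Prod>i<Suc j. f i (increment m i \<omega>)) = of_bool (N (real j / real m) \<omega> = 0 \<and> fst (increment m j \<omega>) \<noteq> 0)
        * (\<Prod>i<Suc j. iexp (z * snd (increment m i \<omega>)))"
      unfolding zero by (simp add: f_def)
    have "(\<Prod>i<Suc j. iexp (z * snd (increment m i \<omega>))) = exp (\<Sum>i<Suc j. \<i> * complex_of_real (z * snd (increment m i \<omega>)))"
      by (rule exp_sum[symmetric]) simp
    also have "\<dots> = iexp (z * (\<Sum>i<Suc j. snd (increment m i \<omega>)))"
      by (simp only: sum_distrib_left of_real_sum)
    also have "(\<Sum>i<Suc j. snd (increment m i \<omega>)) = L (real (Suc j) / real m) \<omega>"
      by (rule tel(2))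
    finally have e: "(\<Prod>i<Suc j. iexp (z * snd (increment m i \<omega>))) = iexp (z * L (real (Suc j) / real m) \<omega>)" .
    have "N (real j / real m) \<omega> = 0 \<and> fst (increment m j \<omega>) \<noteq> 0 \<longleftrightarrow> N (real j / real m) \<omega> = 0 \<and> N (real (Suc j) / real m) \<omega> \<noteq> 0"
      by (auto simp: increment_def)
    then show ?case by (simp only: p e)
  qed
  then have "(CLINT \<omega>|M. of_bool (N (real j / real m) \<omega> = 0 \<and> N (real (Suc j) / real m) \<omega> \<noteq> 0)
      * iexp (z * L (real (Suc j) / real m) \<omega>)) = (CLINT \<omega>|M. \<Prod>i<Suc j. f i (increment m i \<omega>))"
  proof (intro integral_cong_AE)
    have [measurable]: "N (real i / real m) \<in> borel_measurable M" "L (real i / real m) \<in> borel_measurable M" for i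
      by (intro measurable_N measurable_L, simp)+
    show "(\<lambda>\<omega>. of_bool (N (real j / real m) \<omega> = 0 \<and> N (real (Suc j) / real m) \<omega> \<noteq> 0)
      * iexp (z * L (real (Suc j) / real m) \<omega>)) \<in> borel_measurable M"
      by (simp del: of_nat_Suc)
    show "(\<lambda>\<omega>. \<Prod>i<Suc j. f i (increment m i \<omega>)) \<in> borel_measurable M"
      by (intro borel_measurable_prod measurable_compose[OF measurable_increment f_meas])
  qed
  also have "\<dots> = (\<Prod>i<Suc j. CLINT \<omega>|M. f i (N ?h \<omega>, L ?h \<omega>))"
    by (rule integral_prod_increments[OF m f_meas f_bound])
  also have "\<dots> = (\<Prod>i<j. A n) * B n"
  proof -
    have h: "0 \<le> ?h" by simp
    note [measurable] = measurable_N[OF h] measurable_L[OF h]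
    have a: "(CLINT \<omega>|M. iexp (z * L ?h \<omega>) * of_bool (N ?h \<omega> = 0)) = A n"
      using cf_L_atom_N[OF h, of z 0] by (simp add: A_def m_def)
    have "(CLINT \<omega>|M. f i (N ?h \<omega>, L ?h \<omega>)) = A n" if "i < j" for i
      using that a by (simp add: f_def mult.commute)
    moreover have "(CLINT \<omega>|M. f j (N ?h \<omega>, L ?h \<omega>)) = B n"
    proof -
      have "(CLINT \<omega>|M. f j (N ?h \<omega>, L ?h \<omega>)) = (CLINT \<omega>|M. iexp (z * L ?h \<omega>) - iexp (z * L ?h \<omega>) * of_bool (N ?h \<omega> = 0))"
        by (intro Bochner_Integration.integral_cong refl) (simp add: f_def)
      also have "\<dots> = (CLINT \<omega>|M. iexp (z * L ?h \<omega>)) - A n"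
        unfolding a[symmetric]
        by (intro Bochner_Integration.integral_diff integrable_const_bound[where B=1]) (auto simp: norm_mult)
      also have "(CLINT \<omega>|M. iexp (z * L ?h \<omega>)) = exp (complex_of_real ?h * (\<kappa> z - \<theta> z))"
        using cf_NL[OF h, of 0 z] by simp
      finally show ?thesis by (simp only: A_def B_def m_def)
    qed
    ultimately show ?thesis by simp
  qed
  finally show ?thesis by (simp only: prod_constant card_lessThan m_def)
qed

lemma Re_\<theta>_pos: "Re (\<theta> z) > 0"
proof -
  have "v * cos z \<le> v" using v mult_left_mono[OF cos_le_one v] by simp
  then show ?thesis using uw by (simp add: \<theta>_def Re_exp)
qed

lemma \<theta>_nonzero: "\<theta> z \<noteq> 0" using Re_\<theta>_pos[of z] by auto


text \<open>Summing the contributions of the cells gives a geometric series with ratio A and factor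
  B. With m = n + 1, m (1 - A) tends to \<theta> and m B to \<kappa>, so the part with T \<le> t has
  transform \<kappa> (1 - exp (-t \<theta>)) / \<theta>; letting t grow then uses Re \<theta> >
  0.\<close>

lemma rho_law:
  shows "real_distribution (rho M N L)" "char (rho M N L) z = \<kappa> z / \<theta> z"
proof -
  let ?T = "\<lambda>\<omega>. first_jump_time (\<lambda>t. N t \<omega>)"
  let ?f = "\<lambda>\<omega>. first_jump_sum (\<lambda>t. N t \<omega>) (\<lambda>t. L t \<omega>)"
  have NL[measurable]: "N (real i / real m) \<in> borel_measurable M" "L (real i / real m) \<in> borel_measurable M" for i m :: nat
    by (intro measurable_N measurable_L, simp)+
  \<comment> \<open>A Borel version of L at the first jump: the inner limit refines the grid up to
    time t, the outer one removes the cutoff t.\<close>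
  define X where "X \<omega> = lim (\<lambda>t. lim (\<lambda>n. ?f \<omega> (\<lambda>x. x) t n))" for \<omega>
  have X_meas[measurable]: "X \<in> borel_measurable M"
  proof -
    have "(\<lambda>\<omega>. ?f \<omega> (\<lambda>x. x) t n) \<in> borel_measurable M" for t n
      unfolding first_jump_sum_def
      by (intro borel_measurable_sum borel_measurable_times) (simp_all del: of_nat_Suc)
    then show ?thesis unfolding X_def by (intro borel_measurable_lim_metric)
  qed
  have lim_t: "(\<lambda>t::nat. if ?T \<omega> \<le> real t then y else 0) \<longlonglongrightarrow> y" for \<omega> and y :: "'b :: real_normed_vector"
  proof (rule tendsto_eventually)
    show "\<forall>\<^sub>F t in sequentially. (if ?T \<omega> \<le> real t then y else 0) = y"
      using eventually_ge_at_top[of "nat \<lceil>?T \<omega>\<rceil>"]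
    proof eventually_elim
      case (elim t)
      then have "?T \<omega> \<le> real t" by linarith
      then show ?case by simp
    qed
  qed
  have X_eq: "AE \<omega> in M. L (?T \<omega>) \<omega> = X \<omega>"
    using AE_path
  proof eventually_elim
    case (elim \<omega>)
    interpret counting_path "\<lambda>t. N t \<omega>" "\<lambda>t. L t \<omega>" using elim by simp
    have "lim (\<lambda>n. ?f \<omega> (\<lambda>x. x) t n) = (if ?T \<omega> \<le> real t then L (?T \<omega>) \<omega> else 0)" for t
      by (intro limI first_jump_sum_tendsto) simp
    then show ?case unfolding X_def using lim_t[of \<omega> "L (?T \<omega>) \<omega>"] by (simp add: limI)
  qed
  have rho_eq: "rho M N L = distr M borel X"
    unfolding rho_def by (rule distr_completion_AE[OF X_meas X_eq]) simp
  show "real_distribution (rho M N L)" unfolding rho_eq by (rule real_distribution_distr) simp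
  define G where "G x = iexp (z * x)" for x
  define Y where "Y t \<omega> = lim (\<lambda>n. ?f \<omega> G t n)" for t \<omega>
  have f_meas[measurable]: "(\<lambda>\<omega>. ?f \<omega> G t n) \<in> borel_measurable M" for t n
    unfolding first_jump_sum_def G_def
    by (intro borel_measurable_sum borel_measurable_times) (simp_all del: of_nat_Suc)
  have Y_meas[measurable]: "Y t \<in> borel_measurable M" for t unfolding Y_def by measurable
  have AE_Y: "AE \<omega> in M. (\<forall>t. (\<lambda>n. ?f \<omega> G t n) \<longlonglongrightarrow> Y t \<omega>) \<and> (\<forall>t n. norm (?f \<omega> G t n) \<le> 1)
      \<and> (\<lambda>t. Y t \<omega>) \<longlonglongrightarrow> iexp (z * X \<omega>) \<and> (\<forall>t. norm (Y t \<omega>) \<le> 1)"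
    using AE_path X_eq
  proof eventually_elim
    case (elim \<omega>)
    interpret counting_path "\<lambda>t. N t \<omega>" "\<lambda>t. L t \<omega>" using elim by simp
    have l: "(\<lambda>n. ?f \<omega> G t n) \<longlonglongrightarrow> (if ?T \<omega> \<le> real t then G (L (?T \<omega>) \<omega>) else 0)" for t
      unfolding G_def[abs_def] by (intro first_jump_sum_tendsto continuous_intros)
    then have Y: "Y t \<omega> = (if ?T \<omega> \<le> real t then G (L (?T \<omega>) \<omega>) else 0)" for t
      unfolding Y_def by (rule limI)
    have "norm (?f \<omega> G t n) \<le> 1" for t n
    proof -
      obtain \<tau> where "?f \<omega> G t n = (if ?T \<omega> \<le> real t then G (L \<tau> \<omega>) else 0)"
        by (rule first_jump_sum_cases[of G t n])
      then show ?thesis by (simp add: G_def)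
    qed
    moreover have "(\<lambda>t. Y t \<omega>) \<longlonglongrightarrow> G (L (?T \<omega>) \<omega>)" unfolding Y by (rule lim_t)
    ultimately show ?case using l elim(2) by (simp add: Y) (simp add: G_def)
  qed
  define I where "I t = (CLINT \<omega>|M. Y t \<omega>)" for t
  let ?m = "\<lambda>n. of_nat (Suc n) :: complex"
  define A where "A n = exp (- (complex_of_real (1 / real (Suc n)) * \<theta> z))" for n
  define B where "B n = exp (complex_of_real (1 / real (Suc n)) * (\<kappa> z - \<theta> z)) - exp (- (complex_of_real (1 / real (Suc n)) * \<theta> z))" for n
  have lims: "(\<lambda>n. ?m n * (1 - A n)) \<longlonglongrightarrow> \<theta> z" "(\<lambda>n. ?m n * B n) \<longlonglongrightarrow> \<kappa> z"
  proof -
    have e: "(\<lambda>n. ?m n * (exp (- (complex_of_real (1 / real (Suc n)) * \<theta> z)) - 1)) \<longlonglongrightarrow> - \<theta> z"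
      using tendsto_mult_exp_minus_one_complex[of "- \<theta> z"] by (simp del: of_nat_Suc)
    have e': "(\<lambda>n. ?m n * (exp (complex_of_real (1 / real (Suc n)) * (\<kappa> z - \<theta> z)) - 1)) \<longlonglongrightarrow> \<kappa> z - \<theta> z"
      using tendsto_mult_exp_minus_one_complex[of "\<kappa> z - \<theta> z"] by (simp del: of_nat_Suc)
    show "(\<lambda>n. ?m n * (1 - A n)) \<longlonglongrightarrow> \<theta> z"
      using tendsto_minus[OF e] unfolding A_def by (simp only: minus_mult_right minus_diff_eq minus_minus)
    show "(\<lambda>n. ?m n * B n) \<longlonglongrightarrow> \<kappa> z"
      using tendsto_diff[OF e' e] unfolding B_def by (simp add: algebra_simps del: of_nat_Suc)
  qed
  have I_eq: "I t * \<theta> z = \<kappa> z * (1 - exp (- (of_nat t * \<theta> z)))" for t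
  proof -
    let ?S = "\<lambda>n. CLINT \<omega>|M. ?f \<omega> G t n"
    have S: "?S n = (\<Sum>j<t * Suc n. A n ^ j * B n)" for n
    proof -
      let ?q = "\<lambda>j \<omega>. of_bool (N (real j / real (Suc n)) \<omega> = 0 \<and> N (real (Suc j) / real (Suc n)) \<omega> \<noteq> 0)
          * iexp (z * L (real (Suc j) / real (Suc n)) \<omega>)"
      have "integrable M (?q j)" for j
        by (rule integrable_const_bound[where B=1]) (auto simp: norm_mult simp del: of_nat_Suc)
      then have "?S n = (\<Sum>j<t * Suc n. CLINT \<omega>|M. ?q j \<omega>)"
        unfolding first_jump_sum_def G_def by (rule Bochner_Integration.integral_sum)
      then show ?thesis unfolding integral_first_jump_term A_def B_def .
    qed
    have "(\<lambda>n. ?S n) \<longlonglongrightarrow> I t"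
      unfolding I_def
    proof (rule integral_dominated_convergence[where w="\<lambda>_. 1"])
      show "AE \<omega> in M. (\<lambda>n. ?f \<omega> G t n) \<longlonglongrightarrow> Y t \<omega>" using AE_Y by eventually_elim auto
      show "AE \<omega> in M. norm (?f \<omega> G t n) \<le> 1" for n using AE_Y by eventually_elim auto
    qed auto
    then have "(\<lambda>n. ?S n * (?m n * (1 - A n))) \<longlonglongrightarrow> I t * \<theta> z"
      by (intro tendsto_mult lims)
    \<comment> \<open>Multiplying by 1 - A sums the geometric series exactly, and A to the power t
      (n + 1) does not depend on the mesh.\<close>
    moreover have "?S n * (?m n * (1 - A n)) = (?m n * B n) * (1 - exp (- (of_nat t * \<theta> z)))" for n
    proof -
      have "A n ^ (t * Suc n) = exp (of_nat (t * Suc n) * - (complex_of_real (1 / real (Suc n)) * \<theta> z))"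
        unfolding A_def by (rule exp_of_nat_mult[symmetric])
      also have "of_nat (t * Suc n) * - (complex_of_real (1 / real (Suc n)) * \<theta> z) = - (of_nat t * \<theta> z)"
        by (simp only: of_nat_mult of_real_divide of_real_1 of_real_of_nat_eq) (simp del: of_nat_Suc)
      finally have p: "A n ^ (t * Suc n) = exp (- (of_nat t * \<theta> z))" .
      have "?S n * (?m n * (1 - A n)) = ?m n * B n * ((1 - A n) * (\<Sum>j<t * Suc n. A n ^ j))"
        unfolding S sum_distrib_right[symmetric] by (simp only: mult_ac)
      also have "\<dots> = ?m n * B n * (1 - A n ^ (t * Suc n))" by (simp only: one_diff_power_eq)
      finally show ?thesis unfolding p .
    qed
    moreover have "(\<lambda>n. (?m n * B n) * (1 - exp (- (of_nat t * \<theta> z)))) \<longlonglongrightarrow> \<kappa> z * (1 - exp (- (of_nat t * \<theta> z)))"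
      by (intro tendsto_mult lims tendsto_const)
    ultimately show ?thesis by (simp only: LIMSEQ_unique)
  qed
  have "(\<lambda>t. I t * \<theta> z) \<longlonglongrightarrow> char (rho M N L) z * \<theta> z"
  proof (intro tendsto_mult tendsto_const)
    have "char (rho M N L) z = (CLINT \<omega>|M. iexp (z * X \<omega>))"
      unfolding rho_eq char_def by (rule integral_distr) auto
    moreover have "I \<longlonglongrightarrow> (CLINT \<omega>|M. iexp (z * X \<omega>))"
      unfolding I_def
    proof (rule integral_dominated_convergence[where w="\<lambda>_. 1"])
      show "AE \<omega> in M. (\<lambda>t. Y t \<omega>) \<longlonglongrightarrow> iexp (z * X \<omega>)" using AE_Y by eventually_elim auto
      show "AE \<omega> in M. norm (Y t \<omega>) \<le> 1" for t using AE_Y by eventually_elim auto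
    qed auto
    ultimately show "I \<longlonglongrightarrow> char (rho M N L) z" by simp
  qed
  moreover have "(\<lambda>t. I t * \<theta> z) \<longlonglongrightarrow> \<kappa> z * (1 - 0)"
    unfolding I_eq
  proof (intro tendsto_intros)
    have "filterlim (\<lambda>t. Re (\<theta> z) * real t) at_top sequentially"
      using filterlim_tendsto_pos_mult_at_top[OF tendsto_const Re_\<theta>_pos filterlim_real_sequentially] .
    then have "filterlim (\<lambda>t. - (Re (\<theta> z) * real t)) at_bot sequentially"
      by (simp add: filterlim_uminus_at_bot)
    from filterlim_compose[OF exp_at_bot this]
    have "(\<lambda>t. norm (exp (- (of_nat t * \<theta> z)))) \<longlonglongrightarrow> 0" by (simp add: mult.commute)
    then show "(\<lambda>t. exp (- (of_nat t * \<theta> z))) \<longlonglongrightarrow> 0" by (rule tendsto_norm_zero_cancel)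
  qed
  ultimately have "char (rho M N L) z * \<theta> z = \<kappa> z * (1 - 0)" by (rule LIMSEQ_unique)
  then show "char (rho M N L) z = \<kappa> z / \<theta> z" using \<theta>_nonzero[of z] by (simp add: field_simps)
qed

end

section \<open>The law of the exponential integral\<close>

lemma (in prob_space) integral_indep_var:
  fixes g :: "_ \<Rightarrow> complex"
  assumes ind: "indep_var S X T Y" and g[measurable]: "g \<in> borel_measurable (S \<Otimes>\<^sub>M T)" and b: "\<And>x. norm (g x) \<le> 1"
  shows "(CLINT \<omega>|M. g (X \<omega>, Y \<omega>)) = (CLINT \<omega>|M. CLINT \<omega>'|M. g (X \<omega>, Y \<omega>'))"
proof -
  from ind have X[measurable]: "X \<in> measurable M S" and Y[measurable]: "Y \<in> measurable M T"
    and eq: "distr M S X \<Otimes>\<^sub>M distr M T Y = distr M (S \<Otimes>\<^sub>M T) (\<lambda>x. (X x, Y x))"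
    unfolding indep_var_distribution_eq by auto
  interpret X: prob_space "distr M S X" by (rule prob_space_distr) simp
  interpret Y: prob_space "distr M T Y" by (rule prob_space_distr) simp
  interpret P: pair_prob_space "distr M S X" "distr M T Y" ..
  have "(CLINT \<omega>|M. g (X \<omega>, Y \<omega>)) = (CLINT p|distr M S X \<Otimes>\<^sub>M distr M T Y. g p)"
    unfolding eq by (subst integral_distr) auto
  also have "\<dots> = (CLINT x|distr M S X. CLINT y|distr M T Y. g (x, y))"
    by (rule P.integral_fst'[symmetric]) (auto intro!: P.integrable_const_bound[where B=1] b)
  also have "\<dots> = (CLINT x|distr M S X. CLINT \<omega>'|M. g (x, Y \<omega>'))"
    by (intro Bochner_Integration.integral_cong refl) (subst integral_distr, auto)
  also have "\<dots> = (CLINT \<omega>|M. CLINT \<omega>'|M. g (X \<omega>, Y \<omega>'))"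
    by (subst integral_distr) (auto intro!: borel_measurable_lebesgue_integral)
  finally show ?thesis .
qed

text \<open>The first-order terms of exp (-x) (1 + x) cancel; with x = h \<theta> this makes a step
  of length h wrong only by O(h^2).\<close>

lemma norm_exp_minus_mult_le: "norm (exp (- x) * (1 + x) - 1) \<le> (norm x)^2" if "0 \<le> Re x" for x :: complex
proof -
  have "exp (- x) * (1 + x) - 1 = exp (- x) * - (exp x - (1 + x))"
    by (simp add: algebra_simps flip: exp_add)
  then have "norm (exp (- x) * (1 + x) - 1) = exp (- Re x) * norm (exp x - (1 + x))"
    by (simp add: norm_mult norm_minus_commute)
  also have "norm (exp x - (1 + x)) \<le> exp (Re x) * (norm x)^2"
    using Taylor_exp[of x 1] that by (simp add: numeral_2_eq_2)
  finally show ?thesis by (simp add: mult.assoc[symmetric] flip: exp_add)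
qed

context compound_poisson_pair
begin

section \<open>The infinite product\<close>

definition \<phi> :: "real \<Rightarrow> complex" where "\<phi> z = (\<Prod>n. \<kappa> (z / c ^ n) / \<theta> (z / c ^ n))"

text \<open>The quotient is the characteristic function of \<open>rho\<close>, which gives the bound
  at once.\<close>

lemma norm_\<kappa>_div_\<theta>_le: "norm (\<kappa> z / \<theta> z) \<le> 1"
  using real_distribution.cmod_char_le_1[OF rho_law(1), of z] by (simp add: rho_law(2))

lemma norm_\<theta>_ge: "u + w \<le> norm (\<theta> z)"
proof -
  have "v * cos z \<le> v" using v mult_left_mono[OF cos_le_one v] by simp
  then have "u + w \<le> Re (\<theta> z)" by (simp add: \<theta>_def Re_exp)
  then show ?thesis using complex_Re_le_cmod[of "\<theta> z"] by linarith
qed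

lemma norm_\<theta>_le: "norm (\<theta> z) \<le> u + 2 * v + w"
proof -
  have "norm (\<theta> z) \<le> norm (complex_of_real (u + v + w)) + norm (complex_of_real v * iexp z)"
    unfolding \<theta>_def by (rule norm_triangle_ineq4)
  also have "norm (complex_of_real v * iexp z) = v" using v by (simp add: norm_mult)
  also have "norm (complex_of_real (u + v + w)) = u + v + w" using u v w by (simp only: norm_of_real)
  finally show ?thesis by simp
qed

text \<open>Along the points z / c^i this linear bound makes the deviations of the factors from 1
  geometric, so that the product converges and tends to 1 as z tends to 0.\<close>

lemma norm_\<kappa>_div_\<theta>_minus_one_le: "norm (\<kappa> z / \<theta> z - 1) \<le> (v + w * d) / (u + w) * \<bar>z\<bar>"
proof -
  have e: "norm (iexp x - 1) \<le> \<bar>x\<bar>" for x using iexp_approx1[of x 0] by simp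
  have "\<kappa> z - \<theta> z = complex_of_real v * (iexp z - 1) + complex_of_real w * (iexp (z * d) - 1)"
    by (simp add: \<kappa>_def \<theta>_def algebra_simps)
  then have "norm (\<kappa> z - \<theta> z) \<le> v * norm (iexp z - 1) + w * norm (iexp (z * d) - 1)"
    using v w norm_triangle_ineq[of "complex_of_real v * (iexp z - 1)" "complex_of_real w * (iexp (z * d) - 1)"]
    by (simp add: norm_mult)
  also have "\<dots> \<le> v * \<bar>z\<bar> + w * \<bar>z * d\<bar>"
    using v w by (intro add_mono mult_left_mono e) auto
  also have "\<dots> = (v + w * d) * \<bar>z\<bar>" using d_pos by (simp add: abs_mult algebra_simps)
  finally have le: "norm (\<kappa> z - \<theta> z) \<le> (v + w * d) * \<bar>z\<bar>" .
  have "\<kappa> z / \<theta> z - 1 = (\<kappa> z - \<theta> z) / \<theta> z" using \<theta>_nonzero[of z] by (simp add: field_simps)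
  then have "norm (\<kappa> z / \<theta> z - 1) = norm (\<kappa> z - \<theta> z) / norm (\<theta> z)" by (simp add: norm_divide)
  also have "\<dots> \<le> ((v + w * d) * \<bar>z\<bar>) / (u + w)"
    using le norm_\<theta>_ge[of z] uw by (intro frac_le) (auto intro: order_trans[OF norm_ge_zero])
  finally show ?thesis by simp
qed

lemma \<phi>_LIMSEQ: "(\<lambda>n. \<Prod>i\<le>n. \<kappa> (z / c ^ i) / \<theta> (z / c ^ i)) \<longlonglongrightarrow> \<phi> z"
  unfolding \<phi>_def
proof (intro convergent_prod_LIMSEQ abs_convergent_prod_imp_convergent_prod summable_imp_abs_convergent_prod)
  show "summable (\<lambda>i. norm (\<kappa> (z / c ^ i) / \<theta> (z / c ^ i) - 1))"
  proof (rule summable_comparison_test)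
    show "summable (\<lambda>i. (v + w * d) / (u + w) * \<bar>z\<bar> * (1 / c) ^ i)"
      using c by (intro summable_mult summable_geometric) auto
    show "\<exists>K. \<forall>i\<ge>K. norm (norm (\<kappa> (z / c ^ i) / \<theta> (z / c ^ i) - 1)) \<le> (v + w * d) / (u + w) * \<bar>z\<bar> * (1 / c) ^ i"
    proof (intro exI allI impI)
      fix i :: nat
      show "norm (norm (\<kappa> (z / c ^ i) / \<theta> (z / c ^ i) - 1)) \<le> (v + w * d) / (u + w) * \<bar>z\<bar> * (1 / c) ^ i"
        using norm_\<kappa>_div_\<theta>_minus_one_le[of "z / c ^ i"] c by (simp add: abs_divide power_divide)
    qed
  qed
qed

text \<open>Splitting off the factor n = 0. The equation expresses stationarity: the side with
  \<kappa> is a jump of N, after which the argument of the remaining integral is divided by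
  c.\<close>

lemma \<phi>_rec: "\<theta> z * \<phi> z = \<kappa> z * \<phi> (z / c)"
proof -
  have "(\<lambda>n. (\<kappa> z / \<theta> z) * (\<Prod>i\<le>n. \<kappa> (z / c / c ^ i) / \<theta> (z / c / c ^ i))) \<longlonglongrightarrow> (\<kappa> z / \<theta> z) * \<phi> (z / c)"
    by (intro tendsto_mult tendsto_const \<phi>_LIMSEQ)
  moreover have "(\<lambda>n. (\<kappa> z / \<theta> z) * (\<Prod>i\<le>n. \<kappa> (z / c / c ^ i) / \<theta> (z / c / c ^ i))) \<longlonglongrightarrow> \<phi> z"
    using LIMSEQ_Suc[OF \<phi>_LIMSEQ[of z]] unfolding prod.atMost_Suc_shift by simp
  ultimately have "\<phi> z = (\<kappa> z / \<theta> z) * \<phi> (z / c)" by (rule LIMSEQ_unique[rotated])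
  then show ?thesis using \<theta>_nonzero[of z] by simp
qed

lemma norm_\<phi>_le: "norm (\<phi> z) \<le> 1"
proof (rule LIMSEQ_le_const2[OF tendsto_norm[OF \<phi>_LIMSEQ]])
  have "norm (\<Prod>i\<le>n. \<kappa> (z / c ^ i) / \<theta> (z / c ^ i)) \<le> 1" for n
    by (simp only: prod_norm[symmetric]) (intro prod_le_1 conjI norm_ge_zero norm_\<kappa>_div_\<theta>_le)
  then show "\<exists>K. \<forall>n\<ge>K. norm (\<Prod>i\<le>n. \<kappa> (z / c ^ i) / \<theta> (z / c ^ i)) \<le> 1" by blast
qed

lemma \<phi>_measurable [measurable]: "\<phi> \<in> borel_measurable borel"
proof (rule borel_measurable_LIMSEQ_metric[OF _ \<phi>_LIMSEQ])
  show "(\<lambda>z. \<Prod>i\<le>n. \<kappa> (z / c ^ i) / \<theta> (z / c ^ i)) \<in> borel_measurable borel" for n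
    unfolding \<kappa>_def \<theta>_def by measurable
qed

lemma norm_\<phi>_minus_one_le: "norm (\<phi> z - 1) \<le> (v + w * d) / (u + w) * \<bar>z\<bar> * (1 / (1 - 1 / c))"
proof (rule LIMSEQ_le_const2)
  show "(\<lambda>n. norm ((\<Prod>i\<le>n. \<kappa> (z / c ^ i) / \<theta> (z / c ^ i)) - 1)) \<longlonglongrightarrow> norm (\<phi> z - 1)"
    by (intro tendsto_intros \<phi>_LIMSEQ)
  have "norm ((\<Prod>i\<le>n. \<kappa> (z / c ^ i) / \<theta> (z / c ^ i)) - 1) \<le> (v + w * d) / (u + w) * \<bar>z\<bar> * (1 / (1 - 1 / c))" for n
  proof -
    have "norm ((\<Prod>i\<le>n. \<kappa> (z / c ^ i) / \<theta> (z / c ^ i)) - (\<Prod>i\<le>n. 1)) \<le> (\<Sum>i\<le>n. norm (\<kappa> (z / c ^ i) / \<theta> (z / c ^ i) - 1))"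
      by (rule norm_prod_diff) (use norm_\<kappa>_div_\<theta>_le in auto)
    also have "\<dots> \<le> (\<Sum>i\<le>n. (v + w * d) / (u + w) * \<bar>z\<bar> * (1 / c) ^ i)"
    proof (rule sum_mono)
      fix i show "norm (\<kappa> (z / c ^ i) / \<theta> (z / c ^ i) - 1) \<le> (v + w * d) / (u + w) * \<bar>z\<bar> * (1 / c) ^ i"
        using norm_\<kappa>_div_\<theta>_minus_one_le[of "z / c ^ i"] c by (simp add: abs_divide power_divide)
    qed
    also have "\<dots> = (v + w * d) / (u + w) * \<bar>z\<bar> * (\<Sum>i\<le>n. (1 / c) ^ i)" by (simp add: sum_distrib_left)
    also have "\<dots> \<le> (v + w * d) / (u + w) * \<bar>z\<bar> * (1 / (1 - 1 / c))"
    proof (intro mult_left_mono)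
      have "(\<Sum>i\<le>n. (1 / c) ^ i) \<le> (\<Sum>i. (1 / c) ^ i)"
        using c by (intro sum_le_suminf summable_geometric) auto
      also have "\<dots> = 1 / (1 - 1 / c)" using c by (intro suminf_geometric) auto
      finally show "(\<Sum>i\<le>n. (1 / c) ^ i) \<le> 1 / (1 - 1 / c)" .
    qed (use v w d_pos uw in auto)
    finally show ?thesis by simp
  qed
  then show "\<exists>K. \<forall>n\<ge>K. norm ((\<Prod>i\<le>n. \<kappa> (z / c ^ i) / \<theta> (z / c ^ i)) - 1) \<le> (v + w * d) / (u + w) * \<bar>z\<bar> * (1 / (1 - 1 / c))" by blast
qed

lemma \<phi>_tendsto_one:
  assumes "X \<longlonglongrightarrow> 0" shows "(\<lambda>n. \<phi> (X n)) \<longlonglongrightarrow> 1"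
proof (rule LIM_zero_cancel, rule Lim_null_comparison)
  show "\<forall>\<^sub>F n in sequentially. norm (\<phi> (X n) - 1) \<le> (v + w * d) / (u + w) * \<bar>X n\<bar> * (1 / (1 - 1 / c))"
    by (intro always_eventually allI norm_\<phi>_minus_one_le)
  have "(\<lambda>n. (v + w * d) / (u + w) * \<bar>X n\<bar> * (1 / (1 - 1 / c))) \<longlonglongrightarrow> (v + w * d) / (u + w) * \<bar>0\<bar> * (1 / (1 - 1 / c))"
    by (intro tendsto_mult tendsto_const tendsto_rabs assms)
  then show "(\<lambda>n. (v + w * d) / (u + w) * \<bar>X n\<bar> * (1 / (1 - 1 / c))) \<longlonglongrightarrow> 0" by simp
qed

text \<open>\<open>\<phi>\<close> is annihilated by the generator of the process that the integral and the counter form, so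
  one step of length \<open>h\<close> changes it only by \<open>O(h^2)\<close>.\<close>

lemma one_step_error:
  assumes h: "0 \<le> h"
  shows "norm ((CLINT \<omega>|M. iexp (y * L h \<omega>) * \<phi> (y * c powr (- N h \<omega>))) - \<phi> y)
    \<le> ((u + 2 * v + w)^2 + (u + w)^2) * h^2"
proof -
  note [measurable] = measurable_N[OF h] measurable_L[OF h]
  let ?e = "\<lambda>\<omega>. iexp (y * L h \<omega>) * \<phi> (y * c powr (- N h \<omega>))"
  let ?a = "\<lambda>m \<omega>. iexp (y * L h \<omega>) * of_bool (N h \<omega> = real m) :: complex"
  let ?B = "\<lambda>\<omega>. of_bool (N h \<omega> = real 0) + of_bool (N h \<omega> = real 1) :: real"
  have ie: "integrable M ?e" by (rule integrable_const_bound[where B=1]) (auto simp: norm_mult norm_\<phi>_le)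
  have ia: "integrable M (?a m)" for m by (rule integrable_const_bound[where B=1]) (auto simp: norm_mult)
  have iB: "integrable M (\<lambda>\<omega>. of_bool (N h \<omega> = real m) :: real)" for m by (rule integrable_const_bound[where B=1]) auto
  have pB: "(LINT \<omega>|M. of_bool (N h \<omega> = real m)) = exp (- (h * (u + w))) * ((h * (u + w)) ^ m / fact m)" for m
  proof -
    have "(LINT \<omega>|M. of_bool (N h \<omega> = real m)) = (LINT \<omega>|M. indicator {\<omega> \<in> space M. N h \<omega> = real m} \<omega> :: real)"
      by (intro Bochner_Integration.integral_cong refl) (simp add: indicator_def)
    then show ?thesis using prob_N_eq[OF h, of m] by simp
  qed
  let ?x = "complex_of_real h * \<theta> y"
  \<comment> \<open>The events N h = 0 and N h = 1 are computed exactly, and the recursion merges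
    them into \<phi> y times exp (-x) (1 + x). What is left is the event that N h is neither 0 nor
    1, of probability O(h^2), and the second-order defect of exp (-x) (1 + x).\<close>
  have split: "(CLINT \<omega>|M. ?e \<omega>) - \<phi> y = (CLINT \<omega>|M. ?e \<omega> - (?a 0 \<omega> * \<phi> y + ?a 1 \<omega> * \<phi> (y / c))) + \<phi> y * (exp (- ?x) * (1 + ?x) - 1)"
  proof -
    have a0: "(CLINT \<omega>|M. ?a 0 \<omega>) = exp (- ?x)" using cf_L_atom_N[OF h, of y 0] by simp
    have a1: "(CLINT \<omega>|M. ?a 1 \<omega>) = exp (- ?x) * (complex_of_real h * \<kappa> y)" using cf_L_atom_N[OF h, of y 1] by simp
    have "(CLINT \<omega>|M. ?e \<omega> - (?a 0 \<omega> * \<phi> y + ?a 1 \<omega> * \<phi> (y / c)))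
        = (CLINT \<omega>|M. ?e \<omega>) - ((CLINT \<omega>|M. ?a 0 \<omega>) * \<phi> y + (CLINT \<omega>|M. ?a 1 \<omega>) * \<phi> (y / c))"
      by (subst Bochner_Integration.integral_diff[OF ie], intro Bochner_Integration.integrable_add integrable_mult_left ia,
          subst Bochner_Integration.integral_add[OF integrable_mult_left[OF ia] integrable_mult_left[OF ia]],
          simp only: integral_mult_left_zero)
    also have "(CLINT \<omega>|M. ?a 0 \<omega>) * \<phi> y + (CLINT \<omega>|M. ?a 1 \<omega>) * \<phi> (y / c)
        = exp (- ?x) * \<phi> y + exp (- ?x) * complex_of_real h * (\<kappa> y * \<phi> (y / c))"
      unfolding a0 a1 by (simp only: mult_ac)
    also have "\<dots> = \<phi> y * (exp (- ?x) * (1 + ?x))" unfolding \<phi>_rec[symmetric] by (simp add: algebra_simps)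
    finally show ?thesis by (simp add: algebra_simps)
  qed
  have "norm (CLINT \<omega>|M. ?e \<omega> - (?a 0 \<omega> * \<phi> y + ?a 1 \<omega> * \<phi> (y / c))) \<le> (LINT \<omega>|M. 1 - ?B \<omega>)"
  proof (rule order_trans[OF integral_norm_bound], rule integral_mono)
    show "integrable M (\<lambda>\<omega>. norm (?e \<omega> - (?a 0 \<omega> * \<phi> y + ?a 1 \<omega> * \<phi> (y / c))))"
      by (intro integrable_norm Bochner_Integration.integrable_diff ie Bochner_Integration.integrable_add integrable_mult_left ia)
    show "integrable M (\<lambda>\<omega>. 1 - ?B \<omega>)"
      by (intro Bochner_Integration.integrable_diff Bochner_Integration.integrable_add iB) simp
    fix \<omega>
    consider "N h \<omega> = 0" | "N h \<omega> = 1" | "N h \<omega> \<noteq> 0" "N h \<omega> \<noteq> 1" by blast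
    then show "norm (?e \<omega> - (?a 0 \<omega> * \<phi> y + ?a 1 \<omega> * \<phi> (y / c))) \<le> 1 - ?B \<omega>"
    proof cases
      case 2 then show ?thesis using c by (simp add: powr_minus divide_inverse)
    qed (use c in \<open>auto simp: norm_mult norm_\<phi>_le\<close>)
  qed
  also have "(LINT \<omega>|M. 1 - ?B \<omega>) = 1 - exp (- (h * (u + w))) * (1 + h * (u + w))"
    by (subst Bochner_Integration.integral_diff, simp, intro Bochner_Integration.integrable_add iB,
        subst Bochner_Integration.integral_add[OF iB iB]) (simp add: pB[of 0, simplified] pB[of 1, simplified] prob_space algebra_simps)
  also have "\<dots> \<le> (h * (u + w))^2"
  proof -
    have "(1 - h * (u + w)) * (1 + h * (u + w)) \<le> exp (- (h * (u + w))) * (1 + h * (u + w))"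
      using exp_ge_add_one_self[of "- (h * (u + w))"] h uw by (intro mult_right_mono) auto
    then show ?thesis by (simp add: power2_eq_square algebra_simps)
  qed
  finally have 1: "norm (CLINT \<omega>|M. ?e \<omega> - (?a 0 \<omega> * \<phi> y + ?a 1 \<omega> * \<phi> (y / c))) \<le> (u + w)^2 * h^2"
    by (simp add: power_mult_distrib mult.commute)
  have "norm (\<phi> y * (exp (- ?x) * (1 + ?x) - 1)) = norm (\<phi> y) * norm (exp (- ?x) * (1 + ?x) - 1)"
    by (rule norm_mult)
  also have "\<dots> \<le> 1 * (norm ?x)^2"
  proof (rule mult_mono[OF norm_\<phi>_le norm_exp_minus_mult_le])
    show "0 \<le> Re ?x" using h Re_\<theta>_pos[of y] by simp
  qed auto
  also have "(norm ?x)^2 = h^2 * (norm (\<theta> y))^2" by (simp add: norm_mult power_mult_distrib)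
  also have "\<dots> \<le> h^2 * (u + 2 * v + w)^2" by (intro mult_left_mono power_mono norm_\<theta>_le) auto
  finally have 2: "norm (\<phi> y * (exp (- ?x) * (1 + ?x) - 1)) \<le> (u + 2 * v + w)^2 * h^2" by (simp add: mult.commute)
  show ?thesis unfolding split using norm_triangle_le[OF add_mono[OF 1 2]] by (simp add: algebra_simps)
qed

end

lemma (in prob_space) norm_expectation_le:
  fixes f :: "'a \<Rightarrow> complex"
  assumes "\<And>\<omega>. norm (f \<omega>) \<le> B"
  shows "norm (CLINT \<omega>|M. f \<omega>) \<le> B"
proof -
  have "norm (CLINT \<omega>|M. f \<omega>) \<le> (LINT \<omega>|M. norm (f \<omega>))" by (rule integral_norm_bound)
  also have "\<dots> \<le> (LINT \<omega>|M. B)"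
    by (rule integral_mono') (use assms order_trans[OF norm_ge_zero assms] in auto)
  finally show ?thesis by (simp add: prob_space)
qed

section \<open>The integral on the grid as an approximate martingale\<close>

context compound_poisson_pair
begin

text \<open>Counter and integral are functions of the sequence of increments, so that the state
  after j steps depends on the coordinates below j only and independence of the next increment
  applies.\<close>

definition grid_N :: "nat \<Rightarrow> (nat \<Rightarrow> real \<times> real) \<Rightarrow> real" where
  "grid_N j x = (\<Sum>l<j. fst (x l))"

definition grid_integral :: "nat \<Rightarrow> (nat \<Rightarrow> real \<times> real) \<Rightarrow> real" where
  "grid_integral j x = (\<Sum>i<j. c powr (- grid_N i x) * snd (x i))"

lemma grid_restrict:
  "grid_N j (restrict x {..<j}) = grid_N j x" "grid_integral j (restrict x {..<j}) = grid_integral j x"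
proof -
  have N: "grid_N i (restrict x {..<j}) = grid_N i x" if "i \<le> j" for i
    unfolding grid_N_def using that by (intro sum.cong) auto
  show "grid_N j (restrict x {..<j}) = grid_N j x" by (rule N) simp
  show "grid_integral j (restrict x {..<j}) = grid_integral j x"
    unfolding grid_integral_def by (intro sum.cong) (auto simp: N)
qed

lemma measurable_fst_borel [measurable]: "fst \<in> borel_measurable (borel :: (real \<times> real) measure)"
  and measurable_snd_borel [measurable]: "snd \<in> borel_measurable (borel :: (real \<times> real) measure)"
  by (intro borel_measurable_continuous_onI continuous_intros)+

lemma measurable_fst_component: "i \<in> I \<Longrightarrow> (\<lambda>x. fst (x i)) \<in> borel_measurable (PiM I (\<lambda>_. borel :: (real \<times> real) measure))"
  and measurable_snd_component: "i \<in> I \<Longrightarrow> (\<lambda>x. snd (x i)) \<in> borel_measurable (PiM I (\<lambda>_. borel :: (real \<times> real) measure))"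
proof -
  assume i: "i \<in> I"
  have m: "(\<lambda>x. x i) \<in> measurable (PiM I (\<lambda>_. borel :: (real \<times> real) measure)) borel"
    using i by (rule measurable_component_singleton)
  show "(\<lambda>x. fst (x i)) \<in> borel_measurable (PiM I (\<lambda>_. borel :: (real \<times> real) measure))"
    by (rule measurable_compose[OF m measurable_fst_borel])
  show "(\<lambda>x. snd (x i)) \<in> borel_measurable (PiM I (\<lambda>_. borel :: (real \<times> real) measure))"
    by (rule measurable_compose[OF m measurable_snd_borel])
qed

lemma grid_N_measurable: "i \<le> j \<Longrightarrow> grid_N i \<in> borel_measurable (PiM {..<j} (\<lambda>_. borel))"
  unfolding grid_N_def
  by (intro borel_measurable_sum measurable_fst_component) auto

lemma grid_integral_measurable: "grid_integral j \<in> borel_measurable (PiM {..<j} (\<lambda>_. borel))"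
  unfolding grid_integral_def
proof (intro borel_measurable_sum borel_measurable_times)
  fix i assume i: "i \<in> {..<j}"
  show "(\<lambda>x. snd (x i)) \<in> borel_measurable (PiM {..<j} (\<lambda>_. borel :: (real \<times> real) measure))"
    by (rule measurable_snd_component[OF i])
  have [measurable]: "grid_N i \<in> borel_measurable (PiM {..<j} (\<lambda>_. borel))"
    using i by (intro grid_N_measurable) auto
  show "(\<lambda>x. c powr (- grid_N i x)) \<in> borel_measurable (PiM {..<j} (\<lambda>_. borel))" by measurable
qed

abbreviation "step_const \<equiv> (u + 2 * v + w)^2 + (u + w)^2"

text \<open>The conjectured conditional transform of the full integral given the first j steps: the
  accumulated part times \<phi> at the argument scaled by c^(-N). If \<phi> is the right transform,
  its expectation is nearly constant in j.\<close>

definition grid_value :: "real \<Rightarrow> nat \<Rightarrow> (nat \<Rightarrow> real \<times> real) \<Rightarrow> complex" where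
  "grid_value z j x = iexp (z * grid_integral j x) * \<phi> (z * c powr (- grid_N j x))"

lemma norm_grid_value_le: "norm (grid_value z j x) \<le> 1"
  unfolding grid_value_def by (simp add: norm_mult norm_\<phi>_le)

lemma grid_value_measurable: "grid_value z j \<in> borel_measurable (PiM {..<j} (\<lambda>_. borel))"
proof -
  note [measurable] = grid_N_measurable[OF order_refl] grid_integral_measurable
  show ?thesis unfolding grid_value_def by measurable
qed

lemma measurable_increments: "(\<lambda>\<omega>. restrict (\<lambda>i. increment m i \<omega>) I) \<in> measurable M (PiM I (\<lambda>_. borel))"
  by (intro measurable_restrict measurable_increment)

text \<open>Independence lets increment j be integrated out with the past fixed; the inner integral
  is then the one-step expectation at the random argument y = z c^(-N), and the bound of
  \<open>one_step_error\<close> is uniform in y.\<close>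

lemma grid_value_step:
  assumes m: "m > 0"
  shows "norm ((CLINT \<omega>|M. grid_value z (Suc j) (\<lambda>i. increment m i \<omega>)) - (CLINT \<omega>|M. grid_value z j (\<lambda>i. increment m i \<omega>)))
    \<le> step_const * (1 / real m)^2"
proof -
  let ?S = "PiM {..<j} (\<lambda>_. borel :: (real \<times> real) measure)" and ?T = "PiM {j} (\<lambda>_. borel :: (real \<times> real) measure)"
  let ?X = "\<lambda>\<omega>. restrict (\<lambda>i. increment m i \<omega>) {..<j}" and ?Y = "\<lambda>\<omega>. restrict (\<lambda>i. increment m i \<omega>) {j}"
  let ?h = "1 / real m"
  have h: "0 \<le> ?h" by simp
  have ind: "indep_var ?S ?X ?T ?Y"
    by (rule indep_var_restrict[OF indep_increments[OF m, of "Suc j"]]) auto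
  define H where "H a p = iexp (a * snd p) * \<phi> (a * c powr (- fst p))" for a and p :: "real \<times> real"
  have H_le: "norm (H a p) \<le> 1" for a p by (simp add: H_def norm_mult norm_\<phi>_le)
  define g where "g p = iexp (z * grid_integral j (fst p)) * H (z * c powr (- grid_N j (fst p))) (snd p j)" for p :: "(nat \<Rightarrow> real \<times> real) \<times> (nat \<Rightarrow> real \<times> real)"
  have g_meas: "g \<in> borel_measurable (?S \<Otimes>\<^sub>M ?T)"
  proof -
    have [measurable]: "(\<lambda>p. fst (snd p j)) \<in> borel_measurable (?S \<Otimes>\<^sub>M ?T)" "(\<lambda>p. snd (snd p j)) \<in> borel_measurable (?S \<Otimes>\<^sub>M ?T)"
      by (rule measurable_compose[OF measurable_snd measurable_fst_component]
        measurable_compose[OF measurable_snd measurable_snd_component], simp)+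
    have [measurable]: "(\<lambda>p. grid_N j (fst p)) \<in> borel_measurable (?S \<Otimes>\<^sub>M ?T)" "(\<lambda>p. grid_integral j (fst p)) \<in> borel_measurable (?S \<Otimes>\<^sub>M ?T)"
      by (rule measurable_compose[OF measurable_fst grid_N_measurable[OF order_refl]]
        measurable_compose[OF measurable_fst grid_integral_measurable])+
    show ?thesis unfolding g_def H_def by measurable
  qed
  have g_eq: "grid_value z (Suc j) (\<lambda>i. increment m i \<omega>) = g (?X \<omega>, ?Y \<omega>)" for \<omega>
  proof -
    let ?x = "\<lambda>i. increment m i \<omega>"
    have N: "grid_N (Suc j) ?x = grid_N j ?x + fst (?x j)" by (simp add: grid_N_def)
    have I: "grid_integral (Suc j) ?x = grid_integral j ?x + c powr (- grid_N j ?x) * snd (?x j)" by (simp add: grid_integral_def)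
    have p: "c powr (- (grid_N j ?x + fst (?x j))) = c powr (- grid_N j ?x) * c powr (- fst (?x j))"
      by (simp add: powr_add[symmetric])
    show ?thesis unfolding grid_value_def N I g_def fst_conv snd_conv grid_restrict H_def p
      by (simp add: ring_distribs exp_add mult.assoc)
  qed
  define P where "P a = (CLINT \<omega>|M. iexp (a * L ?h \<omega>) * \<phi> (a * c powr (- N ?h \<omega>)))" for a
  have inner: "(CLINT \<omega>'|M. g (?X \<omega>, ?Y \<omega>')) = iexp (z * grid_integral j (?X \<omega>)) * P (z * c powr (- grid_N j (?X \<omega>)))" for \<omega>
  proof -
    have H_meas: "H a \<in> borel_measurable borel" for a unfolding H_def by measurable
    have "(CLINT \<omega>'|M. H a (increment m j \<omega>')) = P a" for a
      unfolding integral_increment_grid[OF H_meas] by (simp add: H_def P_def)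
    then show ?thesis by (simp add: g_def)
  qed
  have X_meas: "?X \<in> measurable M ?S" by (rule measurable_increments)
  have int1: "integrable M (\<lambda>\<omega>. CLINT \<omega>'|M. g (?X \<omega>, ?Y \<omega>'))"
  proof (rule integrable_const_bound[where B=1])
    have "(\<lambda>(\<omega>, \<omega>'). g (?X \<omega>, ?Y \<omega>')) \<in> borel_measurable (M \<Otimes>\<^sub>M M)"
      unfolding case_prod_beta
      by (rule measurable_compose[OF measurable_Pair g_meas],
          rule measurable_compose[OF measurable_fst X_meas],
          rule measurable_compose[OF measurable_snd measurable_increments])
    then show "(\<lambda>\<omega>. CLINT \<omega>'|M. g (?X \<omega>, ?Y \<omega>')) \<in> borel_measurable M"
      by (rule borel_measurable_lebesgue_integral)
    have "norm (CLINT \<omega>'|M. g (?X \<omega>, ?Y \<omega>')) \<le> 1" for \<omega>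
      by (rule norm_expectation_le) (use H_le in \<open>simp add: g_def norm_mult\<close>)
    then show "AE \<omega> in M. norm (CLINT \<omega>'|M. g (?X \<omega>, ?Y \<omega>')) \<le> 1" by simp
  qed
  have int2: "integrable M (\<lambda>\<omega>. grid_value z j (?X \<omega>))"
    by (rule integrable_const_bound[where B=1, OF AE_I2[OF norm_grid_value_le]
          measurable_compose[OF X_meas grid_value_measurable]])
  have "(CLINT \<omega>|M. grid_value z (Suc j) (\<lambda>i. increment m i \<omega>)) = (CLINT \<omega>|M. CLINT \<omega>'|M. g (?X \<omega>, ?Y \<omega>'))"
    unfolding g_eq
    by (rule integral_indep_var[OF ind g_meas]) (simp add: g_def norm_mult H_le)
  moreover have "(CLINT \<omega>|M. grid_value z j (\<lambda>i. increment m i \<omega>)) = (CLINT \<omega>|M. grid_value z j (?X \<omega>))"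
    unfolding grid_value_def grid_restrict ..
  ultimately have "(CLINT \<omega>|M. grid_value z (Suc j) (\<lambda>i. increment m i \<omega>)) - (CLINT \<omega>|M. grid_value z j (\<lambda>i. increment m i \<omega>))
      = (CLINT \<omega>|M. (CLINT \<omega>'|M. g (?X \<omega>, ?Y \<omega>')) - grid_value z j (?X \<omega>))"
    by (simp only: Bochner_Integration.integral_diff[OF int1 int2])
  also have "norm \<dots> \<le> step_const * ?h^2"
  proof (rule norm_expectation_le)
    fix \<omega>
    let ?a = "z * c powr (- grid_N j (?X \<omega>))"
    have "(CLINT \<omega>'|M. g (?X \<omega>, ?Y \<omega>')) - grid_value z j (?X \<omega>) = iexp (z * grid_integral j (?X \<omega>)) * (P ?a - \<phi> ?a)"
      unfolding inner grid_value_def by (rule right_diff_distrib[symmetric])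
    then have "norm ((CLINT \<omega>'|M. g (?X \<omega>, ?Y \<omega>')) - grid_value z j (?X \<omega>)) = norm (iexp (z * grid_integral j (?X \<omega>))) * norm (P ?a - \<phi> ?a)"
      by (simp only: norm_mult)
    also have "\<dots> = norm (P ?a - \<phi> ?a)" by simp
    also have "\<dots> \<le> step_const * ?h^2" unfolding P_def by (rule one_step_error[OF h])
    finally show "norm ((CLINT \<omega>'|M. g (?X \<omega>, ?Y \<omega>')) - grid_value z j (?X \<omega>)) \<le> step_const * ?h^2" .
  qed
  finally show ?thesis .
qed

lemma grid_value_error:
  assumes m: "m > 0"
  shows "norm ((CLINT \<omega>|M. grid_value z j (\<lambda>i. increment m i \<omega>)) - \<phi> z) \<le> real j * (step_const * (1 / real m)^2)"
proof (induction j)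
  case 0
  have "grid_value z 0 x = \<phi> z" for x using c by (simp add: grid_value_def grid_N_def grid_integral_def)
  then show ?case by (simp add: prob_space)
next
  case (Suc j)
  have "norm ((CLINT \<omega>|M. grid_value z (Suc j) (\<lambda>i. increment m i \<omega>)) - \<phi> z)
     \<le> norm ((CLINT \<omega>|M. grid_value z (Suc j) (\<lambda>i. increment m i \<omega>)) - (CLINT \<omega>|M. grid_value z j (\<lambda>i. increment m i \<omega>)))
       + norm ((CLINT \<omega>|M. grid_value z j (\<lambda>i. increment m i \<omega>)) - \<phi> z)"
    by (rule norm_diff_triangle_le) (rule order_refl)+
  also have "\<dots> \<le> step_const * (1 / real m)^2 + real j * (step_const * (1 / real m)^2)"
    by (intro add_mono grid_value_step[OF m] Suc)
  finally show ?case by (simp add: algebra_simps)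
qed

text \<open>A Borel version of the integral over (0, t] for integer t.\<close>

definition I_lim :: "nat \<Rightarrow> 'a \<Rightarrow> real" where
  "I_lim t \<omega> = lim (\<lambda>n. riemann_sum (\<lambda>t. N t \<omega>) (\<lambda>t. L t \<omega>) c t n)"

lemma riemann_sum_measurable [measurable]:
  "(\<lambda>\<omega>. riemann_sum (\<lambda>t. N t \<omega>) (\<lambda>t. L t \<omega>) c t n) \<in> borel_measurable M"
proof -
  have [measurable]: "N (real i / real m) \<in> borel_measurable M" "L (real i / real m) \<in> borel_measurable M" for i m :: nat
    by (intro measurable_N measurable_L, simp)+
  show ?thesis unfolding riemann_sum_def
    by (intro borel_measurable_sum borel_measurable_times) (simp_all del: of_nat_Suc)
qed

lemma I_lim_measurable [measurable]: "I_lim t \<in> borel_measurable M"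
  unfolding I_lim_def by measurable

lemma AE_I_lim:
  "AE \<omega> in M. counting_path (\<lambda>t. N t \<omega>) (\<lambda>t. L t \<omega>) \<and>
     (\<forall>t. (\<lambda>n. riemann_sum (\<lambda>t. N t \<omega>) (\<lambda>t. L t \<omega>) c t n) \<longlonglongrightarrow> I_lim t \<omega> \<and>
       I_lim t \<omega> = path_integral (\<lambda>t. N t \<omega>) (\<lambda>t. L t \<omega>) c (real t))"
  using AE_path
proof eventually_elim
  case (elim \<omega>)
  interpret counting_path "\<lambda>t. N t \<omega>" "\<lambda>t. L t \<omega>" using elim by simp
  have "(\<lambda>n. riemann_sum (\<lambda>t. N t \<omega>) (\<lambda>t. L t \<omega>) c t n) \<longlonglongrightarrow> path_integral (\<lambda>t. N t \<omega>) (\<lambda>t. L t \<omega>) c (real t)" for t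
    by (rule path_integral_approx(2)[OF c])
  moreover from this have "I_lim t \<omega> = path_integral (\<lambda>t. N t \<omega>) (\<lambda>t. L t \<omega>) c (real t)" for t
    unfolding I_lim_def by (rule limI)
  ultimately show ?case using elim by simp
qed

text \<open>There are t (n + 1) steps with an error O(1 / (n + 1)^2) each, so the martingale
  identity becomes exact as the mesh vanishes.\<close>

lemma cf_I_lim: "(CLINT \<omega>|M. iexp (z * I_lim t \<omega>) * \<phi> (z * c powr (- N (real t) \<omega>))) = \<phi> z"
proof -
  have [measurable]: "N (real t) \<in> borel_measurable M" by (rule measurable_N) simp
  let ?R = "\<lambda>n \<omega>. riemann_sum (\<lambda>t. N t \<omega>) (\<lambda>t. L t \<omega>) c t n"
  let ?V = "\<lambda>n \<omega>. iexp (z * ?R n \<omega>) * \<phi> (z * c powr (- N (real t) \<omega>))"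
  have "(\<lambda>n. CLINT \<omega>|M. ?V n \<omega>) \<longlonglongrightarrow> (CLINT \<omega>|M. iexp (z * I_lim t \<omega>) * \<phi> (z * c powr (- N (real t) \<omega>)))"
  proof (rule integral_dominated_convergence[where w="\<lambda>_. 1"])
    show "AE \<omega> in M. (\<lambda>n. ?V n \<omega>) \<longlonglongrightarrow> iexp (z * I_lim t \<omega>) * \<phi> (z * c powr (- N (real t) \<omega>))"
      using AE_I_lim
    proof eventually_elim
      case (elim \<omega>)
      then have "(\<lambda>n. ?R n \<omega>) \<longlonglongrightarrow> I_lim t \<omega>" by blast
      then show ?case by (intro tendsto_intros)
    qed
    show "AE \<omega> in M. norm (?V n \<omega>) \<le> 1" for n by (simp add: norm_mult norm_\<phi>_le)
  qed auto
  moreover have "(\<lambda>n. CLINT \<omega>|M. ?V n \<omega>) \<longlonglongrightarrow> \<phi> z"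
  proof (rule LIM_zero_cancel, rule Lim_null_comparison)
    have eq: "(CLINT \<omega>|M. ?V n \<omega>) = (CLINT \<omega>|M. grid_value z (t * Suc n) (\<lambda>i. increment (Suc n) i \<omega>))" for n
    proof (rule integral_cong_AE)
      show "AE \<omega> in M. ?V n \<omega> = grid_value z (t * Suc n) (\<lambda>i. increment (Suc n) i \<omega>)"
        using AE_path
      proof eventually_elim
        case (elim \<omega>)
        interpret counting_path "\<lambda>t. N t \<omega>" "\<lambda>t. L t \<omega>" using elim by simp
        have gN: "grid_N i (\<lambda>i. increment (Suc n) i \<omega>) = N (real i / real (Suc n)) \<omega>" for i
          using sum_lessThan_telescope[of "\<lambda>i. N (real i / real (Suc n)) \<omega>" i] N_zero
          by (simp add: grid_N_def increment_def)
        have "grid_integral (t * Suc n) (\<lambda>i. increment (Suc n) i \<omega>) = ?R n \<omega>"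
          unfolding grid_integral_def gN riemann_sum_def by (simp add: increment_def)
        moreover have "grid_N (t * Suc n) (\<lambda>i. increment (Suc n) i \<omega>) = N (real t) \<omega>"
          unfolding gN of_nat_mult by (simp del: of_nat_Suc)
        ultimately show ?case by (simp add: grid_value_def)
      qed
      show "?V n \<in> borel_measurable M" by measurable
      have "(\<lambda>\<omega>. grid_value z (t * Suc n) (restrict (\<lambda>i. increment (Suc n) i \<omega>) {..<t * Suc n})) \<in> borel_measurable M"
        by (rule measurable_compose[OF measurable_increments grid_value_measurable])
      then show "(\<lambda>\<omega>. grid_value z (t * Suc n) (\<lambda>i. increment (Suc n) i \<omega>)) \<in> borel_measurable M"
        unfolding grid_value_def grid_restrict .
    qed
    show "\<forall>\<^sub>F n in sequentially. norm ((CLINT \<omega>|M. ?V n \<omega>) - \<phi> z) \<le> real t * step_const * inverse (real (Suc n))"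
    proof (intro always_eventually allI)
      fix n
      have "norm ((CLINT \<omega>|M. ?V n \<omega>) - \<phi> z) \<le> real (t * Suc n) * (step_const * (1 / real (Suc n))^2)"
        unfolding eq by (rule grid_value_error) simp
      also have "\<dots> = real t * step_const * inverse (real (Suc n))"
        unfolding of_nat_mult by (simp add: power2_eq_square divide_inverse del: of_nat_Suc)
      finally show "norm ((CLINT \<omega>|M. ?V n \<omega>) - \<phi> z) \<le> real t * step_const * inverse (real (Suc n))" .
    qed
    show "(\<lambda>n. real t * step_const * inverse (real (Suc n))) \<longlonglongrightarrow> 0"
      by (rule tendsto_mult_right_zero) (rule LIMSEQ_inverse_real_of_nat)
  qed
  ultimately show ?thesis by (rule LIMSEQ_unique)
qed

lemma cf_I_lim_tendsto: "(\<lambda>t. CLINT \<omega>|M. iexp (z * I_lim t \<omega>)) \<longlonglongrightarrow> \<phi> z"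
proof -
  have [measurable]: "N (real t) \<in> borel_measurable M" for t by (rule measurable_N) simp
  let ?V = "\<lambda>t \<omega>. iexp (z * I_lim t \<omega>) * (1 - \<phi> (z * c powr (- N (real t) \<omega>)))"
  have "(\<lambda>t. CLINT \<omega>|M. ?V t \<omega>) \<longlonglongrightarrow> (CLINT \<omega>|M. 0)"
  proof (rule integral_dominated_convergence[where w="\<lambda>_. 2"])
    show "AE \<omega> in M. norm (?V t \<omega>) \<le> 2" for t
    proof (intro AE_I2)
      fix \<omega>
      have "norm (?V t \<omega>) = norm (1 - \<phi> (z * c powr (- N (real t) \<omega>)))" by (simp add: norm_mult)
      also have "\<dots> \<le> 1 + 1" by (rule order_trans[OF norm_triangle_ineq4]) (simp add: norm_\<phi>_le)
      finally show "norm (?V t \<omega>) \<le> 2" by simp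
    qed
    show "AE \<omega> in M. (\<lambda>t. ?V t \<omega>) \<longlonglongrightarrow> 0"
      using AE_path
    proof eventually_elim
      case (elim \<omega>)
      interpret counting_path "\<lambda>t. N t \<omega>" "\<lambda>t. L t \<omega>" using elim by simp
      have "(\<lambda>t. c powr (- N (real t) \<omega>)) \<longlonglongrightarrow> 0"
      proof -
        have "filterlim (\<lambda>t. ln c * N (real t) \<omega>) at_top sequentially"
          using c by (intro filterlim_tendsto_pos_mult_at_top[OF tendsto_const _ filterlim_N]) simp
        then have "filterlim (\<lambda>t. - (ln c * N (real t) \<omega>)) at_bot sequentially"
          by (simp add: filterlim_uminus_at_bot)
        from filterlim_compose[OF exp_at_bot this] show ?thesis
          using c by (simp add: powr_def mult.commute)
      qed
      from tendsto_mult[OF tendsto_const this, of z]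
      have "(\<lambda>t. z * c powr (- N (real t) \<omega>)) \<longlonglongrightarrow> 0" by simp
      from tendsto_norm_zero[OF tendsto_diff[OF tendsto_const \<phi>_tendsto_one[OF this], of 1, simplified]]
      have "(\<lambda>t. norm (?V t \<omega>)) \<longlonglongrightarrow> 0" by (simp add: norm_mult)
      then show ?case by (rule tendsto_norm_zero_cancel)
    qed
  qed auto
  then have "(\<lambda>t. (CLINT \<omega>|M. ?V t \<omega>) + \<phi> z) \<longlonglongrightarrow> 0 + \<phi> z" by (intro tendsto_add tendsto_const) simp
  moreover have "(CLINT \<omega>|M. ?V t \<omega>) + \<phi> z = (CLINT \<omega>|M. iexp (z * I_lim t \<omega>))" for t
  proof -
    have "(CLINT \<omega>|M. ?V t \<omega>) = (CLINT \<omega>|M. iexp (z * I_lim t \<omega>) - iexp (z * I_lim t \<omega>) * \<phi> (z * c powr (- N (real t) \<omega>)))"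
      by (simp only: right_diff_distrib mult_1_right)
    also have "\<dots> = (CLINT \<omega>|M. iexp (z * I_lim t \<omega>)) - (CLINT \<omega>|M. iexp (z * I_lim t \<omega>) * \<phi> (z * c powr (- N (real t) \<omega>)))"
      by (rule Bochner_Integration.integral_diff; rule integrable_const_bound[where B=1]) (auto simp: norm_mult norm_\<phi>_le)
    finally show ?thesis by (simp only: cf_I_lim diff_add_cancel)
  qed
  ultimately show ?thesis by simp
qed

text \<open>Finiteness of the limit is read off the characteristic functions: mass escaping to infinity
  would keep their averages over a centred normal argument of vanishing variance away from 1.\<close>

lemma AE_I_lim_bounded: "AE \<omega> in M. \<exists>B::nat. \<forall>t. I_lim t \<omega> < real B"
proof -
  interpret G: real_distribution std_normal_distribution by (rule real_dist_normal_dist)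
  define D where "D = {\<omega> \<in> space M. \<forall>B::nat. \<exists>t. real B \<le> I_lim t \<omega>}"
  have D[measurable]: "D \<in> sets M" unfolding D_def by measurable
  \<comment> \<open>For fixed s let t grow: the Gaussian kernel vanishes on \<open>D\<close> and is
    at most 1 elsewhere. Letting s tend to 0 afterwards sends the left-hand side to 1, because
    \<phi> tends to 1 at 0, and leaves \<open>D\<close> no mass.\<close>
  have key: "Re (CLINT \<xi>|std_normal_distribution. \<phi> (\<xi> * s)) \<le> 1 - prob D" if s: "s > 0" for s
  proof -
    let ?E = "\<lambda>t \<omega>. exp (- ((s * I_lim t \<omega>)^2) / 2)"
    have iE: "integrable M (?E t)" for t by (rule integrable_const_bound[where B=1]) auto
    have eq: "(CLINT \<xi>|std_normal_distribution. CLINT \<omega>|M. iexp (\<xi> * s * I_lim t \<omega>)) = complex_of_real (LINT \<omega>|M. ?E t \<omega>)" for t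
    proof -
      have "(CLINT \<xi>|std_normal_distribution. CLINT \<omega>|M. iexp (\<xi> * s * I_lim t \<omega>))
        = (CLINT \<xi>|std_normal_distribution. CLINT \<omega>|M. 1 * iexp (\<xi> * (s * I_lim t \<omega>)))"
        by (simp only: mult.assoc mult_1_left)
      also have "\<dots> = (CLINT \<omega>|M. 1 * complex_of_real (?E t \<omega>))"
        by (rule integral_std_normal_swap) (auto intro: sigma_finite_measure_axioms)
      finally show ?thesis by simp
    qed
    have lim: "(\<lambda>t. CLINT \<xi>|std_normal_distribution. CLINT \<omega>|M. iexp (\<xi> * s * I_lim t \<omega>))
      \<longlonglongrightarrow> (CLINT \<xi>|std_normal_distribution. \<phi> (\<xi> * s))"
    proof (rule integral_dominated_convergence[where w="\<lambda>_. 1"])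
      show "AE \<xi> in std_normal_distribution. (\<lambda>t. CLINT \<omega>|M. iexp (\<xi> * s * I_lim t \<omega>)) \<longlonglongrightarrow> \<phi> (\<xi> * s)"
        by (intro AE_I2 cf_I_lim_tendsto)
      show "AE \<xi> in std_normal_distribution. norm (CLINT \<omega>|M. iexp (\<xi> * s * I_lim t \<omega>)) \<le> 1" for t
      proof (intro AE_I2)
        fix \<xi>
        show "norm (CLINT \<omega>|M. iexp (\<xi> * s * I_lim t \<omega>)) \<le> 1"
          by (rule norm_expectation_le) (simp only: norm_exp_i_times order_refl)
      qed
      show "(\<lambda>\<xi>. CLINT \<omega>|M. iexp (\<xi> * s * I_lim t \<omega>)) \<in> borel_measurable std_normal_distribution" for t
        by (intro borel_measurable_lebesgue_integral) measurable
    qed auto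
    have Dlim: "(\<lambda>t. LINT \<omega>|M. ?E t \<omega> * indicator D \<omega>) \<longlonglongrightarrow> (LINT \<omega>|M. (0::real))"
    proof (rule integral_dominated_convergence[where w="\<lambda>_. 1"])
      show "AE \<omega> in M. (\<lambda>t. ?E t \<omega> * indicator D \<omega>) \<longlonglongrightarrow> 0"
        using AE_I_lim
      proof eventually_elim
        case (elim \<omega>)
        interpret counting_path "\<lambda>t. N t \<omega>" "\<lambda>t. L t \<omega>" using elim by simp
        have mono: "I_lim t \<omega> \<le> I_lim t' \<omega>" if "t \<le> t'" for t t'
          using elim path_integral_mono[OF c, of "real t" "real t'"] that by simp
        show ?case
        proof (cases "\<omega> \<in> D")
          case True
          have top: "filterlim (\<lambda>t. I_lim t \<omega>) at_top sequentially"
            unfolding filterlim_at_top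
          proof
            fix B :: real
            obtain t where "real (nat \<lceil>B\<rceil>) \<le> I_lim t \<omega>" using True unfolding D_def by blast
            then have "B \<le> I_lim t \<omega>" by linarith
            then show "\<forall>\<^sub>F t in sequentially. B \<le> I_lim t \<omega>"
              using mono by (intro eventually_sequentiallyI[of t]) (meson order_trans)
          qed
          have "filterlim (\<lambda>t. (s^2 / 2) * (I_lim t \<omega> * I_lim t \<omega>)) at_top sequentially"
            using s by (intro filterlim_tendsto_pos_mult_at_top[OF tendsto_const] filterlim_at_top_mult_at_top top) auto
          then have "filterlim (\<lambda>t. - ((s^2 / 2) * (I_lim t \<omega> * I_lim t \<omega>))) at_bot sequentially"
            by (simp add: filterlim_uminus_at_bot)
          from filterlim_compose[OF exp_at_bot this] show ?thesis
            using True by (simp add: power_mult_distrib power2_eq_square mult_ac)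
        qed simp
      qed
    qed (auto simp: indicator_def)
    have "(LINT \<omega>|M. ?E t \<omega>) \<le> (1 - prob D) + (LINT \<omega>|M. ?E t \<omega> * indicator D \<omega>)" for t
    proof -
      have iED: "integrable M (\<lambda>\<omega>. ?E t \<omega> * indicator D \<omega>)" by (rule integrable_const_bound[where B=1]) (auto simp: indicator_def)
      have iD: "integrable M (\<lambda>\<omega>. 1 - indicator D \<omega> :: real)" by (rule integrable_const_bound[where B=1]) (auto simp: indicator_def)
      have "(LINT \<omega>|M. ?E t \<omega>) \<le> (LINT \<omega>|M. (1 - indicator D \<omega>) + ?E t \<omega> * indicator D \<omega>)"
        by (rule integral_mono[OF iE Bochner_Integration.integrable_add[OF iD iED]]) (auto simp: indicator_def)
      also have "\<dots> = (LINT \<omega>|M. 1 - indicator D \<omega>) + (LINT \<omega>|M. ?E t \<omega> * indicator D \<omega>)"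
        by (rule Bochner_Integration.integral_add[OF iD iED])
      also have "(LINT \<omega>|M. 1 - indicator D \<omega>) = (LINT \<omega>|M. indicator (space M - D) \<omega>)"
        by (intro Bochner_Integration.integral_cong refl) (simp add: indicator_def)
      also have "\<dots> = prob (space M - D)" by simp
      also have "\<dots> = 1 - prob D" by (rule prob_compl) (rule D)
      finally show ?thesis .
    qed
    moreover have "(\<lambda>t. LINT \<omega>|M. ?E t \<omega>) \<longlonglongrightarrow> Re (CLINT \<xi>|std_normal_distribution. \<phi> (\<xi> * s))"
      using tendsto_Re[OF lim] unfolding eq by simp
    moreover have "(\<lambda>t. (1 - prob D) + (LINT \<omega>|M. ?E t \<omega> * indicator D \<omega>)) \<longlonglongrightarrow> (1 - prob D) + 0"
      using Dlim by (intro tendsto_add tendsto_const) simp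
    ultimately show ?thesis by (intro LIMSEQ_le[where Y="\<lambda>t. (1 - prob D) + (LINT \<omega>|M. ?E t \<omega> * indicator D \<omega>)"]) auto
  qed
  have "(\<lambda>n. CLINT \<xi>|std_normal_distribution. \<phi> (\<xi> * inverse (real (Suc n)))) \<longlonglongrightarrow> (CLINT \<xi>|std_normal_distribution. 1)"
  proof (rule integral_dominated_convergence[where w="\<lambda>_. 1"])
    show "AE \<xi> in std_normal_distribution. (\<lambda>n. \<phi> (\<xi> * inverse (real (Suc n)))) \<longlonglongrightarrow> 1"
      by (intro AE_I2 \<phi>_tendsto_one tendsto_mult_right_zero LIMSEQ_inverse_real_of_nat)
  qed (auto simp: norm_\<phi>_le)
  from tendsto_Re[OF this] have "(\<lambda>n. Re (CLINT \<xi>|std_normal_distribution. \<phi> (\<xi> * inverse (real (Suc n))))) \<longlonglongrightarrow> 1" by simp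
  then have "1 \<le> 1 - prob D"
    by (rule LIMSEQ_le_const2) (use key in auto)
  then have "prob D = 0" using measure_nonneg[of M D] by linarith
  then have "AE \<omega> in M. \<not> (\<forall>B::nat. \<exists>t. real B \<le> I_lim t \<omega>)"
    unfolding D_def by (subst (asm) prob_eq_0) auto
  then show ?thesis by eventually_elim (auto simp: not_le)
qed

lemma mu_law:
  shows "real_distribution (mu c M N L)" "char (mu c M N L) z = \<phi> z"
proof -
  define X where "X \<omega> = lim (\<lambda>t. I_lim t \<omega>)" for \<omega>
  have X_meas[measurable]: "X \<in> borel_measurable M" unfolding X_def by measurable
  have AE_X: "AE \<omega> in M. (\<lambda>t. I_lim t \<omega>) \<longlonglongrightarrow> X \<omega> \<and> Lim at_top (\<lambda>t. exp_integral c N L t \<omega>) = X \<omega>"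
    using AE_I_lim AE_I_lim_bounded
  proof eventually_elim
    case (elim \<omega>)
    interpret counting_path "\<lambda>t. N t \<omega>" "\<lambda>t. L t \<omega>" using elim by simp
    have mono: "incseq (\<lambda>t. I_lim t \<omega>)"
      using elim(1) path_integral_mono[OF c] by (auto simp: incseq_def)
    obtain B :: nat where "\<forall>t. I_lim t \<omega> < real B" using elim(2) by blast
    then obtain l where l: "(\<lambda>t. I_lim t \<omega>) \<longlonglongrightarrow> l"
      using incseq_convergent[OF mono, of "real B"] by (meson less_imp_le)
    then have X: "X \<omega> = l" unfolding X_def by (rule limI)
    have "exp_integral c N L t \<omega> = path_integral (\<lambda>t. N t \<omega>) (\<lambda>t. L t \<omega>) c t" for t
      by (simp add: exp_integral_def path_integral_def)
    then have "Lim at_top (\<lambda>t. exp_integral c N L t \<omega>) = l"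
      using path_integral_tendsto[OF c, of l] l elim(1) by simp
    then show ?case using l X by simp
  qed
  have mu_eq: "mu c M N L = distr M borel X"
    unfolding mu_def
  proof (rule distr_completion_AE[OF X_meas])
    show "AE \<omega> in M. Lim at_top (\<lambda>t. exp_integral c N L t \<omega>) = X \<omega>" using AE_X by eventually_elim simp
  qed simp
  show "real_distribution (mu c M N L)" unfolding mu_eq by (rule real_distribution_distr) simp
  have "char (mu c M N L) z = (CLINT \<omega>|M. iexp (z * X \<omega>))"
    unfolding mu_eq char_def by (rule integral_distr) auto
  moreover have "(\<lambda>t. CLINT \<omega>|M. iexp (z * I_lim t \<omega>)) \<longlonglongrightarrow> (CLINT \<omega>|M. iexp (z * X \<omega>))"
  proof (rule integral_dominated_convergence[where w="\<lambda>_. 1"])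
    show "AE \<omega> in M. (\<lambda>t. iexp (z * I_lim t \<omega>)) \<longlonglongrightarrow> iexp (z * X \<omega>)"
      using AE_X by eventually_elim (auto intro!: tendsto_intros)
  qed auto
  ultimately show "char (mu c M N L) z = \<phi> z" using LIMSEQ_unique[OF cf_I_lim_tendsto] by simp
qed

end

section \<open>The Levy measures of the symmetrizations\<close>

text \<open>The coefficients t^m / m of -ln (1 - t e^(iz)), placed at the naturals inside the real
  line so that a dilated measure is a dilated argument. At 0 the value is 0, by
  \<open>x / 0 = 0\<close>.\<close>

definition geom_weight :: "real \<Rightarrow> real \<Rightarrow> real" where
  "geom_weight t x = (if x \<in> \<nat> then t ^ nat \<lfloor>x\<rfloor> / x else 0)"

lemma geom_weight_of_nat: "geom_weight t (real m) = t ^ m / real m"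
  by (simp add: geom_weight_def)

lemma geom_weight_not_nat: "x \<notin> \<nat> \<Longrightarrow> geom_weight t x = 0"
  by (simp add: geom_weight_def)

lemma has_sum_geom_weight_iff:
  fixes f :: "real \<Rightarrow> real"
  assumes s: "s > 0"
  shows "((\<lambda>x. geom_weight t (x * s) * f x) has_sum S) {0<..} \<longleftrightarrow> ((\<lambda>m. t ^ m / real m * f (real m / s)) has_sum S) UNIV"
proof -
  have inj: "inj_on (\<lambda>m. real m / s) {0<..}" using s by (auto simp: inj_on_def)
  have "((\<lambda>x. geom_weight t (x * s) * f x) has_sum S) {0<..}
      \<longleftrightarrow> ((\<lambda>x. geom_weight t (x * s) * f x) has_sum S) ((\<lambda>m. real m / s) ` {0<..})"
  proof (rule has_sum_cong_neutral)
    fix x assume x: "x \<in> {0<..} - (\<lambda>m. real m / s) ` {0<..}"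
    have "x * s \<notin> \<nat>"
    proof
      assume "x * s \<in> \<nat>"
      then obtain m where m: "x * s = real m" by (auto elim: Nats_cases)
      then have "x = real m / s" using s by (simp add: field_simps)
      moreover have "m > 0" using m x s by (cases "m = 0") auto
      ultimately show False using x by auto
    qed
    then show "geom_weight t (x * s) * f x = 0" by (simp add: geom_weight_not_nat)
  qed (use s in auto)
  also have "\<dots> \<longleftrightarrow> ((\<lambda>m. geom_weight t (real m / s * s) * f (real m / s)) has_sum S) {0<..}"
    by (subst has_sum_reindex[OF inj]) (simp add: o_def)
  also have "\<dots> \<longleftrightarrow> ((\<lambda>m. t ^ m / real m * f (real m / s)) has_sum S) UNIV"
    using s by (intro has_sum_cong_neutral) (auto simp: geom_weight_of_nat)
  finally show ?thesis .
qed

lemma ln_cmod_one_minus_series: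
  assumes t: "\<bar>t\<bar> < 1"
  shows "(\<lambda>m. t ^ m / real m * cos (real m * y)) sums - ln (cmod (1 - complex_of_real t * iexp y))"
proof -
  let ?z = "- (complex_of_real t * iexp y)"
  have z: "cmod ?z < 1" using t by (simp add: norm_mult)
  have nz: "1 + ?z \<noteq> 0"
  proof
    assume "1 + ?z = 0"
    then have "?z = - 1" by (simp add: eq_neg_iff_add_eq_0 add.commute)
    then show False using z by simp
  qed
  have "(\<lambda>n. Re (- ((- ?z) ^ n) / of_nat n)) sums Re (ln (1 + ?z))"
    using Ln_series'[OF z] by (rule sums_Re)
  moreover {
  have "Re (- ((- ?z) ^ n) / of_nat n) = - (t ^ n / real n * cos (real n * y))" for n
  proof -
    have "(- ?z) ^ n = complex_of_real (t ^ n) * iexp (real n * y)"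
      by (simp add: power_mult_distrib exp_of_nat_mult[symmetric] mult_ac)
    then have "Re ((- ?z) ^ n) = t ^ n * cos (real n * y)" by (simp add: Re_exp)
    then show ?thesis by (simp add: Re_divide_of_nat)
  qed
  then have "(\<lambda>n. Re (- ((- ?z) ^ n) / of_nat n)) = (\<lambda>n. - (t ^ n / real n * cos (real n * y)))" by (rule ext)
  }
  moreover have "Re (ln (1 + ?z)) = ln (cmod (1 - complex_of_real t * iexp y))"
    using Re_Ln[OF nz] by simp
  ultimately have "(\<lambda>n. - (t ^ n / real n * cos (real n * y))) sums ln (cmod (1 - complex_of_real t * iexp y))"
    by (simp only:)
  from sums_minus[OF this] show ?thesis by simp
qed

lemma summable_power_div:
  assumes t: "\<bar>t\<bar> < (1::real)"
  shows "summable (\<lambda>m. \<bar>t ^ m / real m\<bar>)"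
proof (rule summable_comparison_test)
  show "summable (\<lambda>m. \<bar>t\<bar> ^ m)" using t by (intro summable_geometric) auto
  have "\<bar>t ^ m / real m\<bar> \<le> \<bar>t\<bar> ^ m" for m
    by (cases "m = 0") (auto simp: abs_divide power_abs divide_le_eq mult_le_cancel_left1)
  then show "\<exists>N. \<forall>n\<ge>N. norm \<bar>t ^ n / real n\<bar> \<le> \<bar>t\<bar> ^ n" by auto
qed

text \<open>The part with the cosine sums to -2 ln |1 - t e^(iz/s)| by the logarithm series; the
  part with -1 is the same series at z = 0 with opposite sign, which gives 2 ln (1 - t).\<close>

lemma geom_weight_exponent:
  assumes t: "\<bar>t\<bar> < 1" and s: "s > 0"
  shows "((\<lambda>x. 2 * geom_weight t (x * s) * (cos (x * z) - 1)) has_sum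
      (2 * ln (1 - t) - 2 * ln (cmod (1 - complex_of_real t * iexp (z / s))))) {0<..}"
proof -
  let ?y = "z / s"
  have "(\<lambda>m. 2 * (t ^ m / real m * cos (real m * ?y)) - 2 * (t ^ m / real m * cos (real m * 0)))
     sums (2 * - ln (cmod (1 - complex_of_real t * iexp ?y)) - 2 * - ln (cmod (1 - complex_of_real t * iexp 0)))"
    by (intro sums_diff sums_mult ln_cmod_one_minus_series t)
  moreover have c0: "cmod (1 - complex_of_real t * iexp 0) = 1 - t"
  proof -
    have "1 - complex_of_real t * iexp 0 = complex_of_real (1 - t)" by simp
    then show ?thesis using t by (simp only: norm_of_real)
  qed
  moreover have "2 * (t ^ m / real m * cos (real m * ?y)) - 2 * (t ^ m / real m * cos (real m * 0))
      = t ^ m / real m * (2 * (cos (real m / s * z) - 1))" for m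
    by (simp add: algebra_simps)
  moreover have "2 * - A - 2 * - B = 2 * B - 2 * A" for A B :: real by simp
  ultimately have sums: "(\<lambda>m. t ^ m / real m * (2 * (cos (real m / s * z) - 1)))
     sums (2 * ln (1 - t) - 2 * ln (cmod (1 - complex_of_real t * iexp ?y)))"
    by (simp only:)
  have "((\<lambda>m. t ^ m / real m * (2 * (cos (real m / s * z) - 1))) has_sum
      (2 * ln (1 - t) - 2 * ln (cmod (1 - complex_of_real t * iexp ?y)))) UNIV"
  proof (rule norm_summable_imp_has_sum[OF _ sums], rule summable_comparison_test)
    show "summable (\<lambda>m. \<bar>t ^ m / real m\<bar> * 4)" by (intro summable_mult2 summable_power_div t)
    have "norm (norm (t ^ m / real m * (2 * (cos (real m / s * z) - 1)))) \<le> \<bar>t ^ m / real m\<bar> * 4" for m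
    proof -
      have "\<bar>2 * (cos (real m / s * z) - 1)\<bar> \<le> 4"
        using cos_ge_minus_one[of "real m / s * z"] cos_le_one[of "real m / s * z"]
        unfolding abs_le_iff by (intro conjI) argo+
      from mult_left_mono[OF this abs_ge_zero[of "t ^ m / real m"]] show ?thesis
        by (simp only: real_norm_def abs_abs abs_mult)
    qed
    then show "\<exists>N. \<forall>n\<ge>N. norm (norm (t ^ n / real n * (2 * (cos (real n / s * z) - 1)))) \<le> \<bar>t ^ n / real n\<bar> * 4" by blast
  qed
  moreover have "geom_weight t (x * s) * (2 * (cos (x * z) - 1)) = 2 * geom_weight t (x * s) * (cos (x * z) - 1)" for x
    by simp
  ultimately show ?thesis
    using has_sum_geom_weight_iff[OF s, of t "\<lambda>x. 2 * (cos (x * z) - 1)"] by (simp only:)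
qed

lemma summable_on_geom_weight:
  assumes t: "\<bar>t\<bar> < 1" and s: "s > 0"
  shows "(\<lambda>x. \<bar>geom_weight t (x * s)\<bar> * x^2) summable_on {0<..}"
proof -
  have abs: "\<bar>geom_weight t y\<bar> = geom_weight \<bar>t\<bar> y" if "y \<ge> 0" for y
    using that by (simp add: geom_weight_def abs_divide power_abs)
  have "summable (\<lambda>m. of_nat m * \<bar>t\<bar> ^ m)"
  proof (rule summable_comparison_test)
    show "summable (\<lambda>m. of_nat (Suc m) * \<bar>t\<bar> ^ m)"
      using geometric_deriv_sums[of "\<bar>t\<bar>"] t by (auto intro: sums_summable)
    show "\<exists>N. \<forall>n\<ge>N. norm (real n * \<bar>t\<bar> ^ n) \<le> real (Suc n) * \<bar>t\<bar> ^ n"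
      by (auto intro!: mult_right_mono)
  qed
  then have "summable (\<lambda>m. norm (\<bar>t\<bar> ^ m / real m * (real m / s)^2))"
  proof (rule summable_comparison_test[OF _ summable_mult2[of _ "1 / s^2"], rotated])
    have "\<bar>t\<bar> ^ m / real m * (real m / s)^2 = real m * \<bar>t\<bar> ^ m * (1 / s^2)" for m
      by (cases "m = 0") (auto simp: power_divide power2_eq_square)
    then show "\<exists>N. \<forall>n\<ge>N. norm (norm (\<bar>t\<bar> ^ n / real n * (real n / s)^2)) \<le> of_nat n * \<bar>t\<bar> ^ n * (1 / s^2)"
      by auto
  qed
  then have "(\<lambda>m. \<bar>t\<bar> ^ m / real m * (real m / s)^2) summable_on UNIV"
    by (rule norm_summable_imp_summable_on)
  then obtain S where "((\<lambda>m. \<bar>t\<bar> ^ m / real m * (real m / s)^2) has_sum S) UNIV" by (auto simp: summable_on_def)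
  then have "((\<lambda>x. geom_weight \<bar>t\<bar> (x * s) * x^2) has_sum S) {0<..}"
    using has_sum_geom_weight_iff[OF s, of "\<bar>t\<bar>" "\<lambda>x. x^2"] by simp
  then have "(\<lambda>x. geom_weight \<bar>t\<bar> (x * s) * x^2) summable_on {0<..}" by (auto simp: summable_on_def)
  then show ?thesis
    by (rule summable_on_cong[THEN iffD1, rotated]) (use abs s in auto)
qed

text \<open>The masses of the Levy measures of the two symmetrizations: \<open>rho_weight q a s x\<close> is the mass
  at \<open>x\<close> for \<open>\<rho>\<close>, where \<open>s = c^k\<close>, \<open>a = min (r/p) (p/r)\<close>, and \<open>mu_weight q a s c x\<close> the one
  for \<open>\<mu>\<close>.\<close>

definition rho_weight :: "real \<Rightarrow> real \<Rightarrow> real \<Rightarrow> real \<Rightarrow> real" where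
  "rho_weight q a s x = geom_weight q x - geom_weight (- a) (x * s)"

definition mu_weight :: "real \<Rightarrow> real \<Rightarrow> real \<Rightarrow> real \<Rightarrow> real \<Rightarrow> real" where
  "mu_weight q a s c x = (\<Sum>\<^sub>\<infinity>n. rho_weight q a s (x * c ^ n))"

context
  fixes q a s c :: real
  assumes q: "0 \<le> q" "q < 1" and a: "0 < a" "a < 1" and s: "s > 0" and c: "c > 1"
begin

lemma summable_on_rho_weight: "(\<lambda>x. \<bar>rho_weight q a s x\<bar> * x^2) summable_on {0<..}"
proof (rule Infinite_Sum.summable_on_comparison_test)
  show "(\<lambda>x. \<bar>geom_weight q (x * 1)\<bar> * x^2 + \<bar>geom_weight (- a) (x * s)\<bar> * x^2) summable_on {0<..}"
    using q a s by (intro summable_on_add summable_on_geom_weight) auto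
  show "\<bar>rho_weight q a s x\<bar> * x^2 \<le> \<bar>geom_weight q (x * 1)\<bar> * x^2 + \<bar>geom_weight (- a) (x * s)\<bar> * x^2" for x
    unfolding ring_distribs[symmetric] by (intro mult_right_mono) (auto simp: rho_weight_def)
qed auto

lemma cos_exponent_rho_weight:
  "cos_exponent (rho_weight q a s) z = 2 * ln (1 - q) - 2 * ln (cmod (1 - complex_of_real q * iexp z))
    - (2 * ln (1 + a) - 2 * ln (cmod (1 + complex_of_real a * iexp (z / s))))"
proof -
  have "((\<lambda>x. 2 * geom_weight q (x * 1) * (cos (x * z) - 1) + - (2 * geom_weight (- a) (x * s) * (cos (x * z) - 1))) has_sum
     ((2 * ln (1 - q) - 2 * ln (cmod (1 - complex_of_real q * iexp (z / 1))))
      + - (2 * ln (1 - - a) - 2 * ln (cmod (1 - complex_of_real (- a) * iexp (z / s)))))) {0<..}"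
    using q a s by (intro has_sum_add has_sum_uminusI geom_weight_exponent) auto
  then show ?thesis
    unfolding cos_exponent_def rho_weight_def by (intro infsumI) (simp add: algebra_simps)
qed

text \<open>Substituting x / c^n for x makes the total of row n equal to c^(-2n) times that of row
  0. Absolute summability of the double family permits summing over n first, into the masses of a
  single measure.\<close>

lemma summable_on_rho_weight_prod:
  "(\<lambda>(n, x). \<bar>rho_weight q a s (x * c ^ n)\<bar> * x^2) summable_on UNIV \<times> {0<..}"
proof (rule summable_on_SigmaI)
  let ?Q = "\<Sum>\<^sub>\<infinity>x\<in>{0<..}. \<bar>rho_weight q a s x\<bar> * x^2"
  fix n :: nat
  have "((\<lambda>x. \<bar>rho_weight q a s x\<bar> * (x / c ^ n)^2) has_sum (?Q * ((1 / c^2) ^ n))) {0<..}"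
    using has_sum_cmult_left[OF has_sum_infsum[OF summable_on_rho_weight], of "(1 / c^2) ^ n"]
    by (simp add: power_divide power_mult[symmetric] mult.commute)
  moreover have "((\<lambda>x. \<bar>rho_weight q a s (x * c ^ n)\<bar> * x^2) has_sum S) {0<..} \<longleftrightarrow>
      ((\<lambda>x. \<bar>rho_weight q a s x\<bar> * (x / c ^ n)^2) has_sum S) {0<..}" for S
    using c by (intro has_sum_reindex_bij_witness[of _ "\<lambda>x. x / c ^ n" "\<lambda>x. x * c ^ n"]) auto
  ultimately show "((\<lambda>x. case (n, x) of (n, x) \<Rightarrow> \<bar>rho_weight q a s (x * c ^ n)\<bar> * x^2) has_sum (?Q * ((1 / c^2) ^ n))) {0<..}"
    by simp
next
  let ?Q = "\<Sum>\<^sub>\<infinity>x\<in>{0<..}. \<bar>rho_weight q a s x\<bar> * x^2"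
  have "summable (\<lambda>n. norm (?Q * ((1 / c^2) ^ n)))"
    unfolding norm_mult norm_power using c
    by (intro summable_mult summable_geometric) (auto simp: one_less_power)
  then show "(\<lambda>n. ?Q * ((1 / c^2) ^ n)) summable_on UNIV" by (rule norm_summable_imp_summable_on)
qed auto

lemma summable_on_rho_weight_orbit:
  assumes "x > 0" shows "(\<lambda>n. \<bar>rho_weight q a s (x * c ^ n)\<bar>) summable_on UNIV"
proof -
  have "(\<lambda>(x, n). \<bar>rho_weight q a s (x * c ^ n)\<bar> * x^2) summable_on {0<..} \<times> UNIV"
    using summable_on_rho_weight_prod by (subst (asm) summable_on_swap) simp
  from summable_on_SigmaD1[OF this, of x] assms
  have "(\<lambda>n. \<bar>rho_weight q a s (x * c ^ n)\<bar> * x^2) summable_on UNIV" by simp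
  from summable_on_cmult_left[OF this, of "1 / x^2"] assms show ?thesis by simp
qed

lemma has_sum_mu_weight:
  assumes "x > 0" shows "((\<lambda>n. rho_weight q a s (x * c ^ n)) has_sum mu_weight q a s c x) UNIV"
proof -
  have "(\<lambda>n. rho_weight q a s (x * c ^ n)) summable_on UNIV"
    by (rule abs_summable_summable) (use summable_on_rho_weight_orbit[OF assms] in simp)
  then show ?thesis unfolding mu_weight_def by (rule has_sum_infsum)
qed

lemma mu_weight_sums:
  assumes "x > 0" shows "(\<lambda>n. rho_weight q a s (x * c ^ n)) sums mu_weight q a s c x"
  using has_sum_mu_weight[OF assms] by (rule has_sum_imp_sums)

lemma summable_on_mu_weight: "(\<lambda>x. \<bar>mu_weight q a s c x\<bar> * x^2) summable_on {0<..}"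
proof (rule Infinite_Sum.summable_on_comparison_test)
  have "(\<lambda>(x, n). \<bar>rho_weight q a s (x * c ^ n)\<bar> * x^2) summable_on {0<..} \<times> UNIV"
    using summable_on_rho_weight_prod by (subst (asm) summable_on_swap) simp
  from summable_on_Sigma_banach[OF this]
  show "(\<lambda>x. \<Sum>\<^sub>\<infinity>n. \<bar>rho_weight q a s (x * c ^ n)\<bar> * x^2) summable_on {0<..}" by simp
  fix x :: real assume x: "x \<in> {0<..}"
  then have so: "(\<lambda>n. \<bar>rho_weight q a s (x * c ^ n)\<bar>) summable_on UNIV" by (intro summable_on_rho_weight_orbit) auto
  have "\<bar>mu_weight q a s c x\<bar> \<le> (\<Sum>\<^sub>\<infinity>n. \<bar>rho_weight q a s (x * c ^ n)\<bar>)"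
    unfolding mu_weight_def using norm_infsum_bound[of "\<lambda>n. rho_weight q a s (x * c ^ n)" UNIV] so by simp
  then have "\<bar>mu_weight q a s c x\<bar> * x^2 \<le> (\<Sum>\<^sub>\<infinity>n. \<bar>rho_weight q a s (x * c ^ n)\<bar>) * x^2"
    by (rule mult_right_mono) simp
  also have "\<dots> = (\<Sum>\<^sub>\<infinity>n. \<bar>rho_weight q a s (x * c ^ n)\<bar> * x^2)" by (rule infsum_cmult_left'[symmetric])
  finally show "\<bar>mu_weight q a s c x\<bar> * x^2 \<le> (\<Sum>\<^sub>\<infinity>n. \<bar>rho_weight q a s (x * c ^ n)\<bar> * x^2)" .
qed auto

lemma cos_exponent_mu_weight:
  "(\<lambda>n. cos_exponent (rho_weight q a s) (z / c ^ n)) sums cos_exponent (mu_weight q a s c) z"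
proof -
  let ?f = "\<lambda>n x. 2 * rho_weight q a s (x * c ^ n) * (cos (x * z) - 1)"
  have "(\<lambda>p. norm ((\<lambda>(n, x). ?f n x) p)) summable_on UNIV \<times> {0<..}"
  proof (rule Infinite_Sum.abs_summable_on_comparison_test')
    show "(\<lambda>p. z^2 * (case p of (n, x) \<Rightarrow> \<bar>rho_weight q a s (x * c ^ n)\<bar> * x^2)) summable_on UNIV \<times> {0<..}"
      by (intro summable_on_cmult_right summable_on_rho_weight_prod)
    fix p :: "nat \<times> real"
    obtain n x where p: "p = (n, x)" by (cases p)
    show "norm ((\<lambda>(n, x). ?f n x) p) \<le> z^2 * (case p of (n, x) \<Rightarrow> \<bar>rho_weight q a s (x * c ^ n)\<bar> * x^2)"
      unfolding p using cos_term_bound[of "\<lambda>x. rho_weight q a s (x * c ^ n)" x z] by simp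
  qed
  then have sm: "(\<lambda>(n, x). ?f n x) summable_on UNIV \<times> {0<..}" by (rule abs_summable_summable)
  then obtain S where S: "((\<lambda>(n, x). ?f n x) has_sum S) (UNIV \<times> {0<..})" by (auto simp: summable_on_def)
  have "((\<lambda>n. cos_exponent (rho_weight q a s) (z / c ^ n)) has_sum S) UNIV"
  proof (rule has_sum_SigmaD[OF S])
    fix n :: nat
    have "((\<lambda>x. 2 * rho_weight q a s x * (cos (x * (z / c ^ n)) - 1)) has_sum cos_exponent (rho_weight q a s) (z / c ^ n)) {0<..}"
      unfolding cos_exponent_def by (intro has_sum_infsum cos_terms_summable summable_on_rho_weight)
    also have "?this \<longleftrightarrow> ((\<lambda>x. ?f n x) has_sum cos_exponent (rho_weight q a s) (z / c ^ n)) {0<..}"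
      using c by (intro has_sum_reindex_bij_witness[of _ "\<lambda>x. x * c ^ n" "\<lambda>x. x / c ^ n"]) auto
    finally show "((\<lambda>x. case (n, x) of (n, x) \<Rightarrow> ?f n x) has_sum cos_exponent (rho_weight q a s) (z / c ^ n)) {0<..}"
      by simp
  qed
  then have "(\<lambda>n. cos_exponent (rho_weight q a s) (z / c ^ n)) sums S" by (rule has_sum_imp_sums)
  moreover have "((\<lambda>x. 2 * mu_weight q a s c x * (cos (x * z) - 1)) has_sum S) {0<..}"
  proof (rule has_sum_SigmaD)
    show "((\<lambda>(x, n). ?f n x) has_sum S) ({0<..} \<times> UNIV)" using S by (subst (asm) has_sum_swap) simp
    fix x :: real assume "x \<in> {0<..}"
    then have "((\<lambda>n. rho_weight q a s (x * c ^ n) * (2 * (cos (x * z) - 1))) has_sum mu_weight q a s c x * (2 * (cos (x * z) - 1))) UNIV"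
      by (intro has_sum_cmult_left has_sum_mu_weight) auto
    moreover have "y * (2 * (cos (x * z) - 1)) = 2 * y * (cos (x * z) - 1)" for y by simp
    ultimately show "((\<lambda>n. case (x, n) of (x, n) \<Rightarrow> ?f n x) has_sum 2 * mu_weight q a s c x * (cos (x * z) - 1)) UNIV"
      by (simp only: prod.case)
  qed
  then have "cos_exponent (mu_weight q a s c) z = S" unfolding cos_exponent_def by (rule infsumI)
  ultimately show ?thesis by simp
qed

end

text \<open>Multiplying p + r e^(iy) by e^(-iy) and conjugating exchanges p and r without changing
  the modulus. Hence only the smaller of the two ratios enters; it is below 1 when p and r differ,
  so that the logarithm series applies.\<close>

lemma cmod_add_iexp_square:
  fixes p r y :: real
  assumes p: "p > 0" and r: "r > 0"
  shows "(cmod (complex_of_real p + complex_of_real r * iexp y))^2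
    = ((p + r) / (1 + min (r / p) (p / r)))^2 * (cmod (1 + complex_of_real (min (r / p) (p / r)) * iexp y))^2"
proof -
  have sq: "(cmod (complex_of_real x + complex_of_real x' * iexp y))^2 = x^2 + x'^2 + 2 * x * x' * cos y" for x x' :: real
  proof -
    have "(cmod (complex_of_real x + complex_of_real x' * iexp y))^2 = (x + x' * cos y)^2 + (x' * sin y)^2"
      by (simp add: cmod_power2 Re_exp Im_exp)
    also have "\<dots> = x^2 + x'^2 * ((sin y)^2 + (cos y)^2) + 2 * x * x' * cos y"
      by algebra
    finally show ?thesis by (simp only: sin_cos_squared_add mult_1_right)
  qed
  have sq1: "(cmod (1 + complex_of_real x' * iexp y))^2 = 1 + x'^2 + 2 * x' * cos y" for x'
    using sq[of 1 x'] by simp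
  show ?thesis
  proof (cases "r \<le> p")
    case True
    then have "r / p \<le> 1" "1 \<le> p / r" using p r by auto
    then have m: "min (r / p) (p / r) = r / p" by linarith
    have e: "(p + r) / (1 + r / p) = p" using p r by (simp add: field_simps)
    show ?thesis unfolding m e sq sq1 using p by (simp add: field_simps power2_eq_square)
  next
    case False
    then have "p / r \<le> 1" "1 \<le> r / p" using p r by auto
    then have m: "min (r / p) (p / r) = p / r" by linarith
    have e: "(p + r) / (1 + p / r) = r" using p r by (simp add: field_simps)
    show ?thesis unfolding m e sq sq1 using r by (simp add: field_simps power2_eq_square)
  qed
qed

section \<open>Signs of the masses\<close>

lemma geom_weight_nonneg: "0 \<le> t \<Longrightarrow> 0 < x \<Longrightarrow> 0 \<le> geom_weight t x"
  by (simp add: geom_weight_def)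

lemma geom_weight_mono: "0 \<le> t \<Longrightarrow> t \<le> t' \<Longrightarrow> 0 < x \<Longrightarrow> geom_weight t x \<le> geom_weight t' x"
  by (auto simp: geom_weight_def intro!: divide_right_mono power_mono)

lemma abs_geom_weight: "0 < x \<Longrightarrow> \<bar>geom_weight t x\<bar> = geom_weight \<bar>t\<bar> x"
  by (simp add: geom_weight_def abs_divide power_abs)

lemma geom_weight_uminus_le: "0 \<le> t \<Longrightarrow> 0 < x \<Longrightarrow> geom_weight (- t) x \<le> geom_weight t x"
  using abs_ge_self[of "geom_weight (- t) x"] by (simp add: abs_geom_weight)

lemma geom_weight_uminus_even: "geom_weight (- t) (real (2 * j)) = t ^ (2 * j) / real (2 * j)"
  by (simp only: geom_weight_of_nat power_minus_even even_mult_iff even_numeral simp_thms)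

lemma geom_weight_uminus_odd: "odd m \<Longrightarrow> geom_weight (- t) (real m) = - (t ^ m / real m)"
  by (simp add: geom_weight_of_nat)

lemma geom_weight_uminus_nonpos:
  assumes "0 \<le> t" "0 < x" "\<And>j. x \<noteq> real (2 * j)" shows "geom_weight (- t) x \<le> 0"
proof (cases "x \<in> \<nat>")
  case True
  then obtain m where m: "x = real m" by (auto elim: Nats_cases)
  have "odd m"
  proof
    assume "even m"
    then obtain j where "m = 2 * j" by blast
    then show False using assms(3)[of j] m by simp
  qed
  then show ?thesis using assms(1) by (simp add: m geom_weight_uminus_odd)
qed (simp add: geom_weight_not_nat)

lemma geom_weight_le_inverse: "0 \<le> t \<Longrightarrow> t \<le> 1 \<Longrightarrow> 0 < x \<Longrightarrow> geom_weight t x \<le> 1 / x"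
  by (auto simp: geom_weight_def intro!: divide_right_mono power_le_one)

text \<open>A fixed factor \<open>K\<close> disappears on taking j-th roots for large j.\<close>

lemma power_half_bound:
  fixes x y K :: real
  assumes "0 \<le> x" "0 < y" "0 < K" "\<And>j::nat. j \<ge> 1 \<Longrightarrow> K * y ^ j \<le> x ^ j"
  shows "y \<le> x"
proof (rule ccontr)
  assume "\<not> y \<le> x"
  then have "(\<lambda>j. (x / y) ^ j) \<longlonglongrightarrow> 0" using assms by (intro LIMSEQ_realpow_zero) auto
  then have "\<forall>\<^sub>F j in sequentially. (x / y) ^ j < K" using assms by (intro order_tendstoD)
  then obtain j :: nat where "j \<ge> 1" "(x / y) ^ j < K"
    by (metis eventually_sequentially le_add1 le_add2 nle_le)
  then show False using assms(4)[of j] assms(2) by (simp add: power_divide field_simps)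
qed

section \<open>Signs of the masses for \<rho>\<close>

context
  fixes q a :: real
  assumes q: "0 \<le> q" "q < 1" and a: "0 < a" "a < 1"
begin

text \<open>The point 2 decides: it is the first natural with a negative contribution, and a \<le> q
  makes the positive part dominate everywhere.\<close>

lemma rho_weight_nonneg_iff_one: "(\<forall>x>0. 0 \<le> rho_weight q a 1 x) \<longleftrightarrow> a \<le> q"
proof
  assume "\<forall>x>0. 0 \<le> rho_weight q a 1 x"
  then have "0 \<le> rho_weight q a 1 (real 2)" by auto
  then have "a ^ 2 \<le> q ^ 2"
    using geom_weight_uminus_even[of a 1] by (simp add: rho_weight_def geom_weight_of_nat del: of_nat_numeral)
  then show "a \<le> q" using q by (simp add: power2_le_iff_abs_le)
next
  assume "a \<le> q"
  show "\<forall>x>0. 0 \<le> rho_weight q a 1 x"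
  proof (intro allI impI)
    fix x :: real assume "x > 0"
    then have "geom_weight (- a) x \<le> geom_weight q x"
      using geom_weight_uminus_le[of a x] geom_weight_mono[of a q x] a \<open>a \<le> q\<close> by linarith
    then show "0 \<le> rho_weight q a 1 x" by (simp add: rho_weight_def)
  qed
qed

text \<open>The even point 2 j with value a^(2j) / (2j) is matched with j, whose mass is q^j / j, so
  a^2 \<le> q suffices with a factor 2 to spare; odd and non-integral points contribute nothing
  positive on the left.\<close>

lemma geom_weight_double_le:
  assumes "a^2 \<le> q" "x > 0" shows "geom_weight (- a) (2 * x) \<le> geom_weight q x"
proof (cases "\<exists>j. 2 * x = real (2 * j)")
  case True
  then obtain j where j: "2 * x = real (2 * j)" by blast
  then have x: "x = real j" by simp
  have "a ^ (2 * j) \<le> q ^ j" unfolding power_mult using assms by (intro power_mono) auto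
  moreover have "q ^ j \<le> 2 * q ^ j" using q by simp
  ultimately have "a ^ (2 * j) \<le> 2 * q ^ j" by linarith
  moreover have "j > 0" using assms(2) x by simp
  ultimately have "a ^ (2 * j) / real (2 * j) \<le> q ^ j / real j" by (simp add: field_simps)
  then show ?thesis unfolding j geom_weight_uminus_even by (simp add: x geom_weight_of_nat)
next
  case False
  then have "geom_weight (- a) (2 * x) \<le> 0" using a assms by (intro geom_weight_uminus_nonpos) auto
  also have "0 \<le> geom_weight q x" using q assms by (intro geom_weight_nonneg)
  finally show ?thesis .
qed

text \<open>The negative mass at 2 / s must meet a natural below 2, which forces s = 2. All even
  points are then used for a^2 \<le> q, since each single one gives it only up to the factor
  2.\<close>

lemma rho_weight_nonneg_iff_gt_one:
  assumes s: "s > 1" shows "(\<forall>x>0. 0 \<le> rho_weight q a s x) \<longleftrightarrow> s = 2 \<and> a^2 \<le> q"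
proof
  assume nn: "\<forall>x>0. 0 \<le> rho_weight q a s x"
  have le: "a ^ (2 * j) / real (2 * j) \<le> geom_weight q (real (2 * j) / s)" if "j \<ge> 1" for j
  proof -
    have "0 \<le> rho_weight q a s (real (2 * j) / s)" using nn that s by auto
    then show ?thesis using s geom_weight_uminus_even[of a j] by (simp add: rho_weight_def)
  qed
  have "s = 2"
  proof -
    have "0 < a ^ (2 * 1) / real (2 * 1)" using a by simp
    then have "geom_weight q (real (2 * 1) / s) \<noteq> 0" using le[of 1] by linarith
    then have "2 / s \<in> \<nat>" using geom_weight_not_nat[of "2 / s" q] by auto
    then obtain n where n: "2 / s = real n" by (auto elim: Nats_cases)
    have "0 < 2 / s" "2 / s < 2" using s by (auto simp: divide_less_eq)
    then have "n = 1" using n by simp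
    then show ?thesis using n s by (simp add: field_simps)
  qed
  moreover have "a^2 \<le> q"
  proof (rule power_half_bound[of _ _ "1/2"])
    fix j :: nat assume "j \<ge> 1"
    have "real (2 * j) / s = real j" using \<open>s = 2\<close> by simp
    then have "a ^ (2 * j) / real (2 * j) \<le> q ^ j / real j"
      using le[OF \<open>j \<ge> 1\<close>] by (simp only: geom_weight_of_nat)
    then have "a ^ (2 * j) \<le> 2 * q ^ j" using \<open>j \<ge> 1\<close> by (simp add: field_simps)
    then show "1 / 2 * (a^2) ^ j \<le> q ^ j" unfolding power_mult by simp
  qed (use q a in auto)
  ultimately show "s = 2 \<and> a^2 \<le> q" by simp
next
  assume "s = 2 \<and> a^2 \<le> q"
  then show "\<forall>x>0. 0 \<le> rho_weight q a s x"
    using geom_weight_double_le by (auto simp: rho_weight_def mult.commute)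
qed

text \<open>The negative mass at 2 \<sigma> must meet a natural l, which gives the inequality. At
  the further points l j it follows by taking j-th powers, because l / 2 = \<sigma> > 1 gives (l /
  2)^j \<ge> l / 2.\<close>

lemma rho_weight_nonneg_iff_lt_one:
  assumes \<sigma>: "\<sigma> > 1"
  shows "(\<forall>x>0. 0 \<le> rho_weight q a (1 / \<sigma>) x) \<longleftrightarrow> (\<exists>l::nat. real l = 2 * \<sigma> \<and> real l / 2 * a^2 \<le> q ^ l)"
proof
  assume "\<forall>x>0. 0 \<le> rho_weight q a (1 / \<sigma>) x"
  then have "0 \<le> rho_weight q a (1 / \<sigma>) (2 * \<sigma>)" using \<sigma> by auto
  then have le: "a ^ 2 / 2 \<le> geom_weight q (2 * \<sigma>)"
    using \<sigma> geom_weight_uminus_even[of a 1] by (simp add: rho_weight_def)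
  moreover have "a^2 / 2 > 0" using a by simp
  ultimately have "geom_weight q (2 * \<sigma>) \<noteq> 0" by linarith
  then have "2 * \<sigma> \<in> \<nat>" using geom_weight_not_nat by blast
  then obtain l where l: "2 * \<sigma> = real l" by (auto elim: Nats_cases)
  have "real l > 0" using l \<sigma> by linarith
  then have "real l / 2 * a^2 \<le> q ^ l" using le unfolding l geom_weight_of_nat by (simp add: field_simps)
  then show "\<exists>l::nat. real l = 2 * \<sigma> \<and> real l / 2 * a^2 \<le> q ^ l" using l by metis
next
  assume "\<exists>l::nat. real l = 2 * \<sigma> \<and> real l / 2 * a^2 \<le> q ^ l"
  then obtain l :: nat where l: "real l = 2 * \<sigma>" "real l / 2 * a^2 \<le> q ^ l" by blast
  show "\<forall>x>0. 0 \<le> rho_weight q a (1 / \<sigma>) x"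
  proof (intro allI impI)
    fix x :: real assume x: "x > 0"
    have "geom_weight (- a) (x / \<sigma>) \<le> geom_weight q x"
    proof (cases "\<exists>j. x / \<sigma> = real (2 * j)")
      case True
      then obtain j where j: "x / \<sigma> = real (2 * j)" by blast
      have "x = real (l * j)" using j l(1) \<sigma> by (simp add: field_simps)
      have j1: "j \<ge> 1" using j x \<sigma> by (cases j) auto
      have "real l / 2 * (a^2) ^ j \<le> (real l / 2) ^ j * (a^2) ^ j"
        using j1 l(1) \<sigma> by (intro mult_right_mono self_le_power) auto
      also have "\<dots> = (real l / 2 * a^2) ^ j" by (rule power_mult_distrib[symmetric])
      also have "\<dots> \<le> (q ^ l) ^ j" using l(2) by (intro power_mono) auto
      finally have "real l / 2 * a ^ (2 * j) \<le> q ^ (l * j)" by (simp add: power_mult)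
      moreover have "real l > 0" using l(1) \<sigma> by linarith
      ultimately have "a ^ (2 * j) / real (2 * j) \<le> q ^ (l * j) / real (l * j)"
        using j1 by (simp add: field_simps)
      moreover have "geom_weight (- a) (x / \<sigma>) = a ^ (2 * j) / real (2 * j)" by (simp only: j geom_weight_uminus_even)
      moreover have "geom_weight q x = q ^ (l * j) / real (l * j)" by (simp only: \<open>x = real (l * j)\<close> geom_weight_of_nat)
      ultimately show ?thesis by simp
    next
      case False
      then have "geom_weight (- a) (x / \<sigma>) \<le> 0" using a x \<sigma> by (intro geom_weight_uminus_nonpos) auto
      also have "0 \<le> geom_weight q x" using q x by (intro geom_weight_nonneg)
      finally show ?thesis .
    qed
    then show "0 \<le> rho_weight q a (1 / \<sigma>) x" by (simp add: rho_weight_def)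
  qed
qed

end

section \<open>Signs of the masses for \<mu>: sums along the orbits y c^n\<close>

definition orbit_sum :: "real \<Rightarrow> real \<Rightarrow> real \<Rightarrow> real" where
  "orbit_sum c t y = (\<Sum>n. geom_weight t (y * c ^ n))"

lemma summable_geom_weight_orbit:
  assumes c: "c > 1" and t: "\<bar>t\<bar> < 1" and y: "y > 0"
  shows "summable (\<lambda>n. geom_weight t (y * c ^ n))"
proof (rule summable_comparison_test)
  show "summable (\<lambda>n. 1 / y * (1 / c) ^ n)" using c by (intro summable_mult summable_geometric) auto
  have "norm (geom_weight t (y * c ^ n)) \<le> 1 / y * (1 / c) ^ n" for n
    using geom_weight_le_inverse[of "\<bar>t\<bar>" "y * c ^ n"] t y c by (simp add: abs_geom_weight power_divide)
  then show "\<exists>N. \<forall>n\<ge>N. norm (geom_weight t (y * c ^ n)) \<le> 1 / y * (1 / c) ^ n" by blast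
qed

lemma orbit_sum_mono:
  assumes c: "c > 1" and t: "\<bar>t\<bar> < 1" "\<bar>t'\<bar> < 1" and y: "y > 0" "y' > 0"
    and le: "\<And>n. geom_weight t (y * c ^ n) \<le> geom_weight t' (y' * c ^ n)"
  shows "orbit_sum c t y \<le> orbit_sum c t' y'"
  unfolding orbit_sum_def using assms by (intro suminf_le summable_geom_weight_orbit) auto

lemma orbit_sum_shift:
  assumes c: "c > 1" and t: "\<bar>t\<bar> < 1" and y: "y > 0"
  shows "orbit_sum c t y = (\<Sum>n<k. geom_weight t (y * c ^ n)) + orbit_sum c t (y * c ^ k)"
  unfolding orbit_sum_def
  using suminf_split_initial_segment[OF summable_geom_weight_orbit[OF assms], of k]
  by (simp add: power_add mult_ac)

lemma orbit_sum_shift_le: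
  assumes c: "c > 1" and t: "0 \<le> t" "t < 1" and y: "y > 0"
  shows "orbit_sum c t (y * c ^ k) \<le> orbit_sum c t y"
proof -
  have "0 \<le> (\<Sum>n<k. geom_weight t (y * c ^ n))" using assms by (intro sum_nonneg geom_weight_nonneg) auto
  then show ?thesis using orbit_sum_shift[of c t y k] assms by simp
qed

lemma mu_weight_orbit_sum:
  assumes q: "0 \<le> q" "q < 1" and a: "0 < a" "a < 1" and s: "s > 0" and c: "c > 1" and x: "x > 0"
  shows "mu_weight q a s c x = orbit_sum c q x - orbit_sum c (- a) (x * s)"
proof -
  have "(\<lambda>n. geom_weight q (x * c ^ n) - geom_weight (- a) (x * s * c ^ n)) sums (orbit_sum c q x - orbit_sum c (- a) (x * s))"
    unfolding orbit_sum_def using assms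
    by (intro sums_diff summable_sums summable_geom_weight_orbit) auto
  then have "(\<lambda>n. rho_weight q a s (x * c ^ n)) sums (orbit_sum c q x - orbit_sum c (- a) (x * s))"
    by (simp add: rho_weight_def mult_ac)
  from sums_unique2[OF mu_weight_sums[OF q a s c x] this] show ?thesis .
qed

text \<open>If 2 j / C = t and 2 j' / C = t' are naturals for different primes j and j', then j t' =
  j' t, so j divides t and 2 = e C with e natural; C > 1 leaves only e = 1 and C = 2. Thus at most
  one prime qualifies.\<close>

lemma finite_primes_with_ratio:
  assumes "C > 1" "C \<noteq> 2" shows "finite {j::nat. prime j \<and> 2 * real j / C \<in> \<nat>}"
proof -
  have "j = j'" if j: "prime j" "2 * real j / C \<in> \<nat>" and j': "prime j'" "2 * real j' / C \<in> \<nat>" for j j'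
  proof (rule ccontr)
    assume "j \<noteq> j'"
    obtain t t' where t: "2 * real j / C = real t" and t': "2 * real j' / C = real t'"
      using j j' by (auto elim!: Nats_cases)
    have "2 * real j = real t * C" "2 * real j' = real t' * C" using t t' assms by (simp_all add: field_simps)
    then have "real j * (real t' * C) = real j' * (real t * C)" by algebra
    then have "real (j * t') = real (j' * t)" using assms by simp
    then have "j dvd j' * t" by (metis dvd_triv_left of_nat_eq_iff)
    moreover have "\<not> j dvd j'" using primes_dvd_imp_eq[OF j(1) j'(1)] \<open>j \<noteq> j'\<close> by blast
    ultimately have "j dvd t" using j(1) by (simp add: prime_dvd_mult_iff)
    then obtain e where e: "t = j * e" by blast
    have "real j > 0" using j(1) prime_gt_0_nat by simp
    then have eC: "2 = real e * C" using t e assms by (simp add: field_simps)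
    have "e \<noteq> 0"
    proof
      assume "e = 0"
      with eC show False by simp
    qed
    moreover have "\<not> e \<ge> 2"
    proof
      assume "e \<ge> 2"
      then have "2 * 1 \<le> real e * 1" by simp
      also have "\<dots> < real e * C" using \<open>e \<noteq> 0\<close> assms by (intro mult_strict_left_mono) auto
      finally show False using eC by simp
    qed
    ultimately have "e = 1" by simp
    then show False using eC assms by simp
  qed
  then show ?thesis
    by (metis (mono_tags, lifting) finite.emptyI finite_insert finite_subset mem_Collect_eq singletonI subsetI empty_iff)
qed

lemma tendsto_linear_powr_zero:
  assumes "0 < a" "a < 1" "0 < b" shows "(\<lambda>j. a powr (real (2 * j) * b)) \<longlonglongrightarrow> 0"
proof -
  have "a powr (real (2 * j) * b) = (a powr (2 * b)) ^ j" for j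
  proof -
    have "(a powr (2 * b)) ^ j = (a powr (2 * b)) powr real j" using assms by (simp add: powr_realpow)
    also have "\<dots> = a powr (2 * b * real j)" by (rule powr_powr)
    finally show ?thesis by (simp add: mult_ac)
  qed
  moreover have "a powr (2 * b) < 1" using assms powr_less_mono'[of a 0 "2 * b"] by simp
  ultimately show ?thesis by (simp add: LIMSEQ_realpow_zero)
qed

text \<open>At \<open>x = 2 j / c^k\<close> for a large prime \<open>j\<close> the mass is dominated by its leading term
  \<open>(q^(2 j) - a^(2 j)) / (2 j)\<close>: primality of \<open>j\<close> makes \<open>2 j / c^i\<close> with \<open>1 \<le> i \<le> k\<close> an integer only
  if \<open>c^i = 2\<close>, and the later points \<open>2 j c^n\<close> of the orbit contribute geometrically small terms.\<close>

lemma mu_weight_negative: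
  assumes q: "0 \<le> q" "q < 1" and a: "0 < a" "a < 1" and c: "c > 1"
    and qa: "q < a" and two: "\<And>i. i \<in> {1..k} \<Longrightarrow> c ^ i = 2 \<Longrightarrow> q < a^2"
  shows "\<exists>x>0. mu_weight q a (c ^ k) c x < 0"
proof -
  \<comment> \<open>Bernoulli's inequality c^n \<ge> 1 + n (c - 1) bounds a^(2 j c^n) by a^(2j)
    \<epsilon>^n, so the tail of the orbit is geometric with a ratio that vanishes as j
    grows.\<close>
  define \<epsilon> where "\<epsilon> j = a powr (real (2 * j) * (c - 1))" for j
  \<comment> \<open>If some power c^i is 2, each of the k earlier orbit points carries at most q^j /
    j. This crude count gives 2 k q^j / (2j), negligible against a^(2j) / (2j) when q < a^2.\<close>
  define K where "K = (if \<exists>i\<in>{1..k}. c ^ i = 2 then 2 * real k else 0)"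
  define f where "f j = K * (q / a^2) ^ j + (q / a) ^ (2 * j) - 1 + 2 * (\<epsilon> j / (1 - \<epsilon> j))" for j
  have \<epsilon>0: "\<epsilon> \<longlonglongrightarrow> 0" unfolding \<epsilon>_def using a c by (intro tendsto_linear_powr_zero) auto
  have K0: "(\<lambda>j. K * (q / a^2) ^ j) \<longlonglongrightarrow> 0"
  proof (cases "K = 0")
    case False
    then have "q < a^2" using two by (auto simp: K_def split: if_splits)
    then have "(\<lambda>j. (q / a^2) ^ j) \<longlonglongrightarrow> 0" using q a by (intro LIMSEQ_realpow_zero) auto
    then show ?thesis by (rule tendsto_mult_right_zero)
  qed simp
  have "(\<lambda>j. ((q / a)^2) ^ j) \<longlonglongrightarrow> 0"
    using q a qa by (intro LIMSEQ_realpow_zero) (auto simp: power_less_one_iff abs_square_less_1)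
  then have q0: "(\<lambda>j. (q / a) ^ (2 * j)) \<longlonglongrightarrow> 0" by (simp add: power_mult)
  have "f \<longlonglongrightarrow> 0 + 0 - 1 + 2 * (0 / (1 - 0))"
    unfolding f_def by (intro tendsto_intros K0 q0 \<epsilon>0) simp
  then have "f \<longlonglongrightarrow> - 1" by simp
  then have "\<forall>\<^sub>F j in sequentially. f j < 0 \<and> \<epsilon> j < 1"
    using order_tendstoD(2)[of f "-1" sequentially 0] order_tendstoD(2)[OF \<epsilon>0, of 1] by (auto intro: eventually_conj)
  then obtain J where J: "\<And>j. j \<ge> J \<Longrightarrow> f j < 0 \<and> \<epsilon> j < 1" by (auto simp: eventually_sequentially)
  \<comment> \<open>The finitely many primes for which some 2 j / c^i with c^i other than 2 is a
    natural; avoiding them leaves no further positive mass before the leading term.\<close>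
  define bad where "bad = (\<Union>i\<in>{i\<in>{1..k}. c ^ i \<noteq> 2}. {j::nat. prime j \<and> 2 * real j / c ^ i \<in> \<nat>})"
  have "finite bad"
    unfolding bad_def using c by (intro finite_UN_I finite_primes_with_ratio) (auto intro: one_less_power)
  then have "finite (bad \<union> {..J})" by simp
  then have "infinite ({j::nat. prime j} - (bad \<union> {..J}))" using primes_infinite by (rule Diff_infinite_finite)
  then obtain j where "j \<in> {j::nat. prime j} - (bad \<union> {..J})" by (metis finite.emptyI subsetI subset_empty equals0I)
  then have j: "prime j" "j \<notin> bad" "j > J" by auto
  have j0: "j > 0" using j by (simp add: prime_gt_0_nat)
  let ?M = "real (2 * j)"
  have M: "?M > 0" using j0 by simp
  define x where "x = ?M / c ^ k"
  have x: "x > 0" using M c by (simp add: x_def)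
  have "mu_weight q a (c ^ k) c x = orbit_sum c q x - orbit_sum c (- a) (x * c ^ k)"
    using q a c x by (intro mu_weight_orbit_sum) auto
  also have "x * c ^ k = ?M" using c by (simp add: x_def)
  also have "orbit_sum c q x = (\<Sum>n<k. geom_weight q (x * c ^ n)) + orbit_sum c q ?M"
    using orbit_sum_shift[of c q x k] c q x by (simp add: x_def)
  finally have eq: "mu_weight q a (c ^ k) c x = (\<Sum>n<k. geom_weight q (x * c ^ n)) + (orbit_sum c q ?M - orbit_sum c (- a) ?M)"
    by simp
  have first: "(\<Sum>n<k. geom_weight q (x * c ^ n)) \<le> K * q ^ j / ?M"
  proof -
    have le: "geom_weight q (x * c ^ n) \<le> (if \<exists>i\<in>{1..k}. c ^ i = 2 then q ^ j / real j else 0)" if n: "n < k" for n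
    proof -
      define i where "i = k - n"
      have i: "i \<in> {1..k}" using n by (auto simp: i_def)
      have xc: "x * c ^ n = 2 * real j / c ^ i"
      proof -
        have "c ^ k = c ^ i * c ^ n" using n by (simp add: i_def power_add[symmetric])
        then show ?thesis using c by (simp add: x_def field_simps)
      qed
      show ?thesis
      proof (cases "c ^ i = 2")
        case True
        then show ?thesis using i xc by (auto simp: geom_weight_of_nat)
      next
        case False
        then have "2 * real j / c ^ i \<notin> \<nat>" using j i by (auto simp: bad_def)
        then show ?thesis using q by (simp add: xc geom_weight_not_nat)
      qed
    qed
    have "(\<Sum>n<k. geom_weight q (x * c ^ n)) \<le> (\<Sum>n<k. if \<exists>i\<in>{1..k}. c ^ i = 2 then q ^ j / real j else 0)"
      using le by (intro sum_mono) auto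
    also have "\<dots> = K * q ^ j / ?M" using j0 by (simp add: K_def field_simps)
    finally show ?thesis .
  qed
  have second: "orbit_sum c q ?M - orbit_sum c (- a) ?M \<le> (q ^ (2 * j) - a ^ (2 * j)) / ?M + 2 * (a ^ (2 * j) * (\<epsilon> j / (1 - \<epsilon> j)) / ?M)"
  proof -
    have \<epsilon>: "0 < \<epsilon> j" "\<epsilon> j < 1" using a J[of j] j by (auto simp: \<epsilon>_def)
    let ?d = "\<lambda>n. geom_weight q (?M * c ^ n) - geom_weight (- a) (?M * c ^ n)"
    have sd: "summable ?d" using q a c M by (intro summable_diff summable_geom_weight_orbit) auto
    have "orbit_sum c q ?M - orbit_sum c (- a) ?M = suminf ?d"
      unfolding orbit_sum_def using q a c M by (intro suminf_diff summable_geom_weight_orbit) auto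
    also have "\<dots> = (\<Sum>n. ?d (Suc n)) + ?d 0" using suminf_split_head[OF sd] by simp
    also have "?d 0 = (q ^ (2 * j) - a ^ (2 * j)) / ?M"
      using geom_weight_uminus_even[of a j] geom_weight_of_nat[of q "2 * j"] by (simp add: diff_divide_distrib del: of_nat_mult)
    also have "(\<Sum>n. ?d (Suc n)) \<le> (\<Sum>n. 2 * (a ^ (2 * j) / ?M * \<epsilon> j) * \<epsilon> j ^ n)"
    proof (rule suminf_le)
      show "summable (\<lambda>n. ?d (Suc n))" using summable_Suc_iff[of ?d] sd by blast
      show "summable (\<lambda>n. 2 * (a ^ (2 * j) / ?M * \<epsilon> j) * \<epsilon> j ^ n)" using \<epsilon> by (intro summable_mult summable_geometric) auto
      fix n
      let ?y = "?M * c ^ Suc n"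
      have y: "?y > 0" using M c by simp
      have "geom_weight q ?y \<le> geom_weight a ?y" using q qa y by (intro geom_weight_mono) auto
      moreover have "- geom_weight (- a) ?y \<le> geom_weight a ?y"
        using abs_ge_minus_self[of "geom_weight (- a) ?y"] abs_geom_weight[OF y, of "- a"] a by simp
      moreover have "geom_weight a ?y \<le> a ^ (2 * j) / ?M * \<epsilon> j * \<epsilon> j ^ n"
      proof -
        have "geom_weight a ?y \<le> a powr ?y / ?y"
        proof (cases "?y \<in> \<nat>")
          case True
          then obtain m where m: "?y = real m" by (auto elim: Nats_cases)
          show ?thesis unfolding m geom_weight_of_nat using a by (simp add: powr_realpow)
        qed (use y in \<open>simp add: geom_weight_not_nat\<close>)
        also have "\<dots> \<le> a powr ?y / ?M"
          using M c by (intro divide_left_mono) (auto intro!: mult_pos_pos simp: one_le_power mult_le_cancel_left1 simp del: power_Suc)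
        also have "a powr ?y \<le> a powr (?M * (1 + real (Suc n) * (c - 1)))"
        proof (rule powr_mono')
          have "1 + real (Suc n) * (c - 1) \<le> (1 + (c - 1)) ^ Suc n" using c by (intro Bernoulli_inequality) auto
          then show "?M * (1 + real (Suc n) * (c - 1)) \<le> ?y" using M by (intro mult_left_mono) auto
        qed (use a in auto)
        also have "a powr (?M * (1 + real (Suc n) * (c - 1))) = a ^ (2 * j) * \<epsilon> j ^ Suc n"
        proof -
          have "\<epsilon> j ^ Suc n = a powr (?M * (c - 1) * real (Suc n))"
            unfolding \<epsilon>_def using a by (simp only: powr_realpow[symmetric] powr_gt_zero powr_powr) 
          moreover have "a ^ (2 * j) = a powr ?M" using a by (simp only: powr_realpow)
          ultimately show ?thesis by (simp only: powr_add[symmetric]) (simp add: algebra_simps)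
        qed
        finally show ?thesis using M by (simp add: divide_right_mono)
      qed
      ultimately show "?d (Suc n) \<le> 2 * (a ^ (2 * j) / ?M * \<epsilon> j) * \<epsilon> j ^ n" by linarith
    qed
    also have "(\<Sum>n. 2 * (a ^ (2 * j) / ?M * \<epsilon> j) * \<epsilon> j ^ n) = 2 * (a ^ (2 * j) * (\<epsilon> j / (1 - \<epsilon> j)) / ?M)"
      using \<epsilon> by (subst suminf_mult) (auto simp: suminf_geometric summable_geometric)
    finally show ?thesis by simp
  qed
  have "mu_weight q a (c ^ k) c x \<le> a ^ (2 * j) * f j / ?M"
  proof -
    have "q ^ j = a ^ (2 * j) * (q / a^2) ^ j" "q ^ (2 * j) = a ^ (2 * j) * (q / a) ^ (2 * j)"
      using a by (simp_all add: power_divide power_mult)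
    then have "K * q ^ j / ?M + ((q ^ (2 * j) - a ^ (2 * j)) / ?M + 2 * (a ^ (2 * j) * (\<epsilon> j / (1 - \<epsilon> j)) / ?M)) = a ^ (2 * j) * f j / ?M"
      unfolding f_def by (simp add: add_divide_distrib diff_divide_distrib algebra_simps)
    then show ?thesis unfolding eq using first second by linarith
  qed
  also have "\<dots> < 0"
    using J[of j] j a M by (intro divide_neg_pos mult_pos_neg) auto
  finally show ?thesis using x by blast
qed

text \<open>Sufficiency is a shift of orbits, since dropping initial terms only lowers the positive
  side: for a \<le> q compare with the orbit of x c^k itself, for c^l = 2 with that of x c^(k - l),
  whose double is x c^k.\<close>

lemma mu_weight_nonneg_iff_ge_one:
  assumes q: "0 \<le> q" "q < 1" and a: "0 < a" "a < 1" and c: "c > 1"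
  shows "(\<forall>x>0. 0 \<le> mu_weight q a (c ^ k) c x) \<longleftrightarrow> a \<le> q \<or> (\<exists>l\<in>{1..k}. c ^ l = 2) \<and> a^2 \<le> q"
proof
  assume nn: "\<forall>x>0. 0 \<le> mu_weight q a (c ^ k) c x"
  show "a \<le> q \<or> (\<exists>l\<in>{1..k}. c ^ l = 2) \<and> a^2 \<le> q"
  proof (rule ccontr)
    assume neg: "\<not> ?thesis"
    have "\<exists>x>0. mu_weight q a (c ^ k) c x < 0"
      by (rule mu_weight_negative[OF q a c]) (use neg in \<open>auto simp: not_le\<close>)
    then show False using nn by (meson not_le)
  qed
next
  assume h: "a \<le> q \<or> (\<exists>l\<in>{1..k}. c ^ l = 2) \<and> a^2 \<le> q"
  show "\<forall>x>0. 0 \<le> mu_weight q a (c ^ k) c x"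
  proof (intro allI impI)
    fix x :: real assume x: "x > 0"
    have "orbit_sum c (- a) (x * c ^ k) \<le> orbit_sum c q x"
      using h
    proof
      assume "a \<le> q"
      have "orbit_sum c (- a) (x * c ^ k) \<le> orbit_sum c q (x * c ^ k)"
      proof (rule orbit_sum_mono)
        fix n
        have "x * c ^ k * c ^ n > 0" using x c by simp
        then show "geom_weight (- a) (x * c ^ k * c ^ n) \<le> geom_weight q (x * c ^ k * c ^ n)"
          using geom_weight_uminus_le[of a] geom_weight_mono[of a q] a \<open>a \<le> q\<close> by (meson less_imp_le order_trans)
      qed (use q a c x in auto)
      also have "\<dots> \<le> orbit_sum c q x" using c q x by (intro orbit_sum_shift_le) auto
      finally show ?thesis .
    next
      assume "(\<exists>l\<in>{1..k}. c ^ l = 2) \<and> a^2 \<le> q"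
      then obtain l where l: "l \<in> {1..k}" "c ^ l = 2" and aq: "a^2 \<le> q" by blast
      have ck: "c ^ k = 2 * c ^ (k - l)"
        using l by (metis atLeastAtMost_iff le_add_diff_inverse power_add)
      have "orbit_sum c (- a) (x * c ^ k) \<le> orbit_sum c q (x * c ^ (k - l))"
      proof (rule orbit_sum_mono)
        fix n
        have e: "x * c ^ k * c ^ n = 2 * (x * c ^ (k - l) * c ^ n)" by (simp add: ck)
        show "geom_weight (- a) (x * c ^ k * c ^ n) \<le> geom_weight q (x * c ^ (k - l) * c ^ n)"
          unfolding e by (rule geom_weight_double_le[OF q a aq]) (use x c in simp)
      qed (use q a c x in auto)
      also have "\<dots> \<le> orbit_sum c q x" using c q x by (intro orbit_sum_shift_le) auto
      finally show ?thesis .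
    qed
    then show "0 \<le> mu_weight q a (c ^ k) c x" using mu_weight_orbit_sum[OF q a _ c x, of "c ^ k"] c by simp
  qed
qed

section \<open>Negative k: orbits indexed from the negative masses\<close>

lemma mu_weight_nonneg_iff_orbit_sum:
  assumes q: "0 \<le> q" "q < 1" and a: "0 < a" "a < 1" and c: "c > 1"
  shows "(\<forall>x>0. 0 \<le> mu_weight q a (1 / c ^ K) c x) \<longleftrightarrow>
    (\<forall>y>0. orbit_sum c (- a) y \<le> orbit_sum c q (y * c ^ K))"
proof -
  have eq: "mu_weight q a (1 / c ^ K) c (y * c ^ K) = orbit_sum c q (y * c ^ K) - orbit_sum c (- a) y" if "y > 0" for y
    using mu_weight_orbit_sum[OF q a _ c, of "1 / c ^ K" "y * c ^ K"] that c by simp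
  show ?thesis
  proof (intro iffI allI impI)
    fix y :: real assume "\<forall>x>0. 0 \<le> mu_weight q a (1 / c ^ K) c x" "y > 0"
    then show "orbit_sum c (- a) y \<le> orbit_sum c q (y * c ^ K)"
      using eq[of y] c by (auto dest!: spec[of _ "y * c ^ K"])
  next
    fix x :: real assume h: "\<forall>y>0. orbit_sum c (- a) y \<le> orbit_sum c q (y * c ^ K)" and x: "x > 0"
    have "x / c ^ K > 0" using x c by simp
    moreover have "x / c ^ K * c ^ K = x" using c by simp
    ultimately show "0 \<le> mu_weight q a (1 / c ^ K) c x" using eq[of "x / c ^ K"] h by auto
  qed
qed

lemma two_power_odd_cancel:
  assumes "2 ^ x * A = 2 ^ y * (B :: nat)" "odd A" "odd B" shows "x = y"
proof (rule ccontr)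
  assume "x \<noteq> y"
  then consider "x < y" | "y < x" by linarith
  then show False
  proof cases
    case 1
    then have "2 ^ y = 2 ^ x * (2 ^ (y - x) :: nat)" by (simp flip: power_add)
    then have "A = 2 ^ (y - x) * B" using assms(1) by simp
    then show False using 1 assms(2) by simp
  next
    case 2
    then have "2 ^ x = 2 ^ y * (2 ^ (x - y) :: nat)" by (simp flip: power_add)
    then have "B = 2 ^ (x - y) * A" using assms(1) by simp
    then show False using 2 assms(3) by simp
  qed
qed

text \<open>Raising 2 c^n = i to the power j and 2 c^j = m to the power n gives i^j 2^n = m^n 2^j.
  If 2^b is the exact power of 2 in i, then b j + n = j because m is odd, and n \<ge> 1 forces b = 0
  and n = j. So the orbit of 2 meets the naturals only at 2 and m.\<close>

lemma half_odd_power_unique: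
  fixes c :: real
  assumes c: "c > 1" and j: "2 * c ^ j = real m" "odd m" and n: "2 * c ^ n = real i" "n \<ge> 1"
  shows "n = j"
proof -
  have "i \<noteq> 0" using n c by (intro notI) simp
  moreover have "\<not> is_unit (2 :: nat)" by simp
  ultimately obtain A where A': "i = 2 ^ multiplicity 2 i * A" "\<not> 2 dvd A"
    using multiplicity_decompose'[of i 2] by blast
  define b where "b = multiplicity 2 i"
  have A: "i = 2 ^ b * A" "odd A" using A' by (simp_all add: b_def)
  have "real (i ^ j * 2 ^ n) = (2 * c ^ n) ^ j * 2 ^ n" by (simp add: n)
  also have "\<dots> = (2 * c ^ j) ^ n * 2 ^ j"
    unfolding power_mult_distrib power_mult[symmetric] by (simp add: mult.commute)
  also have "\<dots> = real (m ^ n * 2 ^ j)" by (simp add: j)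
  finally have "i ^ j * 2 ^ n = m ^ n * 2 ^ j" by (simp only: of_nat_eq_iff)
  then have "2 ^ (b * j + n) * A ^ j = 2 ^ j * m ^ n"
    by (simp add: A power_mult_distrib power_mult power_add mult_ac)
  then have eq: "b * j + n = j" by (rule two_power_odd_cancel) (use A j in auto)
  then have "b = 0" using n(2) by (cases b) auto
  then show ?thesis using eq by simp
qed

text \<open>At the point 2 the positive side vanishes by hypothesis. The other side has the term a^2
  / 2 and loses only at odd naturals of the orbit; there is at most one by
  \<open>half_odd_power_unique\<close>, it is at least 3, and a^3 / 3 < a^2 / 2.\<close>

lemma mu_weight_negative_no_half_integer_power:
  assumes q: "0 \<le> q" "q < 1" and a: "0 < a" "a < 1" and c: "c > 1"
    and no: "\<And>j. j \<ge> K \<Longrightarrow> 2 * c ^ j \<notin> \<nat>"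
  shows "\<not> (\<forall>x>0. 0 \<le> mu_weight q a (1 / c ^ K) c x)"
proof
  assume "\<forall>x>0. 0 \<le> mu_weight q a (1 / c ^ K) c x"
  then have le: "orbit_sum c (- a) 2 \<le> orbit_sum c q (2 * c ^ K)"
    using mu_weight_nonneg_iff_orbit_sum[OF q a c] by auto
  have "geom_weight q (2 * c ^ K * c ^ n) = 0" for n
    using no[of "K + n"] by (intro geom_weight_not_nat) (simp add: power_add mult.assoc)
  then have "orbit_sum c q (2 * c ^ K) = 0" by (simp add: orbit_sum_def)
  moreover have "orbit_sum c (- a) 2 > 0"
  proof -
    \<comment> \<open>If the orbit contains no odd natural, \<open>n0\<close> is unspecified;
      \<open>h\<close> is still a lower bound because its extra term, if any, is negative.\<close>
    define n0 where "n0 = (THE n. n \<ge> 1 \<and> (\<exists>m. odd m \<and> 2 * c ^ n = real m))"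
    define h where "h n = (if n = 0 then a^2 / 2 else if n = n0 then - (a^3 / 3) else 0)" for n
    have n0: "n = n0" if n: "n \<ge> 1" "odd m" "2 * c ^ n = real m" for n m
      unfolding n0_def
      by (rule the_equality[symmetric]) (use half_odd_power_unique[OF c] n in blast)+
    have "h n \<le> geom_weight (- a) (2 * c ^ n)" for n
    proof (cases "n = 0")
      case True
      then show ?thesis using geom_weight_uminus_even[of a 1] by (simp add: h_def)
    next
      case False
      show ?thesis
      proof (cases "\<exists>m. odd m \<and> 2 * c ^ n = real m")
        case True
        then obtain m where m: "odd m" "2 * c ^ n = real m" by blast
        have "real m > 2" using m(2) c False by (simp flip: m(2))
        then have m3: "m \<ge> 3" by simp
        have "geom_weight (- a) (2 * c ^ n) = - (a ^ m / real m)" unfolding m(2) using m(1) by (rule geom_weight_uminus_odd)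
        moreover have "a ^ m / real m \<le> a ^ 3 / 3" using a m3 by (intro frac_le power_decreasing) auto
        ultimately show ?thesis using False n0[of n m] m by (simp add: h_def)
      next
        case no_odd: False
        have "0 \<le> geom_weight (- a) (2 * c ^ n)"
        proof (cases "2 * c ^ n \<in> \<nat>")
          case True
          then obtain m where m: "2 * c ^ n = real m" by (auto elim: Nats_cases)
          then have "even m" using no_odd by auto
          then show ?thesis unfolding m geom_weight_of_nat using a by simp
        qed (simp add: geom_weight_not_nat)
        moreover have "h n \<le> 0" using False a by (simp add: h_def)
        ultimately show ?thesis by linarith
      qed
    qed
    then have "suminf h \<le> orbit_sum c (- a) 2"
      unfolding orbit_sum_def using a c
      by (intro suminf_le summable_geom_weight_orbit summable_finite[of "{0, n0}"]) (auto simp: h_def)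
    moreover have "suminf h = (\<Sum>n\<in>{0, n0}. h n)" by (rule suminf_finite) (auto simp: h_def)
    moreover have "(\<Sum>n\<in>{0, n0}. h n) \<ge> a^2 / 2 - a^3 / 3" using a by (cases "n0 = 0") (auto simp: h_def)
    moreover have "a^3 / 3 < a^2 / 2"
    proof -
      have "a^3 = a^2 * a" by (simp add: power2_eq_square power3_eq_cube)
      also have "\<dots> \<le> a^2 * 1" using a by (intro mult_left_mono) auto
      finally show ?thesis using a zero_less_power[of a 2] by linarith
    qed
    ultimately show ?thesis by linarith
  qed
  ultimately show False using le by simp
qed

text \<open>In (vii) the mass coming from \<open>2 t\<close> is compensated by that coming from \<open>2 t c^j = m t\<close>. For
  \<open>t \<ge> 2\<close> this is automatic; for \<open>t = 1\<close> the odd point \<open>m\<close> of the same orbit is needed, too.\<close>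

lemma half_odd_term_bound:
  fixes q a :: real
  assumes q: "0 \<le> q" "q < 1" and a: "0 < a" "a < 1" and m: "m \<ge> 5"
    and h: "real m / 2 * a^2 \<le> q ^ m + a ^ m" and t: "t \<ge> 2"
  shows "a ^ (2 * t) / real (2 * t) \<le> q ^ (m * t) / real (m * t)"
proof -
  define \<alpha> where "\<alpha> = real m / 2"
  have \<alpha>: "\<alpha> \<ge> 5/2" using m by (simp add: \<alpha>_def)
  have am: "a ^ m \<le> a ^ 5" using a m by (intro power_decreasing) auto
  have a5: "a ^ 5 = a^2 * a^3" unfolding power_add[symmetric] by simp
  have q1: "q ^ m \<le> 1" using q by (intro power_le_one) auto
  have "a ^ 5 \<le> 1" using a by (intro power_le_one) auto
  \<comment> \<open>First a rough bound on a: with m \<ge> 5 the hypothesis gives a^2 \<le> 4/5,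
    hence a^3 \<le> 9/10, so that a^m \<le> (9/10) a^2 can be absorbed into the left-hand
    side.\<close>
  then have "\<alpha> * a^2 \<le> 2" using h am q1 by (simp add: \<alpha>_def)
  moreover have "5/2 * a^2 \<le> \<alpha> * a^2" using \<alpha> by (intro mult_right_mono) auto
  ultimately have a2: "a^2 \<le> 4/5" by linarith
  have "(a^3)^2 \<le> (9/10)^2"
  proof -
    have "(a^3)^2 = (a^2)^3" unfolding power_mult[symmetric] by simp
    also have "\<dots> \<le> (4/5)^3" using a2 by (intro power_mono) auto
    also have "\<dots> \<le> (9/10)^2" by (simp add: power_divide)
    finally show ?thesis .
  qed
  then have a3: "a^3 \<le> 9/10" by (rule power2_le_imp_le) simp
  have "a^2 * a^3 \<le> a^2 * (9/10)" using a3 by (rule mult_left_mono) simp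
  moreover have "(\<alpha> - 9/10) * a^2 = \<alpha> * a^2 - 9/10 * a^2" by (rule left_diff_distrib)
  ultimately have base: "(\<alpha> - 9/10) * a^2 \<le> q ^ m" using h am a5 unfolding \<alpha>_def by linarith
  \<comment> \<open>The difference of the sides is (\<alpha> - 5/2) (\<alpha> - 3/10) + 3/50, which
    is where m \<ge> 5 enters; t \<ge> 2 then passes from the square to the t-th power.\<close>
  have "\<alpha> \<le> (\<alpha> - 9/10)^2"
  proof -
    have "0 \<le> (\<alpha> - 5/2) * (\<alpha> - 3/10)" using \<alpha> by (intro mult_nonneg_nonneg) auto
    then show ?thesis using \<alpha> by (simp add: power2_eq_square algebra_simps)
  qed
  also have "\<dots> \<le> (\<alpha> - 9/10) ^ t" using \<alpha> t by (intro power_increasing) auto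
  finally have "\<alpha> * (a^2) ^ t \<le> (\<alpha> - 9/10) ^ t * (a^2) ^ t" by (intro mult_right_mono) auto
  also have "\<dots> = ((\<alpha> - 9/10) * a^2) ^ t" by (rule power_mult_distrib[symmetric])
  also have "\<dots> \<le> (q ^ m) ^ t" using base \<alpha> by (intro power_mono) auto
  finally have "real m / 2 * a ^ (2 * t) \<le> q ^ (m * t)" by (simp add: \<alpha>_def power_mult)
  then show ?thesis using t m by (simp add: field_simps)
qed

text \<open>Necessity is the point y = 2, whose orbit meets the naturals only at 2 and m. For
  sufficiency it is enough to compare with the shift by j in place of K, since K \<le> j and
  dropping initial terms lowers the positive side.\<close>

lemma mu_weight_nonneg_iff_half_odd:
  assumes q: "0 \<le> q" "q < 1" and a: "0 < a" "a < 1" and c: "c > 1"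
    and K: "1 \<le> K" "K \<le> j" and m: "2 * c ^ j = real m" "odd m" "m \<ge> 5"
  shows "(\<forall>x>0. 0 \<le> mu_weight q a (1 / c ^ K) c x) \<longleftrightarrow> real m / 2 * a^2 \<le> q ^ m + a ^ m"
  unfolding mu_weight_nonneg_iff_orbit_sum[OF q a c]
proof
  assume "\<forall>y>0. orbit_sum c (- a) y \<le> orbit_sum c q (y * c ^ K)"
  then have le: "orbit_sum c (- a) 2 \<le> orbit_sum c q (2 * c ^ K)" by simp
  have j1: "j \<ge> 1" using K by simp
  have zero: "geom_weight t (2 * c ^ n) = 0" if "n \<noteq> 0" "n \<noteq> j" for n t
  proof (rule geom_weight_not_nat)
    show "2 * c ^ n \<notin> \<nat>"
    proof
      assume "2 * c ^ n \<in> \<nat>"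
      then obtain i where "2 * c ^ n = real i" by (auto elim: Nats_cases)
      from half_odd_power_unique[OF c m(1,2) this] that show False by simp
    qed
  qed
  have "orbit_sum c (- a) 2 = (\<Sum>n\<in>{0, j}. geom_weight (- a) (2 * c ^ n))"
    unfolding orbit_sum_def by (rule suminf_finite) (use zero in auto)
  also have "\<dots> = geom_weight (- a) 2 + geom_weight (- a) (2 * c ^ j)" using j1 by simp
  also have "\<dots> = a^2 / 2 - a ^ m / real m"
    using geom_weight_uminus_even[of a 1] geom_weight_uminus_odd[OF m(2), of a] by (simp add: m(1))
  finally have 1: "orbit_sum c (- a) 2 = a^2 / 2 - a ^ m / real m" .
  have "orbit_sum c q (2 * c ^ K) = (\<Sum>n\<in>{j - K}. geom_weight q (2 * c ^ K * c ^ n))"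
    unfolding orbit_sum_def
  proof (rule suminf_finite)
    fix n assume "n \<notin> {j - K}"
    then show "geom_weight q (2 * c ^ K * c ^ n) = 0"
      using zero[of "K + n" q] K by (simp add: power_add mult.assoc)
  qed simp
  also have "\<dots> = geom_weight q (2 * c ^ j)" using K by (simp add: mult.assoc flip: power_add)
  also have "\<dots> = q ^ m / real m" unfolding m(1) by (rule geom_weight_of_nat)
  finally have "a^2 / 2 - a ^ m / real m \<le> q ^ m / real m" using le 1 by simp
  then have "a^2 / 2 \<le> (q ^ m + a ^ m) / real m" unfolding add_divide_distrib by linarith
  then show "real m / 2 * a^2 \<le> q ^ m + a ^ m" using m(3) by (simp add: pos_le_divide_eq mult.commute)
next
  assume h: "real m / 2 * a^2 \<le> q ^ m + a ^ m"
  show "\<forall>y>0. orbit_sum c (- a) y \<le> orbit_sum c q (y * c ^ K)"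
  proof (intro allI impI)
    fix y :: real assume y: "y > 0"
    let ?d = "\<lambda>n. geom_weight (- a) (y * c ^ n) - geom_weight q (y * c ^ j * c ^ n)"
    have sd: "summable ?d" using q a c y by (intro summable_diff summable_geom_weight_orbit) auto
    define n0 where "n0 = (THE n. y * c ^ n = 2)"
    \<comment> \<open>A comparison sequence with sum 0: the surplus a^m / m that the point 2 may
      leave is paid by the odd point m, found j steps later on the same orbit. All other points are
      nonpositive on their own.\<close>
    define e where "e n = (if y * c ^ n0 = 2 then (if n = n0 then a ^ m / real m else if n = n0 + j then - (a ^ m / real m) else 0) else 0)" for n
    have n0: "n = n0" if "y * c ^ n = 2" for n
      unfolding n0_def
    proof (rule the_equality[symmetric])
      show "y * c ^ n = 2" by (rule that)
      fix i assume "y * c ^ i = 2"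
      then have "y * c ^ i = y * c ^ n" using that by simp
      then show "i = n" using y c by simp
    qed
    have "?d n \<le> e n" for n
    proof -
      let ?z = "y * c ^ n"
      have z: "?z > 0" using y c by simp
      have q0: "0 \<le> geom_weight q (y * c ^ j * c ^ n)" using q y c by (intro geom_weight_nonneg) auto
      show ?thesis
      proof (cases "\<exists>t. ?z = real (2 * t)")
        case True
        then obtain t where t: "?z = real (2 * t)" by blast
        have t1: "t \<ge> 1" using z t by (cases t) auto
        have "y * c ^ j * c ^ n = real t * (2 * c ^ j)" using t by (simp add: mult_ac)
        also have "\<dots> = real (m * t)" by (simp add: m(1))
        finally have d: "?d n = a ^ (2 * t) / real (2 * t) - q ^ (m * t) / real (m * t)"
          unfolding t by (simp only: geom_weight_of_nat power_minus_even dvd_triv_left)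
        have nj: "n \<noteq> n0 + j" if "y * c ^ n0 = 2"
        proof
          assume "n = n0 + j"
          then have "?z = (y * c ^ n0) * c ^ j" by (simp add: power_add)
          then have "real (2 * t) = real m" using t that m(1) by simp
          then have "2 * t = m" by (simp only: of_nat_eq_iff)
          then show False using m(2) by auto
        qed
        show ?thesis
        proof (cases "t = 1")
          case True
          then have "?z = 2" using t by simp
          then have "e n = a ^ m / real m" using n0 by (auto simp: e_def)
          moreover have "a^2 / 2 - q ^ m / real m \<le> a ^ m / real m"
          proof -
            have "a^2 / 2 = real m / 2 * a^2 / real m" using m(3) by simp
            also have "\<dots> \<le> (q ^ m + a ^ m) / real m" by (rule divide_right_mono[OF h]) simp
            finally show ?thesis unfolding add_divide_distrib by linarith
          qed
          ultimately show ?thesis using d True by simp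
        next
          case False
          then have "n \<noteq> n0 \<or> y * c ^ n0 \<noteq> 2" using t by auto
          then have "e n = 0" using nj by (auto simp: e_def)
          moreover have "?d n \<le> 0" using half_odd_term_bound[OF q a m(3) h, of t] False t1 d by simp
          ultimately show ?thesis by simp
        qed
      next
        case False
        have neg: "geom_weight (- a) ?z \<le> 0" using a z False by (intro geom_weight_uminus_nonpos) auto
        show ?thesis
        proof (cases "y * c ^ n0 = 2 \<and> n = n0 + j")
          case True
          then have "?z = (y * c ^ n0) * c ^ j" by (simp add: power_add)
          then have "?z = real m" using True m(1) by simp
          then have "geom_weight (- a) ?z = - (a ^ m / real m)" using geom_weight_uminus_odd[OF m(2)] by simp
          moreover have "e n = - (a ^ m / real m)" using True K by (simp add: e_def)
          ultimately show ?thesis using q0 by simp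
        next
          case no: False
          then have "e n \<ge> 0" using a by (auto simp: e_def)
          then show ?thesis using neg q0 by linarith
        qed
      qed
    qed
    moreover have "summable e" by (rule summable_finite[of "{n0, n0 + j}"]) (auto simp: e_def)
    ultimately have "suminf ?d \<le> suminf e" using sd by (intro suminf_le)
    also have "suminf e = (\<Sum>n\<in>{n0, n0 + j}. e n)" by (rule suminf_finite) (auto simp: e_def)
    also have "\<dots> = 0" using K by (simp add: e_def)
    finally have "suminf ?d \<le> 0" .
    moreover have "suminf ?d = orbit_sum c (- a) y - orbit_sum c q (y * c ^ j)"
      unfolding orbit_sum_def using q a c y by (intro suminf_diff[symmetric] summable_geom_weight_orbit) auto
    moreover have "orbit_sum c q (y * c ^ j) \<le> orbit_sum c q (y * c ^ K)"
    proof -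
      have "c ^ j = c ^ K * c ^ (j - K)" using K by (simp flip: power_add)
      then have e: "y * c ^ j = y * c ^ K * c ^ (j - K)" by simp
      show ?thesis unfolding e using y c by (intro orbit_sum_shift_le[OF c q]) simp
    qed
    ultimately show "orbit_sum c (- a) y \<le> orbit_sum c q (y * c ^ K)" by linarith
  qed
qed

section \<open>The functions F and h\<close>

lemma summable_F_fun:
  assumes "\<alpha> \<ge> 2" "0 \<le> x" "x \<le> 1" shows "summable (\<lambda>n. (1 / real \<alpha>) ^ n * x ^ (2 * \<alpha> ^ n))"
proof (rule summable_comparison_test)
  show "summable (\<lambda>n. (1 / real \<alpha>) ^ n)" using assms by (intro summable_geometric) auto
  have "norm ((1 / real \<alpha>) ^ n * x ^ (2 * \<alpha> ^ n)) \<le> (1 / real \<alpha>) ^ n" for n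
  proof -
    have "(1 / real \<alpha>) ^ n * x ^ (2 * \<alpha> ^ n) \<le> (1 / real \<alpha>) ^ n * 1"
      using assms by (intro mult_left_mono power_le_one) auto
    then show ?thesis using assms by simp
  qed
  then show "\<exists>N. \<forall>n\<ge>N. norm ((1 / real \<alpha>) ^ n * x ^ (2 * \<alpha> ^ n)) \<le> (1 / real \<alpha>) ^ n" by blast
qed

lemma F_fun_nonneg: "\<alpha> \<ge> 2 \<Longrightarrow> 0 \<le> x \<Longrightarrow> x \<le> 1 \<Longrightarrow> 0 \<le> F_fun \<alpha> x"
  unfolding F_fun_def by (intro suminf_nonneg summable_F_fun) auto

lemma F_fun_strict_mono:
  assumes \<alpha>: "\<alpha> \<ge> 2" and x: "0 \<le> x" "x < y" "y \<le> 1" shows "F_fun \<alpha> x < F_fun \<alpha> y"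
proof -
  let ?d = "\<lambda>n. (1 / real \<alpha>) ^ n * y ^ (2 * \<alpha> ^ n) - (1 / real \<alpha>) ^ n * x ^ (2 * \<alpha> ^ n)"
  have s: "summable (\<lambda>n. (1 / real \<alpha>) ^ n * y ^ (2 * \<alpha> ^ n))" "summable (\<lambda>n. (1 / real \<alpha>) ^ n * x ^ (2 * \<alpha> ^ n))"
    using assms by (intro summable_F_fun; simp)+
  have "0 < suminf ?d"
  proof (rule suminf_pos2[where i=0])
    show "summable ?d" using s by (rule summable_diff)
    show "0 \<le> ?d n" for n using x by (auto intro!: mult_left_mono power_mono divide_right_mono)
    show "0 < ?d 0" using x by (simp add: power_strict_mono)
  qed
  also have "suminf ?d = F_fun \<alpha> y - F_fun \<alpha> x" unfolding F_fun_def by (rule suminf_diff[OF s, symmetric])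
  finally show ?thesis by simp
qed

lemma F_fun_zero: "\<alpha> \<ge> 2 \<Longrightarrow> F_fun \<alpha> 0 = 0"
  by (simp add: F_fun_def power_0_left)

lemma F_fun_ge_square:
  assumes "\<alpha> \<ge> 2" "0 \<le> x" "x \<le> 1" shows "x^2 \<le> F_fun \<alpha> x"
proof -
  have "(\<Sum>n\<in>{0}. (1 / real \<alpha>) ^ n * x ^ (2 * \<alpha> ^ n)) \<le> F_fun \<alpha> x"
    unfolding F_fun_def using assms by (intro sum_le_suminf summable_F_fun) auto
  then show ?thesis by simp
qed

lemma continuous_on_F_fun:
  assumes \<alpha>: "\<alpha> \<ge> 2" shows "continuous_on {0..1} (F_fun \<alpha>)"
proof -
  let ?f = "\<lambda>n x. (1 / real \<alpha>) ^ n * x ^ (2 * \<alpha> ^ n)"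
  have "uniform_limit {0..1} (\<lambda>n x. \<Sum>i<n. ?f i x) (\<lambda>x. suminf (\<lambda>i. ?f i x)) sequentially"
  proof (rule Weierstrass_m_test)
    fix n and x :: real assume x: "x \<in> {0..1}"
    have "(1 / real \<alpha>) ^ n * x ^ (2 * \<alpha> ^ n) \<le> (1 / real \<alpha>) ^ n * 1"
      using x by (intro mult_left_mono power_le_one) auto
    then show "norm (?f n x) \<le> (1 / real \<alpha>) ^ n" using x by simp
  next
    show "summable (\<lambda>n. (1 / real \<alpha>) ^ n)" using \<alpha> by (intro summable_geometric) auto
  qed
  then have "continuous_on {0..1} (\<lambda>x. suminf (\<lambda>i. ?f i x))"
    by (rule uniform_limit_theorem[rotated]) (auto intro!: always_eventually continuous_intros)
  then show ?thesis unfolding F_fun_def .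
qed

lemma h_fun_properties:
  assumes \<alpha>: "\<alpha> \<ge> 2" and \<gamma>: "\<gamma> \<ge> 1" and x: "0 < x" "x \<le> 1"
  shows "0 < h_fun \<alpha> \<gamma> x" "h_fun \<alpha> \<gamma> x < x" "(1 / real \<alpha>) ^ \<gamma> * F_fun \<alpha> x = F_fun \<alpha> (h_fun \<alpha> \<gamma> x)"
proof -
  let ?\<kappa> = "(1 / real \<alpha>) ^ \<gamma>" and ?P = "\<lambda>y. 0 < y \<and> y < x \<and> (1 / real \<alpha>) ^ \<gamma> * F_fun \<alpha> x = F_fun \<alpha> y"
  have F: "0 < F_fun \<alpha> x" using F_fun_strict_mono[OF \<alpha>, of 0 x] x F_fun_zero[OF \<alpha>] by simp
  have \<kappa>: "0 < ?\<kappa>" "?\<kappa> < 1" using \<alpha> \<gamma> by (auto simp: power_less_one_iff)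
  have lt: "?\<kappa> * F_fun \<alpha> x < F_fun \<alpha> x" using F \<kappa> by simp
  have "\<exists>y. 0 \<le> y \<and> y \<le> x \<and> F_fun \<alpha> y = ?\<kappa> * F_fun \<alpha> x"
  proof (rule IVT')
    show "F_fun \<alpha> 0 \<le> ?\<kappa> * F_fun \<alpha> x" using F \<kappa> by (simp add: F_fun_zero[OF \<alpha>])
    show "continuous_on {0..x} (F_fun \<alpha>)" by (rule continuous_on_subset[OF continuous_on_F_fun[OF \<alpha>]]) (use x in auto)
  qed (use lt x in auto)
  then obtain y where y: "0 \<le> y" "y \<le> x" "F_fun \<alpha> y = ?\<kappa> * F_fun \<alpha> x" by blast
  have "y \<noteq> 0"
  proof
    assume "y = 0"
    then have "?\<kappa> * F_fun \<alpha> x = 0" using y(3) F_fun_zero[OF \<alpha>] by metis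
    then show False using mult_pos_pos[OF \<kappa>(1) F] by linarith
  qed
  moreover have "y \<noteq> x" using y(3) lt by auto
  ultimately have Py: "?P y" using y by auto
  have "?P (h_fun \<alpha> \<gamma> x)"
    unfolding h_fun_def
  proof (rule theI)
    show "?P y" by (rule Py)
    fix y' assume Py': "?P y'"
    show "y' = y"
    proof (rule ccontr)
      assume "y' \<noteq> y"
      then have "F_fun \<alpha> y' \<noteq> F_fun \<alpha> y"
        using F_fun_strict_mono[OF \<alpha>, of y' y] F_fun_strict_mono[OF \<alpha>, of y y'] Py Py' x by fastforce
      then show False using Py Py' by simp
    qed
  qed
  then show "0 < h_fun \<alpha> \<gamma> x" "h_fun \<alpha> \<gamma> x < x" "?\<kappa> * F_fun \<alpha> x = F_fun \<alpha> (h_fun \<alpha> \<gamma> x)" by auto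
qed

lemma h_fun_ge_iff:
  assumes \<alpha>: "\<alpha> \<ge> 2" and \<gamma>: "\<gamma> \<ge> 1" and x: "0 < x" "x \<le> 1" and a: "0 < a" "a < 1"
  shows "a \<le> h_fun \<alpha> \<gamma> x \<longleftrightarrow> F_fun \<alpha> a \<le> (1 / real \<alpha>) ^ \<gamma> * F_fun \<alpha> x"
proof -
  note h = h_fun_properties[OF assms(1-4)]
  show ?thesis unfolding h(3)
    using F_fun_strict_mono[OF \<alpha>, of a "h_fun \<alpha> \<gamma> x"] F_fun_strict_mono[OF \<alpha>, of "h_fun \<alpha> \<gamma> x" a] h x a
    by (cases a "h_fun \<alpha> \<gamma> x" rule: linorder_cases) auto
qed

text \<open>Termwise a^(2 m \<alpha>^n) \<le> (a^2)^(m - 1) a^(2 \<alpha>^n), since \<alpha>^n \<ge>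
  1; and a^2 is the first term of F, hence at most F.\<close>

lemma F_fun_power_le:
  assumes \<alpha>: "\<alpha> \<ge> 2" and a: "0 \<le> a" "a \<le> 1" and m: "m \<ge> 1"
  shows "F_fun \<alpha> (a ^ m) \<le> F_fun \<alpha> a ^ m"
proof -
  have sa: "summable (\<lambda>n. (1 / real \<alpha>) ^ n * a ^ (2 * \<alpha> ^ n))" by (rule summable_F_fun[OF \<alpha> a])
  have "F_fun \<alpha> (a ^ m) \<le> (\<Sum>n. (a^2) ^ (m - 1) * ((1 / real \<alpha>) ^ n * a ^ (2 * \<alpha> ^ n)))"
    unfolding F_fun_def
  proof (rule suminf_le)
    fix n
    have "1 \<le> \<alpha> ^ n" using \<alpha> by simp
    then have "(2 * (m - 1)) * 1 \<le> (2 * (m - 1)) * \<alpha> ^ n" by (rule mult_le_mono2)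
    moreover have "(2 * (m - 1)) * A + 2 * A = m * (2 * A)" for A :: nat
      using m by (cases m) (simp_all add: algebra_simps)
    ultimately have "2 * (m - 1) + 2 * \<alpha> ^ n \<le> m * (2 * \<alpha> ^ n)" by (metis add_le_mono1 mult.right_neutral)
    then have "a ^ (m * (2 * \<alpha> ^ n)) \<le> a ^ (2 * (m - 1) + 2 * \<alpha> ^ n)" using a by (rule power_decreasing)
    then have "(a ^ m) ^ (2 * \<alpha> ^ n) \<le> (a^2) ^ (m - 1) * a ^ (2 * \<alpha> ^ n)"
      by (simp only: power_mult[of a m] power_add power_mult[of a 2 "m - 1"])
    then have "(1 / real \<alpha>) ^ n * (a ^ m) ^ (2 * \<alpha> ^ n) \<le> (1 / real \<alpha>) ^ n * ((a^2) ^ (m - 1) * a ^ (2 * \<alpha> ^ n))"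
      by (rule mult_left_mono) simp
    then show "(1 / real \<alpha>) ^ n * (a ^ m) ^ (2 * \<alpha> ^ n) \<le> (a^2) ^ (m - 1) * ((1 / real \<alpha>) ^ n * a ^ (2 * \<alpha> ^ n))"
      by (simp only: mult.left_commute)
  next
    show "summable (\<lambda>n. (1 / real \<alpha>) ^ n * (a ^ m) ^ (2 * \<alpha> ^ n))"
      using a by (intro summable_F_fun[OF \<alpha>] zero_le_power power_le_one)
    show "summable (\<lambda>n. (a^2) ^ (m - 1) * ((1 / real \<alpha>) ^ n * a ^ (2 * \<alpha> ^ n)))"
      by (rule summable_mult[OF sa])
  qed
  also have "\<dots> = (a^2) ^ (m - 1) * F_fun \<alpha> a" unfolding F_fun_def by (rule suminf_mult[OF sa])
  also have "\<dots> \<le> F_fun \<alpha> a ^ (m - 1) * F_fun \<alpha> a"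
    using F_fun_ge_square[OF \<alpha> a] F_fun_nonneg[OF \<alpha> a] by (intro mult_right_mono power_mono) auto
  also have "\<dots> = F_fun \<alpha> a ^ m" using m by (simp add: power_eq_if)
  finally show ?thesis .
qed

text \<open>Jensen's inequality for the measure with masses \<open>\<alpha>^-n\<close> and the function \<open>t^m\<close>.\<close>

lemma F_fun_power_ge:
  assumes \<alpha>: "\<alpha> \<ge> 2" and x: "0 < x" "x \<le> 1"
  defines "W \<equiv> 1 / (1 - 1 / real \<alpha>)"
  shows "F_fun \<alpha> x ^ m \<le> W ^ (m - 1) * F_fun \<alpha> (x ^ m)"
proof (cases "m = 0")
  case True
  have "1 \<le> F_fun \<alpha> 1" using F_fun_ge_square[OF \<alpha>, of 1] by simp
  then show ?thesis using True by simp
next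
  case False
  have W: "W > 0" using \<alpha> by (simp add: W_def)
  have W_sum: "(\<lambda>n. (1 / real \<alpha>) ^ n) sums W" unfolding W_def using \<alpha> by (intro geometric_sums) auto
  have F: "F_fun \<alpha> x > 0" using F_fun_ge_square[OF \<alpha>, of x] x zero_less_power[of x 2] by linarith
  \<comment> \<open>The mean of x^(2 \<alpha>^n) under the weights \<alpha>^(-n) normalized by their
    total W. The tangent of t^m at s, supplied by Bernoulli's inequality, integrates to Jensen's
    inequality.\<close>
  define s where "s = F_fun \<alpha> x / W"
  have s: "s > 0" using F W by (simp add: s_def)
  have tangent: "s ^ m + real m * s ^ (m - 1) * (t - s) \<le> t ^ m" if "t \<ge> 0" for t
  proof -
    have "1 + real m * (t / s - 1) \<le> (1 + (t / s - 1)) ^ m" using that s by (intro Bernoulli_inequality) auto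
    then have "s ^ m * (1 + real m * (t / s - 1)) \<le> s ^ m * (t / s) ^ m" using s by (intro mult_left_mono) auto
    also have "\<dots> = t ^ m" using s by (simp add: power_divide)
    also have "s ^ m * (1 + real m * (t / s - 1)) = s ^ m + real m * s ^ (m - 1) * (t - s)"
    proof -
      have "U * s * (1 + real m * (t / s - 1)) = U * s + real m * U * (t - s)" for U
        using s by (simp add: field_simps)
      moreover have "s ^ m = s ^ (m - 1) * s" using False by (simp add: power_eq_if)
      ultimately show ?thesis by (simp only:)
    qed
    finally show ?thesis .
  qed
  have Fx: "(\<lambda>n. (1 / real \<alpha>) ^ n * x ^ (2 * \<alpha> ^ n)) sums F_fun \<alpha> x"
    unfolding F_fun_def using \<alpha> x by (intro summable_sums summable_F_fun) auto
  have Fxm: "(\<lambda>n. (1 / real \<alpha>) ^ n * (x ^ m) ^ (2 * \<alpha> ^ n)) sums F_fun \<alpha> (x ^ m)"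
    unfolding F_fun_def using \<alpha> x by (intro summable_sums summable_F_fun) (auto intro: power_le_one)
  let ?c = "real m * s ^ (m - 1)"
  have distrib: "(A - C * s) * B + C * (B * t) = B * (A + C * (t - s))" for A B C t :: real
    by (simp add: algebra_simps)
  have "(\<lambda>n. (s ^ m - ?c * s) * (1 / real \<alpha>) ^ n + ?c * ((1 / real \<alpha>) ^ n * x ^ (2 * \<alpha> ^ n)))
      sums ((s ^ m - ?c * s) * W + ?c * F_fun \<alpha> x)"
    by (intro sums_add sums_mult W_sum Fx)
  then have "(s ^ m - ?c * s) * W + ?c * F_fun \<alpha> x \<le> F_fun \<alpha> (x ^ m)"
  proof (rule sums_le[rotated])
    show "(\<lambda>n. (1 / real \<alpha>) ^ n * (x ^ m) ^ (2 * \<alpha> ^ n)) sums F_fun \<alpha> (x ^ m)" by (rule Fxm)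
    fix n
    let ?t = "x ^ (2 * \<alpha> ^ n)"
    have "(s ^ m - ?c * s) * (1 / real \<alpha>) ^ n + ?c * ((1 / real \<alpha>) ^ n * ?t) = (1 / real \<alpha>) ^ n * (s ^ m + ?c * (?t - s))"
      by (rule distrib)
    also have "\<dots> \<le> (1 / real \<alpha>) ^ n * ?t ^ m" using tangent[of ?t] x by (intro mult_left_mono) auto
    also have "?t ^ m = (x ^ m) ^ (2 * \<alpha> ^ n)" by (simp add: mult.commute flip: power_mult)
    finally show "(s ^ m - ?c * s) * (1 / real \<alpha>) ^ n + ?c * ((1 / real \<alpha>) ^ n * ?t) \<le> (1 / real \<alpha>) ^ n * (x ^ m) ^ (2 * \<alpha> ^ n)" .
  qed
  moreover have "F_fun \<alpha> x = s * W" using W by (simp add: s_def)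
  moreover have "(A - C * s) * W + C * (s * W) = A * W" for A C by (simp add: algebra_simps)
  ultimately have "s ^ m * W \<le> F_fun \<alpha> (x ^ m)" by (simp only:)
  then have "W ^ (m - 1) * (s ^ m * W) \<le> W ^ (m - 1) * F_fun \<alpha> (x ^ m)" using W by (intro mult_left_mono) auto
  moreover have "W ^ (m - 1) * (s ^ m * W) = F_fun \<alpha> x ^ m"
  proof -
    have "W ^ (m - 1) * (s ^ m * W) = (W ^ (m - 1) * W) * s ^ m" by (simp only: mult_ac)
    also have "W ^ (m - 1) * W = W ^ m" using False by (simp add: power_eq_if)
    also have "W ^ m * s ^ m = F_fun \<alpha> x ^ m" using W by (simp add: s_def power_divide)
    finally show ?thesis .
  qed
  ultimately show ?thesis by simp
qed

text \<open>The inequality at the point 2 implies the one at every 2 m. Jensen costs W^(m - 1),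
  while the m-th power of the factor \<alpha>^(-\<gamma>) has m - 1 factors to spare, and
  \<alpha>^(-\<gamma>) W \<le> 1 / (\<alpha> - 1) \<le> 1 as \<gamma> \<ge> 1.\<close>

lemma F_fun_le_power:
  assumes \<alpha>: "\<alpha> \<ge> 2" and \<gamma>: "\<gamma> \<ge> 1" and a: "0 \<le> a" "a \<le> 1" and x: "0 < x" "x \<le> 1" and m: "m \<ge> 1"
    and le: "F_fun \<alpha> a \<le> (1 / real \<alpha>) ^ \<gamma> * F_fun \<alpha> x"
  shows "F_fun \<alpha> (a ^ m) \<le> (1 / real \<alpha>) ^ \<gamma> * F_fun \<alpha> (x ^ m)"
proof -
  let ?\<kappa> = "(1 / real \<alpha>) ^ \<gamma>" and ?W = "1 / (1 - 1 / real \<alpha>)"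
  have "?\<kappa> * ?W \<le> (1 / real \<alpha>) ^ 1 * ?W" using \<alpha> \<gamma> by (intro mult_right_mono power_decreasing) auto
  also have "\<dots> \<le> 1" using \<alpha> by (simp add: field_simps)
  finally have \<kappa>W: "?\<kappa> * ?W \<le> 1" .
  have nn: "0 \<le> ?\<kappa>" "0 \<le> ?W" "0 \<le> F_fun \<alpha> (x ^ m)" using \<alpha> x by (auto intro!: F_fun_nonneg power_le_one)
  have "F_fun \<alpha> (a ^ m) \<le> F_fun \<alpha> a ^ m" by (rule F_fun_power_le[OF \<alpha> a m])
  also have "\<dots> \<le> (?\<kappa> * F_fun \<alpha> x) ^ m" using le F_fun_nonneg[OF \<alpha> a] by (intro power_mono)
  also have "\<dots> = ?\<kappa> ^ m * F_fun \<alpha> x ^ m" by (rule power_mult_distrib)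
  also have "\<dots> \<le> ?\<kappa> ^ m * (?W ^ (m - 1) * F_fun \<alpha> (x ^ m))"
    using nn by (intro mult_left_mono F_fun_power_ge[OF \<alpha> x]) auto
  also have "\<dots> = ?\<kappa> * ((?\<kappa> * ?W) ^ (m - 1) * F_fun \<alpha> (x ^ m))"
  proof -
    have "?\<kappa> ^ m = ?\<kappa> * ?\<kappa> ^ (m - 1)" using m by (simp add: power_eq_if)
    then show ?thesis by (simp only: power_mult_distrib mult_ac)
  qed
  also have "\<dots> \<le> ?\<kappa> * (1 * F_fun \<alpha> (x ^ m))"
    using \<kappa>W nn by (intro mult_left_mono mult_right_mono power_le_one mult_nonneg_nonneg) auto
  finally show ?thesis by simp
qed

section \<open>Orbits when some power of c is an integer\<close>

lemma nat_power_of_rational_power: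
  fixes c :: real
  assumes c: "c > 0" and l: "l \<ge> 1" "c ^ l \<in> \<nat>" and rat: "c ^ n \<in> \<rat>"
  shows "c ^ n \<in> \<nat>"
proof -
  have "c ^ n > 0" using c by simp
  then obtain A B :: nat where AB: "B \<noteq> 0" "\<bar>c ^ n\<bar> = real A / real B" "coprime A B"
    using Rats_abs_nat_div_natE[OF rat] by metis
  have cn: "c ^ n = real A / real B" using AB \<open>c ^ n > 0\<close> by simp
  obtain X where X: "c ^ l = real X" using l by (auto elim: Nats_cases)
  \<comment> \<open>The l-th power of c^n = A / B is the integer X^n, so B^l divides A^l, hence B
    divides A, and lowest terms give B = 1.\<close>
  have "(real A / real B) ^ l = real X ^ n"
    unfolding cn[symmetric] X[symmetric] power_mult[symmetric] by (simp add: mult.commute)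
  then have "real (A ^ l) = real (X ^ n * B ^ l)" using AB by (simp add: power_divide field_simps)
  then have "B ^ l dvd A ^ l" by (metis dvd_triv_right of_nat_eq_iff)
  then have "B dvd A" using l by simp
  then have "B = 1" using AB by (metis coprime_absorb_right nat_dvd_1_iff_1)
  then show ?thesis using cn by simp
qed

context
  fixes c :: real and l \<alpha> :: nat
  assumes c: "c > 1" and l: "l = (LEAST j::nat. 1 \<le> j \<and> c ^ j \<in> \<nat>)" and ex: "\<exists>j::nat. 1 \<le> j \<and> c ^ j \<in> \<nat>"
    and \<alpha>: "real \<alpha> = c ^ l"
begin

lemma least_power: "1 \<le> l" "c ^ l \<in> \<nat>"
proof -
  have "1 \<le> l \<and> c ^ l \<in> \<nat>" unfolding l by (rule LeastI_ex[OF ex])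
  then show "1 \<le> l" "c ^ l \<in> \<nat>" by simp_all
qed

lemma \<alpha>_ge_two: "\<alpha> \<ge> 2"
proof -
  have "1 < c ^ l" using c least_power by (intro one_less_power) auto
  then have "1 < real \<alpha>" using \<alpha> by simp
  then show ?thesis by simp
qed

text \<open>Dividing by \<alpha>^(n div l) leaves a rational, hence natural, power of c with
  exponent n mod l < l; minimality of l makes that exponent 0.\<close>

lemma rational_power_dvd:
  assumes rat: "c ^ n \<in> \<rat>"
  shows "l dvd n"
proof -
  have n: "c ^ n = real \<alpha> ^ (n div l) * c ^ (n mod l)"
  proof -
    have "c ^ n = c ^ (l * (n div l) + n mod l)" by (simp only: mult_div_mod_eq)
    also have "\<dots> = c ^ (l * (n div l)) * c ^ (n mod l)" by (rule power_add)
    also have "c ^ (l * (n div l)) = real \<alpha> ^ (n div l)" by (simp only: power_mult \<alpha>)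
    finally show ?thesis .
  qed
  have pos: "real \<alpha> ^ (n div l) > 0" using \<alpha>_ge_two by simp
  have "c ^ (n mod l) = c ^ n / real \<alpha> ^ (n div l)" using pos by (simp add: n)
  also have "\<dots> \<in> \<rat>" by (rule Rats_divide[OF rat]) simp
  finally have "c ^ (n mod l) \<in> \<rat>" .
  then have "c ^ (n mod l) \<in> \<nat>" using c by (intro nat_power_of_rational_power[OF _ least_power]) simp_all
  moreover have "n mod l < l" using least_power by simp
  moreover have "\<not> (1 \<le> n mod l \<and> c ^ (n mod l) \<in> \<nat>)" if "n mod l < l"
    using that unfolding l by (rule not_less_Least)
  ultimately have "\<not> 1 \<le> n mod l" by blast
  then have "n mod l = 0" by linarith
  then show "l dvd n" by (rule mod_0_imp_dvd)
qed

lemma nat_orbit_iff: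
  assumes "X > 0" shows "real X * c ^ n \<in> \<nat> \<longleftrightarrow> l dvd n"
proof
  assume "real X * c ^ n \<in> \<nat>"
  then have "real X * c ^ n \<in> \<rat>" using Nats_subset_Rats by blast
  then have "real X * c ^ n / real X \<in> \<rat>" by (intro Rats_divide) auto
  then show "l dvd n" using assms by (intro rational_power_dvd) simp
next
  assume "l dvd n"
  then obtain i where "n = l * i" by blast
  then have "real X * c ^ n = real (X * \<alpha> ^ i)" by (simp add: power_mult \<alpha>)
  then show "real X * c ^ n \<in> \<nat>" by (simp only: of_nat_in_Nats)
qed

text \<open>From a natural X on, the orbit meets the naturals exactly at the points X \<alpha>^i,
  reached at exponents divisible by l.\<close>

lemma orbit_sum_nat:
  assumes X: "X > 0"
  shows "orbit_sum c t (real X) = (\<Sum>i. t ^ (X * \<alpha> ^ i) / real (X * \<alpha> ^ i))"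
proof -
  have "orbit_sum c t (real X) = (\<Sum>i. geom_weight t (real X * c ^ (l * i)))"
    unfolding orbit_sum_def
  proof (rule suminf_mono_reindex[symmetric])
    show "strict_mono (\<lambda>i. l * i)" using least_power by (auto simp: strict_mono_def)
    fix n assume "n \<notin> range (\<lambda>i. l * i)"
    then have "\<not> l dvd n" by auto
    then show "geom_weight t (real X * c ^ n) = 0" using nat_orbit_iff[OF X] by (intro geom_weight_not_nat) auto
  qed
  also have "(\<lambda>i. geom_weight t (real X * c ^ (l * i))) = (\<lambda>i. t ^ (X * \<alpha> ^ i) / real (X * \<alpha> ^ i))"
  proof
    fix i
    have "real X * c ^ (l * i) = real (X * \<alpha> ^ i)" by (simp add: power_mult \<alpha>)
    then show "geom_weight t (real X * c ^ (l * i)) = t ^ (X * \<alpha> ^ i) / real (X * \<alpha> ^ i)"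
      by (simp only: geom_weight_of_nat)
  qed
  finally show ?thesis .
qed

text \<open>The origin of F: the orbit of 2 m runs through the naturals 2 m \<alpha>^i, and
  factoring out 1 / (2m) leaves the series of F at t^m. All exponents are even, so the sign of t is
  lost.\<close>

lemma orbit_sum_even:
  assumes "m > 0" "0 \<le> t" "t \<le> 1"
  shows "orbit_sum c t (real (2 * m)) = F_fun \<alpha> (t ^ m) / real (2 * m)"
    and "orbit_sum c (- t) (real (2 * m)) = F_fun \<alpha> (t ^ m) / real (2 * m)"
proof -
  have "(t ^ m) ^ (2 * \<alpha> ^ i) = t ^ (2 * m * \<alpha> ^ i)" for i by (simp add: mult_ac flip: power_mult)
  then have eq: "t ^ (2 * m * \<alpha> ^ i) / real (2 * m * \<alpha> ^ i) = (1 / real \<alpha>) ^ i * (t ^ m) ^ (2 * \<alpha> ^ i) / real (2 * m)" for i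
    by (simp add: power_divide)
  have sm: "summable (\<lambda>i. (1 / real \<alpha>) ^ i * (t ^ m) ^ (2 * \<alpha> ^ i))"
    using assms by (intro summable_F_fun \<alpha>_ge_two) (auto intro: power_le_one)
  show 1: "orbit_sum c t (real (2 * m)) = F_fun \<alpha> (t ^ m) / real (2 * m)"
    using assms(1) unfolding F_fun_def by (subst orbit_sum_nat) (auto simp only: eq suminf_divide[OF sm, symmetric])
  have "(- t) ^ (2 * m * \<alpha> ^ i) = t ^ (2 * m * \<alpha> ^ i)" for i by simp
  then have "orbit_sum c (- t) (real (2 * m)) = orbit_sum c t (real (2 * m))"
    using assms(1) by (subst (1 2) orbit_sum_nat) auto
  then show "orbit_sum c (- t) (real (2 * m)) = F_fun \<alpha> (t ^ m) / real (2 * m)" using 1 by simp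
qed

text \<open>The first term -a^X / X outweighs the rest, which is at most a^X / X times the sum of
  \<alpha>^(-i) over i \<ge> 1, that is 1 / (\<alpha> - 1) \<le> 1.\<close>

lemma orbit_sum_odd_nonpos:
  assumes X: "odd X" and a: "0 < a" "a < 1" shows "orbit_sum c (- a) (real X) \<le> 0"
proof -
  have X0: "X > 0" using X by (cases X) auto
  let ?h = "\<lambda>i. a ^ X / real X * (1 / real \<alpha>) ^ i"
  let ?g = "\<lambda>i. (- a) ^ (X * \<alpha> ^ i) / real (X * \<alpha> ^ i)"
  have sh: "summable ?h" using \<alpha>_ge_two by (intro summable_mult summable_geometric) auto
  have abs_g: "\<bar>?g i\<bar> \<le> ?h i" for i
  proof -
    have "X * 1 \<le> X * \<alpha> ^ i" using \<alpha>_ge_two by (intro mult_left_mono) auto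
    then have "a ^ (X * \<alpha> ^ i) \<le> a ^ X" using a by (intro power_decreasing) auto
    then have "a ^ (X * \<alpha> ^ i) / real (X * \<alpha> ^ i) \<le> a ^ X / real (X * \<alpha> ^ i)" by (intro divide_right_mono) auto
    then show ?thesis using a by (simp add: abs_divide power_abs power_divide)
  qed
  have sg: "summable ?g" by (rule summable_comparison_test[OF _ sh]) (use abs_g in auto)
  have "orbit_sum c (- a) (real X) = (\<Sum>i. ?g (Suc i)) + ?g 0"
    unfolding orbit_sum_nat[OF X0] using suminf_split_head[OF sg] by simp
  also have "?g 0 = - (a ^ X / real X)" using X by simp
  also have "(\<Sum>i. ?g (Suc i)) \<le> (\<Sum>i. a ^ X / real X * (1 / real \<alpha>) * (1 / real \<alpha>) ^ i)"
  proof (rule suminf_le)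
    show "?g (Suc i) \<le> a ^ X / real X * (1 / real \<alpha>) * (1 / real \<alpha>) ^ i" for i
      using abs_g[of "Suc i"] abs_ge_self[of "?g (Suc i)"] by (simp only: power_Suc mult.assoc)
    show "summable (\<lambda>i. ?g (Suc i))" using summable_Suc_iff[of ?g] sg by blast
    show "summable (\<lambda>i. a ^ X / real X * (1 / real \<alpha>) * (1 / real \<alpha>) ^ i)"
      using \<alpha>_ge_two by (intro summable_mult summable_geometric) auto
  qed
  also have "(\<Sum>i. a ^ X / real X * (1 / real \<alpha>) * (1 / real \<alpha>) ^ i) = a ^ X / real X * (1 / real \<alpha>) * (1 / (1 - 1 / real \<alpha>))"
    using \<alpha>_ge_two by (subst suminf_mult) (auto simp: suminf_geometric intro!: summable_geometric)
  also have "\<dots> = a ^ X / real X * (1 / (real \<alpha> - 1))"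
  proof -
    have "1 / real \<alpha> * (1 / (1 - 1 / real \<alpha>)) = 1 / (real \<alpha> - 1)" using \<alpha>_ge_two by (simp add: divide_simps)
    then show ?thesis by (simp only: mult.assoc)
  qed
  also have "\<dots> \<le> a ^ X / real X * 1" using \<alpha>_ge_two a by (intro mult_left_mono) auto
  finally show ?thesis by simp
qed

text \<open>Here \<beta> is the least integer with \<beta> l \<ge> K. An orbit is entered at its
  first natural X, and the positive side is compared from X \<alpha>^\<beta> on. Odd X is harmless,
  X = 2 m is \<open>F_fun_le_power\<close>, and X = 2 gives necessity.\<close>

lemma mu_weight_nonneg_iff_integer_power:
  assumes q: "0 \<le> q" "q < 1" and a: "0 < a" "a < 1"
    and K: "K \<ge> 1" and \<beta>: "(\<beta> - 1) * l < K" "K \<le> \<beta> * l"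
  shows "(\<forall>y>0. orbit_sum c (- a) y \<le> orbit_sum c q (y * c ^ K)) \<longleftrightarrow>
    0 < q \<and> a \<le> h_fun \<alpha> \<beta> (q ^ (\<alpha> ^ \<beta>))"
proof -
  let ?Q = "q ^ (\<alpha> ^ \<beta>)" and ?\<kappa> = "(1 / real \<alpha>) ^ \<beta>"
  have \<beta>1: "\<beta> \<ge> 1" using \<beta> K by (cases \<beta>) auto
  have Q: "0 \<le> ?Q" "?Q \<le> 1" using q by (auto intro: power_le_one)
  have Fq: "orbit_sum c q (real (2 * (m * \<alpha> ^ \<beta>))) = ?\<kappa> * F_fun \<alpha> (?Q ^ m) / real (2 * m)" if "m > 0" for m
  proof -
    have "q ^ (m * \<alpha> ^ \<beta>) = ?Q ^ m" by (simp add: mult.commute flip: power_mult)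
    moreover have "orbit_sum c q (real (2 * (m * \<alpha> ^ \<beta>))) = F_fun \<alpha> (q ^ (m * \<alpha> ^ \<beta>)) / real (2 * (m * \<alpha> ^ \<beta>))"
      using q that \<alpha>_ge_two by (intro orbit_sum_even) auto
    ultimately show ?thesis by (simp add: power_divide)
  qed
  have "(\<forall>y>0. orbit_sum c (- a) y \<le> orbit_sum c q (y * c ^ K)) \<longleftrightarrow> F_fun \<alpha> a \<le> ?\<kappa> * F_fun \<alpha> ?Q"
  proof
    assume "\<forall>y>0. orbit_sum c (- a) y \<le> orbit_sum c q (y * c ^ K)"
    then have le: "orbit_sum c (- a) 2 \<le> orbit_sum c q (2 * c ^ K)" by simp
    have "orbit_sum c q (2 * c ^ K) = orbit_sum c q (2 * c ^ K * c ^ (\<beta> * l - K))"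
    proof -
      \<comment> \<open>A natural here would make K + n a multiple of l strictly between (\<beta> -
        1) l and \<beta> l.\<close>
      have "geom_weight q (2 * c ^ K * c ^ n) = 0" if n: "n < \<beta> * l - K" for n
      proof (rule geom_weight_not_nat, rule notI)
        assume "2 * c ^ K * c ^ n \<in> \<nat>"
        then have "l dvd K + n" using nat_orbit_iff[of 2 "K + n"] by (simp add: power_add mult.assoc)
        then obtain i where i: "K + n = l * i" by blast
        have "(\<beta> - 1) * l < l * i" using \<beta>(1) i by linarith
        moreover have "l * i < \<beta> * l" using n i by linarith
        ultimately have "\<beta> - 1 < i" "i < \<beta>" using least_power by (simp_all add: mult.commute[of l])
        then show False by linarith
      qed
      then show ?thesis using orbit_sum_shift[of c q "2 * c ^ K" "\<beta> * l - K"] c q by simp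
    qed
    also have "2 * c ^ K * c ^ (\<beta> * l - K) = real (2 * (1 * \<alpha> ^ \<beta>))"
    proof -
      have "c ^ K * c ^ (\<beta> * l - K) = real \<alpha> ^ \<beta>"
        unfolding \<alpha> power_mult[symmetric] power_add[symmetric] using \<beta>(2) by (simp add: mult.commute)
      then show ?thesis by simp
    qed
    also have "orbit_sum c q (real (2 * (1 * \<alpha> ^ \<beta>))) = ?\<kappa> * F_fun \<alpha> ?Q / 2" using Fq[of 1] by simp
    finally have "orbit_sum c (- a) 2 \<le> ?\<kappa> * F_fun \<alpha> ?Q / 2" using le by simp
    moreover have "orbit_sum c (- a) 2 = F_fun \<alpha> a / 2" using orbit_sum_even(2)[of 1 a] a by simp
    ultimately show "F_fun \<alpha> a \<le> ?\<kappa> * F_fun \<alpha> ?Q" by simp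
  next
    assume le: "F_fun \<alpha> a \<le> ?\<kappa> * F_fun \<alpha> ?Q"
    have Qpos: "0 < ?Q"
    proof -
      have "0 < F_fun \<alpha> a" using F_fun_strict_mono[OF \<alpha>_ge_two, of 0 a] F_fun_zero[OF \<alpha>_ge_two] a by simp
      moreover have "F_fun \<alpha> a \<le> 0" if "?Q = 0" using le F_fun_zero[OF \<alpha>_ge_two] unfolding that by simp
      ultimately have "?Q \<noteq> 0" by fastforce
      then show ?thesis using Q(1) by linarith
    qed
    show "\<forall>y>0. orbit_sum c (- a) y \<le> orbit_sum c q (y * c ^ K)"
    proof (intro allI impI)
      fix y :: real assume y: "y > 0"
      show "orbit_sum c (- a) y \<le> orbit_sum c q (y * c ^ K)"
      proof (cases "\<exists>n. y * c ^ n \<in> \<nat>")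
        case False
        then have "orbit_sum c (- a) y = 0" by (simp add: orbit_sum_def geom_weight_not_nat)
        moreover have "0 \<le> orbit_sum c q (y * c ^ K)"
          unfolding orbit_sum_def using q c y by (intro suminf_nonneg summable_geom_weight_orbit geom_weight_nonneg) auto
        ultimately show ?thesis by simp
      next
        case True
        define n0 where "n0 = (LEAST n. y * c ^ n \<in> \<nat>)"
        obtain X where X: "y * c ^ n0 = real X" using LeastI_ex[OF True] by (auto simp: n0_def elim: Nats_cases)
        have "y * c ^ n0 > 0" using y c by simp
        then have X0: "X > 0" using X by simp
        have "geom_weight (- a) (y * c ^ n) = 0" if "n < n0" for n
          using not_less_Least[OF that[unfolded n0_def]] by (rule geom_weight_not_nat)
        then have 1: "orbit_sum c (- a) y = orbit_sum c (- a) (real X)"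
          using orbit_sum_shift[of c "- a" y n0] c a y X by simp
        have 2: "orbit_sum c q (real (X * \<alpha> ^ \<beta>)) \<le> orbit_sum c q (y * c ^ K)"
        proof -
          have "c ^ n0 * c ^ (\<beta> * l) = c ^ K * c ^ (n0 + (\<beta> * l - K))"
            unfolding power_add[symmetric] using \<beta>(2) by simp
          then have "y * c ^ n0 * c ^ (\<beta> * l) = y * c ^ K * c ^ (n0 + (\<beta> * l - K))" by (simp only: mult.assoc)
          moreover have "c ^ (\<beta> * l) = real \<alpha> ^ \<beta>" unfolding \<alpha> power_mult[symmetric] by (simp add: mult.commute)
          ultimately have e: "real (X * \<alpha> ^ \<beta>) = y * c ^ K * c ^ (n0 + (\<beta> * l - K))" using X by simp
          show ?thesis unfolding e using c q y by (intro orbit_sum_shift_le) auto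
        qed
        have "orbit_sum c (- a) (real X) \<le> orbit_sum c q (real (X * \<alpha> ^ \<beta>))"
        proof (cases "even X")
          case True
          then obtain m where m: "X = 2 * m" by blast
          have m0: "m > 0" using X0 m by simp
          have "F_fun \<alpha> (a ^ m) \<le> ?\<kappa> * F_fun \<alpha> (?Q ^ m)"
            using a Q Qpos m0 \<beta>1 le by (intro F_fun_le_power \<alpha>_ge_two) auto
          then have "F_fun \<alpha> (a ^ m) / real (2 * m) \<le> ?\<kappa> * F_fun \<alpha> (?Q ^ m) / real (2 * m)"
            by (intro divide_right_mono) auto
          then show ?thesis unfolding m using Fq[OF m0] orbit_sum_even(2)[OF m0, of a] a by (simp only: mult.assoc less_imp_le)
        next
          case False
          then have "orbit_sum c (- a) (real X) \<le> 0" using a by (rule orbit_sum_odd_nonpos)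
          also have "0 \<le> orbit_sum c q (real (X * \<alpha> ^ \<beta>))"
            unfolding orbit_sum_def using q c X0 \<alpha>_ge_two
            by (intro suminf_nonneg summable_geom_weight_orbit geom_weight_nonneg) auto
          finally show ?thesis .
        qed
        then show ?thesis using 1 2 by simp
      qed
    qed
  qed
  also have "\<dots> \<longleftrightarrow> 0 < q \<and> a \<le> h_fun \<alpha> \<beta> ?Q"
  \<comment> \<open>For q = 0 the value of \<open>h_fun\<close> at 0 is unspecified; the inequality
    between the values of F fails there because F vanishes at 0 and is positive at a.\<close>
  proof (cases "q = 0")
    case True
    then have Q0: "?Q = 0" using \<alpha>_ge_two by simp
    have "0 < F_fun \<alpha> a" using F_fun_strict_mono[OF \<alpha>_ge_two, of 0 a] F_fun_zero[OF \<alpha>_ge_two] a by simp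
    then have "\<not> F_fun \<alpha> a \<le> ?\<kappa> * F_fun \<alpha> ?Q" unfolding Q0 F_fun_zero[OF \<alpha>_ge_two] by simp
    then show ?thesis using True by blast
  next
    case False
    then have "0 < ?Q" using q by simp
    then show ?thesis using h_fun_ge_iff[OF \<alpha>_ge_two \<beta>1 _ Q(2) a] False q by simp
  qed
  finally show ?thesis .
qed

end

section \<open>Divisibility criteria\<close>

context compound_poisson_pair
begin

context
  fixes q a s :: real
  assumes u_pos: "u > 0" and w_pos: "w > 0" and neq: "u \<noteq> w"
    and q_def: "q = v / (u + v + w)" and a_def: "a = min (w / u) (u / w)" and s_def: "s = c powi k"
begin

lemma parameters: "0 \<le> q" "q < 1" "0 < a" "a < 1" "0 < s"
proof -
  show "0 \<le> q" "q < 1" using u_pos v w_pos by (simp_all add: q_def)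
  show "0 < a" using u_pos w_pos by (simp add: a_def)
  show "a < 1" using u_pos w_pos neq by (cases u w rule: linorder_cases) (simp_all add: a_def min_less_iff_disj)
  show "0 < s" using c by (simp add: s_def)
qed

text \<open>The constants of the two logarithm series combine to (1 - q) / (1 + a), and 1 - q = (u +
  w) / (u + v + w) is exactly the normalization left over from \<kappa> and \<theta>.\<close>

lemma cmod_cf_rho: "(cmod (\<kappa> z / \<theta> z))^2 = exp (cos_exponent (rho_weight q a s) z)"
proof -
  define A where "A = cmod (1 - complex_of_real q * iexp z)"
  define B where "B = cmod (1 + complex_of_real a * iexp (z / s))"
  let ?S = "u + v + w"
  have S: "?S > 0" using u_pos v w_pos by simp
  have qS: "?S * q = v" using S by (simp add: q_def)
  have "\<theta> z = complex_of_real ?S * (1 - complex_of_real q * iexp z)"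
    unfolding \<theta>_def right_diff_distrib mult.assoc[symmetric] of_real_mult[symmetric] qS by simp
  then have \<theta>A: "cmod (\<theta> z) = ?S * A" using S by (simp only: A_def norm_mult norm_of_real abs_of_pos)
  moreover have "cmod (\<theta> z) > 0" using \<theta>_nonzero[of z] by simp
  ultimately have A: "A > 0" using S by (simp add: zero_less_mult_iff)
  have B: "B > 0"
  proof -
    have "1 + complex_of_real a * iexp (z / s) \<noteq> 0"
    proof
      assume "1 + complex_of_real a * iexp (z / s) = 0"
      then have "complex_of_real a * iexp (z / s) = - 1" by (simp add: eq_neg_iff_add_eq_0 add.commute)
      then have "cmod (complex_of_real a * iexp (z / s)) = 1" by simp
      then show False using parameters by (simp add: norm_mult)
    qed
    then show ?thesis by (simp add: B_def)
  qed
  have "z * d = z / s" by (simp add: d_def s_def power_int_minus divide_inverse)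
  then have \<kappa>B: "(cmod (\<kappa> z))^2 = ((u + w) / (1 + a))^2 * B^2"
    unfolding \<kappa>_def B_def a_def by (simp only: cmod_add_iexp_square[OF u_pos w_pos])
  let ?R = "(1 - q) * B / (A * (1 + a))"
  have "2 * ln (1 - q) - 2 * ln A - (2 * ln (1 + a) - 2 * ln B) = 2 * ln ?R"
    using A B parameters by (simp add: ln_mult ln_div)
  moreover have "exp (2 * ln ?R) = ?R^2"
  proof -
    have "?R > 0" using A B parameters by simp
    then show ?thesis by (simp add: exp_double)
  qed
  ultimately have "exp (cos_exponent (rho_weight q a s) z) = ?R^2"
    unfolding A_def B_def by (simp only: cos_exponent_rho_weight[OF parameters c])
  moreover have "1 - q = (u + w) / ?S" using S by (simp add: q_def field_simps)
  moreover have "(cmod (\<kappa> z / \<theta> z))^2 = ((u + w) / ?S * B / (A * (1 + a)))^2"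
    unfolding norm_divide power_divide \<kappa>B \<theta>A by (simp add: power_divide power_mult_distrib)
  ultimately show ?thesis by simp
qed

lemma cmod_cf_mu: "(cmod (\<phi> z))^2 = exp (cos_exponent (mu_weight q a s c) z)"
proof (rule LIMSEQ_unique)
  show "(\<lambda>n. (cmod (\<Prod>i\<le>n. \<kappa> (z / c ^ i) / \<theta> (z / c ^ i)))^2) \<longlonglongrightarrow> (cmod (\<phi> z))^2"
    by (intro tendsto_power tendsto_norm \<phi>_LIMSEQ)
  have "(cmod (\<Prod>i\<le>n. \<kappa> (z / c ^ i) / \<theta> (z / c ^ i)))^2
      = exp (\<Sum>i\<le>n. cos_exponent (rho_weight q a s) (z / c ^ i))" for n
    unfolding prod_norm[symmetric] prod_power_distrib cmod_cf_rho by (simp add: exp_sum)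
  moreover have "(\<lambda>n. \<Sum>i\<le>n. cos_exponent (rho_weight q a s) (z / c ^ i))
      \<longlonglongrightarrow> cos_exponent (mu_weight q a s c) z"
    using cos_exponent_mu_weight[OF parameters c, of z] unfolding sums_def_le .
  ultimately show "(\<lambda>n. (cmod (\<Prod>i\<le>n. \<kappa> (z / c ^ i) / \<theta> (z / c ^ i)))^2)
      \<longlonglongrightarrow> exp (cos_exponent (mu_weight q a s c) z)"
    by (simp only: tendsto_exp)
qed

lemma char_symmetrization_rho:
  "char (symmetrization (rho M N L)) z = complex_of_real (exp (cos_exponent (rho_weight q a s) z))"
  by (simp only: symmetrization(2)[OF rho_law(1)] rho_law(2) cmod_cf_rho)

lemma char_symmetrization_mu:
  "char (symmetrization (mu c M N L)) z = complex_of_real (exp (cos_exponent (mu_weight q a s c) z))"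
  by (simp only: symmetrization(2)[OF mu_law(1)] mu_law(2) cmod_cf_mu)

lemma symmetrization_rho_ID_iff:
  "symmetrization (rho M N L) \<in> ID \<longleftrightarrow> (\<forall>x>0. 0 \<le> rho_weight q a s x)"
proof
  assume "symmetrization (rho M N L) \<in> ID"
  then show "\<forall>x>0. 0 \<le> rho_weight q a s x"
    using infinitely_divisible_imp_nonneg[OF _ summable_on_rho_weight[OF parameters c] char_symmetrization_rho] by blast
next
  assume "\<forall>x>0. 0 \<le> rho_weight q a s x"
  then show "symmetrization (rho M N L) \<in> ID"
    by (intro nonneg_imp_infinitely_divisible[OF symmetrization(1)[OF rho_law(1)] summable_on_rho_weight[OF parameters c] char_symmetrization_rho])
      blast
qed

lemma symmetrization_mu_ID_iff:
  "symmetrization (mu c M N L) \<in> ID \<longleftrightarrow> (\<forall>x>0. 0 \<le> mu_weight q a s c x)"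
proof
  assume "symmetrization (mu c M N L) \<in> ID"
  then show "\<forall>x>0. 0 \<le> mu_weight q a s c x"
    using infinitely_divisible_imp_nonneg[OF _ summable_on_mu_weight[OF parameters c] char_symmetrization_mu] by blast
next
  assume "\<forall>x>0. 0 \<le> mu_weight q a s c x"
  then show "symmetrization (mu c M N L) \<in> ID"
    by (intro nonneg_imp_infinitely_divisible[OF symmetrization(1)[OF mu_law(1)] summable_on_mu_weight[OF parameters c] char_symmetrization_mu])
      blast
qed

lemma symmetrization_rho_ID0_iff:
  "symmetrization (rho M N L) \<in> ID0 \<longleftrightarrow> \<not> (\<forall>x>0. 0 \<le> rho_weight q a s x)"
  using quasi_infinitely_divisible_cos_exponent[OF symmetrization(1)[OF rho_law(1)] summable_on_rho_weight[OF parameters c] char_symmetrization_rho]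
  by (simp only: ID0_def mem_Collect_eq symmetrization_rho_ID_iff simp_thms)

lemma symmetrization_mu_ID0_iff:
  "symmetrization (mu c M N L) \<in> ID0 \<longleftrightarrow> \<not> (\<forall>x>0. 0 \<le> mu_weight q a s c x)"
  using quasi_infinitely_divisible_cos_exponent[OF symmetrization(1)[OF mu_law(1)] summable_on_mu_weight[OF parameters c] char_symmetrization_mu]
  by (simp only: ID0_def mem_Collect_eq symmetrization_mu_ID_iff simp_thms)

end

end

theorem theorem7p5:
  fixes k :: int and c p q r u v w :: real
    and M :: "'a measure" and N L :: "real \<Rightarrow> 'a \<Rightarrow> real"
  assumes "c > 1"
    and "u \<ge> 0" "v \<ge> 0" "w \<ge> 0"
    and "p = u / (u + v + w)" "q = v / (u + v + w)" "r = w / (u + v + w)"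
    and "p \<ge> 0" "q \<ge> 0" "r \<ge> 0" "p + q + r = 1"
    and "p > 0" "r > 0" "p \<noteq> r"
    and "compound_poisson_process M (\<lambda>t \<omega>. (N t \<omega>, L t \<omega>)) (levy_measure c k u v w)"
  shows
    \<comment> \<open>(i)\<close>
    "(k = 0 \<longrightarrow>
        (min (r / p) (p / r) \<le> q \<longrightarrow>
           symmetrization (rho M N L) \<in> ID \<and> symmetrization (mu c M N L) \<in> ID) \<and>
        (min (r / p) (p / r) > q \<longrightarrow>
           symmetrization (rho M N L) \<in> ID0 \<and> symmetrization (mu c M N L) \<in> ID0))
     \<and> \<comment> \<open>(ii)\<close>
     (k > 0 \<longrightarrow>
        (symmetrization (rho M N L) \<in> ID \<longleftrightarrow>
           c powi k = 2 \<and> min ((r / p)^2) ((p / r)^2) \<le> q))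
     \<and> \<comment> \<open>(iii)\<close>
     (k > 0 \<longrightarrow>
        (symmetrization (mu c M N L) \<in> ID \<longleftrightarrow>
           min (r / p) (p / r) \<le> q \<or>
           ((\<exists>l\<in>{1..k}. c powi l = 2) \<and> min ((r / p)^2) ((p / r)^2) \<le> q)))
     \<and> \<comment> \<open>(iv)\<close>
     (k < 0 \<longrightarrow>
        (symmetrization (rho M N L) \<in> ID \<longleftrightarrow>
           (\<exists>l::nat. real l = 2 * c powi \<bar>k\<bar> \<and>
              q ^ l \<ge> real l / 2 * min ((r / p)^2) ((p / r)^2))))
     \<and> \<comment> \<open>(v)\<close>
     (k < 0 \<and> (\<forall>j::int. j \<ge> \<bar>k\<bar> \<longrightarrow> 2 * c powi j \<notin> \<nat>) \<longrightarrow>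
        symmetrization (mu c M N L) \<in> ID0)
     \<and> \<comment> \<open>(vi)\<close>
     (k < 0 \<and> (\<exists>j::nat. 1 \<le> j \<and> c ^ j \<in> \<nat>) \<longrightarrow>
        (\<forall>(l::nat) (\<alpha>::nat) (\<beta>::nat).
           l = (LEAST j::nat. 1 \<le> j \<and> c ^ j \<in> \<nat>) \<and> real \<alpha> = c ^ l \<and>
           int \<beta> = \<lceil>real_of_int \<bar>k\<bar> / real l\<rceil> \<longrightarrow>
           (symmetrization (mu c M N L) \<in> ID \<longleftrightarrow>
              q > 0 \<and> h_fun \<alpha> \<beta> (q ^ (\<alpha> ^ \<beta>)) \<ge> min (r / p) (p / r))))
     \<and> \<comment> \<open>(vii)\<close>
     (k < 0 \<and> (\<exists>j::nat. 1 \<le> j \<and> int j \<ge> \<bar>k\<bar> \<and> (\<exists>m::nat. odd m \<and> 2 * c ^ j = real m)) \<longrightarrow>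
        (\<exists>!j::nat. 1 \<le> j \<and> int j \<ge> \<bar>k\<bar> \<and> (\<exists>m::nat. odd m \<and> 2 * c ^ j = real m)) \<and>
        (\<forall>(j::nat) (\<alpha>::real).
           1 \<le> j \<and> int j \<ge> \<bar>k\<bar> \<and> (\<exists>m::nat. odd m \<and> 2 * c ^ j = real m) \<and>
           \<alpha> = c ^ j \<and> 2 * \<alpha> \<ge> 5 \<longrightarrow>
           (symmetrization (mu c M N L) \<in> ID \<longleftrightarrow>
              q powr (2 * \<alpha>) + (min (r / p) (p / r)) powr (2 * \<alpha>)
                \<ge> \<alpha> * (min (r / p) (p / r))^2)))"
proof -
  define a where "a = min (r / p) (p / r)"
  define s where "s = c powi k"
  define K where "K = nat \<bar>k\<bar>"
  have "u + v + w \<noteq> 0" using assms(5,12) by auto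
  then have S: "u + v + w > 0" using assms(2-4) by linarith
  have u_pos: "u > 0" and w_pos: "w > 0" using assms(5,7,12,13) S by (simp_all add: zero_less_divide_iff)
  have neq: "u \<noteq> w" using assms(5,7,14) by auto
  have "r / p = w / u" "p / r = u / w" using S by (simp_all add: assms(5,7))
  then have a_eq: "a = min (w / u) (u / w)" by (simp add: a_def)
  interpret compound_poisson_pair M N L c u v w k
    by unfold_locales (use assms(1-4,15) u_pos w_pos in auto)
  note pars = u_pos w_pos neq assms(6) a_eq s_def
  note rho_iff = symmetrization_rho_ID_iff[OF pars] and mu_iff = symmetrization_mu_ID_iff[OF pars]
  note rho0_iff = symmetrization_rho_ID0_iff[OF pars] and mu0_iff = symmetrization_mu_ID0_iff[OF pars]
  note q = parameters(1,2)[OF pars] and a = parameters(3,4)[OF pars]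
  note c = assms(1)
  have a2: "min ((r / p)^2) ((p / r)^2) = a^2"
  proof (cases "r / p \<le> p / r")
    case True
    then have "(r / p)^2 \<le> (p / r)^2" using assms(12,13) by (intro power_mono) auto
    then show ?thesis using True by (simp add: a_def)
  next
    case False
    then have "(p / r)^2 \<le> (r / p)^2" using assms(12,13) by (intro power_mono) auto
    then show ?thesis using False by (simp add: a_def min_absorb2)
  qed
  have pos: "s = c ^ K \<and> (K = 0 \<longleftrightarrow> k = 0)" if "k \<ge> 0"
    using that by (simp add: s_def K_def power_int_def)
  have neg: "s = 1 / c ^ K \<and> K \<ge> 1" if "k < 0"
    using that by (auto simp: s_def K_def power_int_def divide_inverse power_inverse)
  have abs_k: "int K = \<bar>k\<bar>" "c powi \<bar>k\<bar> = c ^ K" by (simp_all add: K_def power_int_def)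
  have cK: "c ^ K > 1" if "K \<ge> 1" using that c by (intro one_less_power) auto

  have i: "(symmetrization (rho M N L) \<in> ID \<longleftrightarrow> a \<le> q) \<and> (symmetrization (mu c M N L) \<in> ID \<longleftrightarrow> a \<le> q)
    \<and> (symmetrization (rho M N L) \<in> ID0 \<longleftrightarrow> \<not> a \<le> q) \<and> (symmetrization (mu c M N L) \<in> ID0 \<longleftrightarrow> \<not> a \<le> q)"
    if k: "k = 0"
  proof -
    have s: "s = 1" using k by (simp add: s_def)
    have "(\<forall>x>0. 0 \<le> mu_weight q a 1 c x) \<longleftrightarrow> a \<le> q"
      using mu_weight_nonneg_iff_ge_one[OF q a c, of 0] by simp
    then show ?thesis
      unfolding rho_iff mu_iff rho0_iff mu0_iff s rho_weight_nonneg_iff_one[OF q a] by blast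
  qed
  have ii: "symmetrization (rho M N L) \<in> ID \<longleftrightarrow> c powi k = 2 \<and> a^2 \<le> q" if k: "k > 0"
  proof -
    have "s > 1" using pos cK k by auto
    then show ?thesis unfolding rho_iff rho_weight_nonneg_iff_gt_one[OF q a \<open>s > 1\<close>] by (simp only: s_def)
  qed
  have iii: "symmetrization (mu c M N L) \<in> ID \<longleftrightarrow> a \<le> q \<or> (\<exists>l\<in>{1..k}. c powi l = 2) \<and> a^2 \<le> q" if k: "k > 0"
  proof -
    have "(\<exists>l\<in>{1..K}. c ^ l = 2) \<longleftrightarrow> (\<exists>l\<in>{1..k}. c powi l = 2)"
    proof
      assume "\<exists>l\<in>{1..K}. c ^ l = 2"
      then obtain l where "l \<in> {1..K}" "c ^ l = 2" by blast
      then have "int l \<in> {1..k}" "c powi int l = 2" using k by (auto simp: K_def)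
      then show "\<exists>l\<in>{1..k}. c powi l = 2" by blast
    next
      assume "\<exists>l\<in>{1..k}. c powi l = 2"
      then obtain l where "l \<in> {1..k}" "c powi l = 2" by blast
      then have "nat l \<in> {1..K}" "c ^ nat l = 2" by (auto simp: K_def power_int_def)
      then show "\<exists>l\<in>{1..K}. c ^ l = 2" by blast
    qed
    moreover have "s = c ^ K" using pos k by simp
    ultimately show ?thesis using mu_iff mu_weight_nonneg_iff_ge_one[OF q a c, of K] by simp
  qed
  have iv: "symmetrization (rho M N L) \<in> ID \<longleftrightarrow> (\<exists>l::nat. real l = 2 * c powi \<bar>k\<bar> \<and> real l / 2 * a^2 \<le> q ^ l)"
    if k: "k < 0"
  proof -
    have s: "s = 1 / c ^ K" and "c ^ K > 1" using neg[OF k] cK by auto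
    then show ?thesis unfolding rho_iff s abs_k by (intro rho_weight_nonneg_iff_lt_one[OF q a])
  qed
  have v: "symmetrization (mu c M N L) \<in> ID0" if k: "k < 0" and no: "\<forall>j::int. j \<ge> \<bar>k\<bar> \<longrightarrow> 2 * c powi j \<notin> \<nat>"
  proof -
    have s: "s = 1 / c ^ K" using neg[OF k] by simp
    have "2 * c ^ j \<notin> \<nat>" if "j \<ge> K" for j
    proof -
      have "int j \<ge> \<bar>k\<bar>" using that abs_k(1) by linarith
      then have "2 * c powi int j \<notin> \<nat>" using no by blast
      then show ?thesis by simp
    qed
    then show ?thesis unfolding mu0_iff s by (intro mu_weight_negative_no_half_integer_power[OF q a c])
  qed
  have vi: "symmetrization (mu c M N L) \<in> ID \<longleftrightarrow> q > 0 \<and> a \<le> h_fun \<alpha> \<beta> (q ^ (\<alpha> ^ \<beta>))"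
    if k: "k < 0" and ex: "\<exists>j::nat. 1 \<le> j \<and> c ^ j \<in> \<nat>" and l: "l = (LEAST j::nat. 1 \<le> j \<and> c ^ j \<in> \<nat>)"
      and \<alpha>: "real \<alpha> = c ^ l" and \<beta>: "int \<beta> = \<lceil>real_of_int \<bar>k\<bar> / real l\<rceil>" for l \<alpha> \<beta> :: nat
  proof -
    have s: "s = 1 / c ^ K" and K: "K \<ge> 1" using neg[OF k] by auto
    have l1: "l \<ge> 1" using least_power(1)[OF c l ex \<alpha>] .
    have kK: "real_of_int \<bar>k\<bar> = real K" by (simp add: K_def)
    have "real \<beta> = of_int \<lceil>real K / real l\<rceil>" using arg_cong[OF \<beta>, of real_of_int] unfolding kK by simp
    then have \<beta>': "real \<beta> - 1 < real K / real l" "real K / real l \<le> real \<beta>"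
      using ceiling_correct[of "real K / real l"] by simp_all
    then have "(real \<beta> - 1) * real l < real K" "real K \<le> real \<beta> * real l"
      using l1 by (simp_all add: pos_less_divide_eq pos_divide_le_eq)
    \<comment> \<open>This guards the truncated subtraction \<open>\<beta> - 1\<close> on the
      naturals.\<close>
    moreover have "\<beta> \<ge> 1"
    proof (rule ccontr)
      assume "\<not> \<beta> \<ge> 1"
      then have "\<beta> = 0" by simp
      then show False using \<open>real K \<le> real \<beta> * real l\<close> K by simp
    qed
    ultimately have "real ((\<beta> - 1) * l) < real K" "real K \<le> real (\<beta> * l)" by (simp_all add: of_nat_diff)
    then have "(\<beta> - 1) * l < K" "K \<le> \<beta> * l" by (simp_all only: of_nat_less_iff of_nat_le_iff)
    then show ?thesis
      unfolding mu_iff s mu_weight_nonneg_iff_orbit_sum[OF q a c]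
      by (intro mu_weight_nonneg_iff_integer_power[OF c l ex \<alpha> q a K])
  qed
  have vii: "symmetrization (mu c M N L) \<in> ID \<longleftrightarrow> \<alpha> * a^2 \<le> q powr (2 * \<alpha>) + a powr (2 * \<alpha>)"
    if k: "k < 0" and j: "int j \<ge> \<bar>k\<bar>" and m: "odd m" "2 * c ^ j = real m" and \<alpha>: "\<alpha> = c ^ j" "2 * \<alpha> \<ge> 5"
    for j m :: nat and \<alpha> :: real
  proof -
    have s: "s = 1 / c ^ K" and K: "1 \<le> K" "K \<le> j" using neg[OF k] j abs_k(1) by auto
    have \<alpha>m: "2 * \<alpha> = real m" "\<alpha> = real m / 2" using m(2) \<alpha>(1) by simp_all
    then have m5: "m \<ge> 5" using \<alpha>(2) by simp
    \<comment> \<open>The value 0 is allowed because q may vanish; there \<open>powr\<close> and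
      \<open>^\<close> agree since m is positive.\<close>
    have "x powr real m = x ^ m" if "x \<ge> 0" for x :: real
      using that m5 by (cases "x = 0") (simp_all add: powr_realpow)
    then have powr: "q powr (2 * \<alpha>) + a powr (2 * \<alpha>) = q ^ m + a ^ m" using q a unfolding \<alpha>m(1) by simp
    show ?thesis
      unfolding mu_iff s powr unfolding \<alpha>m(2) by (rule mu_weight_nonneg_iff_half_odd[OF q a c K m(2,1) m5])
  qed
  have unique: "\<exists>!j::nat. 1 \<le> j \<and> int j \<ge> \<bar>k\<bar> \<and> (\<exists>m::nat. odd m \<and> 2 * c ^ j = real m)"
    if ex: "\<exists>j::nat. 1 \<le> j \<and> int j \<ge> \<bar>k\<bar> \<and> (\<exists>m::nat. odd m \<and> 2 * c ^ j = real m)"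
  proof (rule ex_ex1I[OF ex])
    fix j n :: nat
    assume "1 \<le> j \<and> int j \<ge> \<bar>k\<bar> \<and> (\<exists>m::nat. odd m \<and> 2 * c ^ j = real m)"
      and "1 \<le> n \<and> int n \<ge> \<bar>k\<bar> \<and> (\<exists>m::nat. odd m \<and> 2 * c ^ n = real m)"
    then show "j = n" using half_odd_power_unique[OF c] by blast
  qed
  show ?thesis
    unfolding a2 a_def[symmetric]
  proof (intro conjI)
    show "k = 0 \<longrightarrow>
        (a \<le> q \<longrightarrow> symmetrization (rho M N L) \<in> ID \<and> symmetrization (mu c M N L) \<in> ID) \<and>
        (a > q \<longrightarrow> symmetrization (rho M N L) \<in> ID0 \<and> symmetrization (mu c M N L) \<in> ID0)"
      using i by (simp add: not_le)
  next
    show "k < 0 \<and> (\<exists>j::nat. 1 \<le> j \<and> c ^ j \<in> \<nat>) \<longrightarrow>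
        (\<forall>(l::nat) (\<alpha>::nat) (\<beta>::nat).
           l = (LEAST j::nat. 1 \<le> j \<and> c ^ j \<in> \<nat>) \<and> real \<alpha> = c ^ l \<and>
           int \<beta> = \<lceil>real_of_int \<bar>k\<bar> / real l\<rceil> \<longrightarrow>
           (symmetrization (mu c M N L) \<in> ID \<longleftrightarrow> q > 0 \<and> h_fun \<alpha> \<beta> (q ^ (\<alpha> ^ \<beta>)) \<ge> a))"
      by (intro impI allI, elim conjE, rule vi)
  next
    show "k < 0 \<and> (\<exists>j::nat. 1 \<le> j \<and> int j \<ge> \<bar>k\<bar> \<and> (\<exists>m::nat. odd m \<and> 2 * c ^ j = real m)) \<longrightarrow>
        (\<exists>!j::nat. 1 \<le> j \<and> int j \<ge> \<bar>k\<bar> \<and> (\<exists>m::nat. odd m \<and> 2 * c ^ j = real m)) \<and>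
        (\<forall>(j::nat) (\<alpha>::real).
           1 \<le> j \<and> int j \<ge> \<bar>k\<bar> \<and> (\<exists>m::nat. odd m \<and> 2 * c ^ j = real m) \<and> \<alpha> = c ^ j \<and> 2 * \<alpha> \<ge> 5 \<longrightarrow>
           (symmetrization (mu c M N L) \<in> ID \<longleftrightarrow> q powr (2 * \<alpha>) + a powr (2 * \<alpha>) \<ge> \<alpha> * a^2))"
    proof (intro impI conjI allI, goal_cases)
      case 1
      then show ?case by (intro unique) (rule conjunct2)
    next
      case (2 j \<alpha>)
      then show ?case by (elim conjE exE) (rule vii)
    qed
  qed (use ii iii iv v in simp_all)
qed

end
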